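(* Let $\mathbb{W}$ be a super-reflexive Banach space, $\mathbb{U}$ a separable Hilbert space, $T>0$, $\alpha>0$, $\beta\ge0$, $0<\nu<1$, and let $\mathrm{A}:D(\mathrm{A})\subseteq\mathbb{W}\to\mathbb{W}$ be a closed, densely defined linear operator which is sectorial of angle $\frac{\nu\pi}{2}$ and such that $(\lambda_0\mathrm{I}-\mathrm{A})^{-1}$ is compact for some $\lambda_0\in\rho(\mathrm{A})$. Let $\mathrm{B}:\mathbb{U}\to\mathbb{W}$ be a bounded linear operator and $\kappa(t)=\alpha e^{-\beta t}\frac{t^{\nu-1}}{\Gamma(\nu)}$. Let $f:[0,T]\times\mathbb{W}\to\mathbb{W}$ satisfy: (i) for a.e. $t\in[0,T]$ the map $f(t,\cdot):\mathbb{W}\to\mathbb{W}$ is continuous, and for each $w\in\mathbb{W}$ the map $t\mapsto f(t,w)$ is strongly measurable on $[0,T]$; (ii) there exists $\gamma\in\mathrm{L}^1([0,T];\mathbb{R}^+)$ such that $\|f(t,w)\|_{\mathbb{W}}\le\gamma(t)$ for a.e. $t\in[0,T]$ and all $w\in\mathbb{W}$. If the linear system $$w'(t)=\mathrm{A}w(t)+\int_0^t\kappa(t-s)\mathrm{A}w(s)\,\mathrm{d}s+\mathrm{B}u(t),\quad t\in(0,T],\qquad w(0)=\zeta,$$ is approximately controllable on $[0,T]$, then the semilinear system $$w'(t)=\mathrm{A}w(t)+\int_0^t\kappa(t-s)\mathrm{A}w(s)\,\mathrm{d}s+\mathrm{B}u(t)+f(t,w(t)),\quad t\in(0,T],\qquad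 w(0)=\zeta,$$ is approximately controllable on $[0,T]$.
   Context: Mild solution: given $\zeta\in\mathbb{W}$ and $u\in\mathrm{L}^2([0,T];\mathbb{U})$, a mild solution of the semilinear system is a function $w\in C([0,T];\mathbb{W})$ with $w(t)=\mathscr{G}(t)\zeta+\int_0^t\mathscr{G}(t-s)[\mathrm{B}u(s)+f(s,w(s))]\,\mathrm{d}s$ for $t\in[0,T]$, where $\mathscr{G}$ is the $(\alpha,\beta,\nu)$-resolvent family generated by $\mathrm{A}$ (below); for the linear system take $f=0$. Approximate controllability: the (linear or semilinear) system is approximately controllable on $[0,T]$ if for every initial value $\zeta\in\mathbb{W}$, every desired state $\zeta_1\in\mathbb{W}$ and every $\epsilon>0$ there exist a control $u\in\mathrm{L}^2([0,T];\mathbb{U})$ and a corresponding mild solution $w$ such that $\|w(T)-\zeta_1\|_{\mathbb{W}}<\epsilon$. Super-reflexive: every Banach space finitely representable in $\mathbb{W}$ is reflexive (equivalently, $\mathbb{W}$ admits an equivalent uniformly convex norm). Sectorial operator: $\mathrm{A}$ is sectorial of angle $\theta\in(0,\frac{\pi}{2}]$ if $\Sigma_\theta:=\{\lambda\in\mathbb{C}\setminus\{0\}:|\arg(\lambda)|<\theta+\frac{\pi}{2}\}\subset\rho(\mathrm{A})$ and for each $\omega\in(0,\theta)$ there exists $K_\omega\ge1$ such that $\|(\lambda\mathrm{I}-\mathrm{A})^{-1}\|\le K_\omega/|\lambda|$ for all $0\ne\lambda\in\overline{\Sigma}_{\theta-\omega}$. (If the scalar field is real, resolvent set and resolvents are understood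 in the complexification.) $(\alpha,\beta,\nu)$-resolvent family: the family $(\mathscr{G}(t))_{t\ge0}=(\mathscr{G}_{\alpha,\beta}^{\nu}(t))_{t\ge 0}$ of bounded linear operators on $\mathbb{W}$ such that (a) $\mathscr{G}(\cdot)$ is strongly continuous on $[0,\infty)$ and $\mathscr{G}(0)=\mathrm{I}$; (b) $\mathscr{G}(t)z\in D(\mathrm{A})$ and $\mathscr{G}(t)\mathrm{A}z=\mathrm{A}\mathscr{G}(t)z$ for all $z\in D(\mathrm{A})$, $t\ge0$; (c) $\mathscr{G}(t)z=z+\int_0^t(1+1*\kappa)(t-s)\mathrm{A}\mathscr{G}(s)z\,\mathrm{d}s$ for all $z\in D(\mathrm{A})$, $t\ge0$, where $(1*\kappa)(t)=\int_0^t\kappa(s)\,\mathrm{d}s$. If $\mathrm{A}$ is sectorial of angle $\frac{\nu\pi}{2}$, such a family exists and is unique. *)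

theory Defs
  imports "HOL-Analysis.Analysis"
begin

section \<open>Real and complex scalars\<close>

text \<open>
  The scalar field \<open>K\<close> is \<^term>\<open>\<real> :: complex set\<close> or \<^term>\<open>UNIV :: complex set\<close>.  A normed space over
  \<open>K\<close> is a real normed space with an action \<open>c\<close> of \<open>K\<close>; values \<open>c a\<close> with \<open>a\<close> outside \<open>K\<close> are
  irrelevant.  A Hilbert space over \<open>K\<close> is a \<open>K\<close>-Banach space whose underlying real norm comes from a
  real inner product: in the complex case that one is the real part of the Hermitian inner product,
  which is recovered by polarization.
\<close>

definition scalar_field :: "complex set \<Rightarrow> bool" where
  "scalar_field K \<longleftrightarrow> K = \<real> \<or> K = UNIV"

definition scalar_action :: "complex set \<Rightarrow> (complex \<Rightarrow> 'a \<Rightarrow> 'a) \<Rightarrow> ('a::real_normed_vector) itself \<Rightarrow> bool" where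
  "scalar_action K c _ \<longleftrightarrow>
     (\<forall>r x. c (of_real r) x = r *\<^sub>R x) \<and>
     (\<forall>a\<in>K. \<forall>x y. c a (x + y) = c a x + c a y) \<and>
     (\<forall>a\<in>K. \<forall>b\<in>K. \<forall>x. c (a + b) x = c a x + c b x \<and> c (a * b) x = c a (c b x)) \<and>
     (\<forall>a\<in>K. \<forall>x. norm (c a x) = cmod a * norm x)"

definition subspace_over :: "complex set \<Rightarrow> (complex \<Rightarrow> 'a \<Rightarrow> 'a) \<Rightarrow> ('a::real_normed_vector) set \<Rightarrow> bool" where
  "subspace_over K c V \<longleftrightarrow> subspace V \<and> (\<forall>a\<in>K. \<forall>x\<in>V. c a x \<in> V)"

definition linear_over ::
    "complex set \<Rightarrow> (complex \<Rightarrow> 'a \<Rightarrow> 'a) \<Rightarrow> (complex \<Rightarrow> 'b \<Rightarrow> 'b) \<Rightarrow>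
     ('a::real_normed_vector) set \<Rightarrow> ('a \<Rightarrow> 'b::real_normed_vector) \<Rightarrow> bool" where
  "linear_over K c c' V L \<longleftrightarrow>
     (\<forall>x\<in>V. \<forall>y\<in>V. L (x + y) = L x + L y) \<and> (\<forall>a\<in>K. \<forall>x\<in>V. L (c a x) = c' a (L x))"


section \<open>Reflexivity and super-reflexivity\<close>

text \<open>
  Duals of a subspace \<open>Y\<close> of a normed space; functionals on \<open>Y\<close> are extended by zero outside \<open>Y\<close> so
  that they are determined by their values on \<open>Y\<close>.
\<close>

definition dual_over ::
    "complex set \<Rightarrow> (complex \<Rightarrow> 'a \<Rightarrow> 'a) \<Rightarrow> ('a::real_normed_vector) set \<Rightarrow> ('a \<Rightarrow> complex) set" where
  "dual_over K c Y = {\<phi>. linear_over K c (*) Y \<phi> \<and> \<phi> ` Y \<subseteq> K \<and>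
     (\<exists>M. \<forall>y\<in>Y. cmod (\<phi> y) \<le> M * norm y) \<and> (\<forall>y. y \<notin> Y \<longrightarrow> \<phi> y = 0)}"

definition dual_norm :: "('a::real_normed_vector) set \<Rightarrow> ('a \<Rightarrow> complex) \<Rightarrow> real" where
  "dual_norm Y \<phi> = (SUP y\<in>Y \<inter> cball 0 1. cmod (\<phi> y))"

definition bidual_over ::
    "complex set \<Rightarrow> (complex \<Rightarrow> 'a \<Rightarrow> 'a) \<Rightarrow> ('a::real_normed_vector) set \<Rightarrow> (('a \<Rightarrow> complex) \<Rightarrow> complex) set" where
  "bidual_over K c Y = {\<Phi>.
     (\<forall>\<phi>\<in>dual_over K c Y. \<forall>\<psi>\<in>dual_over K c Y. \<Phi> (\<lambda>y. \<phi> y + \<psi> y) = \<Phi> \<phi> + \<Phi> \<psi>) \<and>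
     (\<forall>a\<in>K. \<forall>\<phi>\<in>dual_over K c Y. \<Phi> (\<lambda>y. a * \<phi> y) = a * \<Phi> \<phi>) \<and>
     \<Phi> ` dual_over K c Y \<subseteq> K \<and>
     (\<exists>M. \<forall>\<phi>\<in>dual_over K c Y. cmod (\<Phi> \<phi>) \<le> M * dual_norm Y \<phi>)}"

definition reflexive_over ::
    "complex set \<Rightarrow> (complex \<Rightarrow> 'a \<Rightarrow> 'a) \<Rightarrow> ('a::real_normed_vector) set \<Rightarrow> bool" where
  "reflexive_over K c Y \<longleftrightarrow>
     (\<forall>\<Phi>\<in>bidual_over K c Y. \<exists>y\<in>Y. \<forall>\<phi>\<in>dual_over K c Y. \<Phi> \<phi> = \<phi> y)"

text \<open>
  \<open>Y\<close> is finitely representable in the whole space \<open>'b\<close>.  A \<open>K\<close>-subspace is finite-dimensional over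
  \<open>K\<close> iff it is finite-dimensional over the reals.  The almost isometry is normalized so that
  its inverse is a contraction.
\<close>

definition finitely_representable ::
    "complex set \<Rightarrow> (complex \<Rightarrow> 'a \<Rightarrow> 'a) \<Rightarrow> ('a::real_normed_vector) set \<Rightarrow>
     (complex \<Rightarrow> 'b \<Rightarrow> 'b) \<Rightarrow> ('b::real_normed_vector) itself \<Rightarrow> bool" where
  "finitely_representable K c Y c' _ \<longleftrightarrow>
     (\<forall>E. subspace_over K c E \<and> E \<subseteq> Y \<and> (\<exists>S. finite S \<and> E = span S) \<longrightarrow>
       (\<forall>\<epsilon>>0. \<exists>L::'a \<Rightarrow> 'b. linear_over K c c' E L \<and>
          (\<forall>x\<in>E. norm x \<le> norm (L x) \<and> norm (L x) \<le> (1 + \<epsilon>) * norm x)))"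

definition linf_scale :: "complex \<Rightarrow> (nat \<Rightarrow>\<^sub>C complex) \<Rightarrow> (nat \<Rightarrow>\<^sub>C complex)" where
  "linf_scale a y = Bcontfun (\<lambda>n. a * apply_bcontfun y n)"

text \<open>
  HOL cannot quantify over all Banach spaces inside a formula.  The test spaces \<open>Y\<close> range over the
  closed \<open>K\<close>-subspaces of the space of bounded complex sequences \<open>nat \<Rightarrow>\<^sub>C complex\<close> (\<open>nat\<close> is
  discrete), which include every separable \<open>K\<close>-Banach space up to isometry.  No generality is lost: a
  non-reflexive Banach space has a separable non-reflexive closed subspace, and finite
  representability passes to subspaces.
\<close>

definition super_reflexive ::
    "complex set \<Rightarrow> (complex \<Rightarrow> 'a \<Rightarrow> 'a) \<Rightarrow> ('a::banach) itself \<Rightarrow> bool" where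
  "super_reflexive K c _ \<longleftrightarrow>
     (\<forall>Y. subspace_over K linf_scale Y \<and> closed Y \<and>
          finitely_representable K linf_scale Y c TYPE('a) \<longrightarrow> reflexive_over K linf_scale Y)"


section \<open>Resolvents and sectorial operators\<close>

text \<open>
  An operator is given by its domain \<open>D\<close> and a function \<open>A\<close> whose values outside \<open>D\<close> are irrelevant.
  The next definitions concern a complex space with multiplication \<open>c\<close> by complex scalars.
\<close>

definition closed_operator :: "('a::real_normed_vector) set \<Rightarrow> ('a \<Rightarrow> 'a) \<Rightarrow> bool" where
  "closed_operator D A \<longleftrightarrow> closed ((\<lambda>x. (x, A x)) ` D)"

definition is_resolvent ::
    "(complex \<Rightarrow> 'a \<Rightarrow> 'a) \<Rightarrow> 'a set \<Rightarrow> ('a \<Rightarrow> 'a) \<Rightarrow> complex \<Rightarrow> ('a::real_normed_vector \<Rightarrow>\<^sub>L 'a) \<Rightarrow> bool" where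
  "is_resolvent c D A \<mu> R \<longleftrightarrow>
     (\<forall>x. blinfun_apply R x \<in> D \<and> c \<mu> (blinfun_apply R x) - A (blinfun_apply R x) = x) \<and>
     (\<forall>x\<in>D. blinfun_apply R (c \<mu> x - A x) = x)"

definition resolvent_set ::
    "(complex \<Rightarrow> 'a \<Rightarrow> 'a) \<Rightarrow> ('a::real_normed_vector) set \<Rightarrow> ('a \<Rightarrow> 'a) \<Rightarrow> complex set" where
  "resolvent_set c D A = {\<mu>. \<exists>R. is_resolvent c D A \<mu> R}"

definition resolvent ::
    "(complex \<Rightarrow> 'a \<Rightarrow> 'a) \<Rightarrow> ('a::real_normed_vector) set \<Rightarrow> ('a \<Rightarrow> 'a) \<Rightarrow> complex \<Rightarrow> 'a \<Rightarrow>\<^sub>L 'a" where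
  "resolvent c D A \<mu> = (THE R. is_resolvent c D A \<mu> R)"

definition compact_operator :: "('a::real_normed_vector \<Rightarrow>\<^sub>L 'a) \<Rightarrow> bool" where
  "compact_operator R \<longleftrightarrow> compact (closure (blinfun_apply R ` cball 0 1))"

definition sector :: "real \<Rightarrow> complex set" where
  "sector \<theta> = {\<mu>. \<mu> \<noteq> 0 \<and> \<bar>Arg \<mu>\<bar> < \<theta> + pi / 2}"

definition complex_sectorial ::
    "(complex \<Rightarrow> 'a \<Rightarrow> 'a) \<Rightarrow> ('a::real_normed_vector) set \<Rightarrow> ('a \<Rightarrow> 'a) \<Rightarrow> real \<Rightarrow> bool" where
  "complex_sectorial c D A \<theta> \<longleftrightarrow>
     0 < \<theta> \<and> \<theta> \<le> pi / 2 \<and> sector \<theta> \<subseteq> resolvent_set c D A \<and>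
     (\<forall>\<omega>. 0 < \<omega> \<and> \<omega> < \<theta> \<longrightarrow>
        (\<exists>M\<ge>1. \<forall>\<mu>. \<mu> \<noteq> 0 \<and> \<mu> \<in> closure (sector (\<theta> - \<omega>)) \<longrightarrow>
           norm (resolvent c D A \<mu>) \<le> M / cmod \<mu>))"

definition complex_compact_resolvent ::
    "(complex \<Rightarrow> 'a \<Rightarrow> 'a) \<Rightarrow> ('a::real_normed_vector) set \<Rightarrow> ('a \<Rightarrow> 'a) \<Rightarrow> bool" where
  "complex_compact_resolvent c D A \<longleftrightarrow>
     (\<exists>\<mu>\<in>resolvent_set c D A. compact_operator (resolvent c D A \<mu>))"

text \<open>
  The complexification of a real space \<open>'a\<close> is \<open>'a \<times> 'a\<close>, where \<open>(x, y)\<close> stands for \<open>x + i y\<close>, and \<open>A\<close>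
  acts there as \<^term>\<open>map_prod A A\<close> on \<^term>\<open>D \<times> D\<close>.  The product norm is equivalent to every
  complexification norm, which is all that boundedness, compactness and the existence of the
  constants \<open>M\<close> above depend on.
\<close>

definition complexification_scale :: "complex \<Rightarrow> 'a \<times> 'a \<Rightarrow> 'a \<times> ('a::real_vector)" where
  "complexification_scale \<mu> z =
     (Re \<mu> *\<^sub>R fst z - Im \<mu> *\<^sub>R snd z, Re \<mu> *\<^sub>R snd z + Im \<mu> *\<^sub>R fst z)"

definition sectorial ::
    "complex set \<Rightarrow> (complex \<Rightarrow> 'a \<Rightarrow> 'a) \<Rightarrow> ('a::real_normed_vector) set \<Rightarrow> ('a \<Rightarrow> 'a) \<Rightarrow> real \<Rightarrow> bool" where
  "sectorial K c D A \<theta> \<longleftrightarrow>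
     (if K = UNIV then complex_sectorial c D A \<theta>
      else complex_sectorial complexification_scale (D \<times> D) (map_prod A A) \<theta>)"

definition compact_resolvent ::
    "complex set \<Rightarrow> (complex \<Rightarrow> 'a \<Rightarrow> 'a) \<Rightarrow> ('a::real_normed_vector) set \<Rightarrow> ('a \<Rightarrow> 'a) \<Rightarrow> bool" where
  "compact_resolvent K c D A \<longleftrightarrow>
     (if K = UNIV then complex_compact_resolvent c D A
      else complex_compact_resolvent complexification_scale (D \<times> D) (map_prod A A))"


section \<open>Separability from a compact resolvent\<close>

text \<open>
  A space carrying a densely defined operator with compact resolvent is separable.  Hence the sort
  constraint \<^class>\<open>second_countable_topology\<close>, which the Bochner integral of the library demands of
  the state space from here on, is no additional hypothesis; it also makes strong measurability the
  same as Borel measurability.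
\<close>

lemma compact_subset_closure_countable:
  fixes S :: "'a::metric_space set"
  assumes "compact S"
  shows "\<exists>C. countable C \<and> S \<subseteq> closure C"
proof -
  have "\<forall>n::nat. \<exists>k. finite k \<and> S \<subseteq> (\<Union>x\<in>k. ball x (1 / Suc n))"
    using assms by (simp add: compact_eq_totally_bounded)
  then obtain k where k: "\<And>n::nat. finite (k n)" "\<And>n. S \<subseteq> (\<Union>x\<in>k n. ball x (1 / Suc n))"
    by metis
  have "S \<subseteq> closure (\<Union>n. k n)"
  proof
    fix s assume s: "s \<in> S"
    have "\<exists>y\<in>\<Union>n. k n. dist y s < e" if "e > 0" for e
    proof -
      obtain n where n: "1 / Suc n < e" using \<open>e > 0\<close> by (meson nat_approx_posE)
      obtain x where "x \<in> k n" "dist x s < 1 / Suc n" using k(2)[of n] s by auto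
      then show ?thesis using n by (auto intro: less_trans)
    qed
    then show "s \<in> closure (\<Union>n. k n)" by (simp add: closure_approachable)
  qed
  moreover have "countable (\<Union>n. k n)" using k(1) by (auto intro: countable_finite)
  ultimately show ?thesis by blast
qed

lemma is_resolvent_unique:
  assumes "is_resolvent c D A \<mu> R" "is_resolvent c D A \<mu> R'"
  shows "R = R'"
  using assms by (intro blinfun_eqI) (metis is_resolvent_def)

lemma complex_compact_resolvent_countable:
  assumes "complex_compact_resolvent c D A"
  shows "\<exists>C. countable C \<and> D \<subseteq> closure C"
proof -
  obtain \<mu> where mu: "\<mu> \<in> resolvent_set c D A" "compact_operator (resolvent c D A \<mu>)"
    using assms by (auto simp: complex_compact_resolvent_def)
  define R where "R = resolvent c D A \<mu>"
  obtain Q where "is_resolvent c D A \<mu> Q" using mu(1) by (auto simp: resolvent_set_def)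
  then have R: "is_resolvent c D A \<mu> R"
    unfolding R_def resolvent_def using is_resolvent_unique by (metis (full_types) theI)
  define S where "S = closure (blinfun_apply R ` cball 0 1)"
  have "compact S" using mu(2) by (simp add: S_def R_def compact_operator_def)
  then have "\<exists>C. countable C \<and> (\<lambda>x. real n *\<^sub>R x) ` S \<subseteq> closure C" for n
    by (intro compact_subset_closure_countable compact_scaling)
  then obtain C where C: "\<And>n. countable (C n)" "\<And>n. (\<lambda>x. real n *\<^sub>R x) ` S \<subseteq> closure (C n)"
    by metis
  have "D \<subseteq> closure (\<Union>n. C n)"
  proof
    fix x assume "x \<in> D"
    then obtain y where y: "x = blinfun_apply R y" using R by (metis is_resolvent_def)
    obtain n :: nat where n: "norm y \<le> n" "n > 0"
      by (metis less_eq_real_def not_gr_zero of_nat_0_less_iff reals_Archimedean2 zero_less_one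
            le_less_trans norm_ge_zero)
    have "norm (y /\<^sub>R real n) \<le> 1" using n by (simp add: field_simps)
    then have "blinfun_apply R (y /\<^sub>R real n) \<in> S"
      unfolding S_def by (intro subsetD[OF closure_subset]) auto
    moreover have "x = real n *\<^sub>R blinfun_apply R (y /\<^sub>R real n)"
      using n by (simp add: y blinfun.scaleR_right)
    ultimately have "x \<in> closure (C n)" using C(2)[of n] by blast
    then show "x \<in> closure (\<Union>n. C n)" by (meson UNIV_I UN_upper closure_mono subsetD)
  qed
  moreover have "countable (\<Union>n. C n)" using C(1) by auto
  ultimately show ?thesis by blast
qed

lemma compact_resolvent_imp_separable:
  fixes D :: "'a::banach set"
  assumes "compact_resolvent K c D A" and "closure D = UNIV"
  shows "\<exists>C::'a set. countable C \<and> closure C = UNIV"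
proof -
  have "\<exists>C. countable C \<and> D \<subseteq> closure C"
  proof (cases "K = UNIV")
    case True
    then show ?thesis using assms(1) complex_compact_resolvent_countable
      by (auto simp: compact_resolvent_def)
  next
    case False
    then obtain C where C: "countable C" "D \<times> D \<subseteq> closure C"
      using assms(1) complex_compact_resolvent_countable by (metis compact_resolvent_def)
    have "D \<subseteq> fst ` (D \<times> D)" by auto
    also have "\<dots> \<subseteq> fst ` closure C" using C(2) by blast
    also have "\<dots> \<subseteq> closure (fst ` C)"
      by (intro image_closure_subset closure_subset closed_closure continuous_intros)
    finally show ?thesis using C(1) by blast
  qed
  then show ?thesis using assms(2) by (metis closure_closure closure_mono top.extremum_uniqueI)
qed


section \<open>Resolvent families, mild solutions and controllability\<close>

definition kernel :: "real \<Rightarrow> real \<Rightarrow> real \<Rightarrow> real \<Rightarrow> real" where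
  "kernel \<alpha> \<beta> \<nu> t = \<alpha> * exp (- \<beta> * t) * (t powr (\<nu> - 1) / Gamma \<nu>)"

definition resolvent_family ::
    "complex set \<Rightarrow> (complex \<Rightarrow> 'w \<Rightarrow> 'w) \<Rightarrow> 'w set \<Rightarrow> ('w \<Rightarrow> 'w) \<Rightarrow> (real \<Rightarrow> real) \<Rightarrow>
     (real \<Rightarrow> ('w::{banach, second_countable_topology}) \<Rightarrow>\<^sub>L 'w) \<Rightarrow> bool" where
  "resolvent_family K c D A \<kappa> G \<longleftrightarrow>
     (\<forall>t\<ge>0. linear_over K c c UNIV (blinfun_apply (G t))) \<and>
     (\<forall>z. continuous_on {0..} (\<lambda>t. blinfun_apply (G t) z)) \<and> G 0 = id_blinfun \<and>
     (\<forall>z\<in>D. \<forall>t\<ge>0. blinfun_apply (G t) z \<in> D \<and>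
        blinfun_apply (G t) (A z) = A (blinfun_apply (G t) z)) \<and>
     (\<forall>z\<in>D. \<forall>t\<ge>0. blinfun_apply (G t) z = z +
        (LINT s|lebesgue_on {0..t}.
           (1 + (LINT r|lebesgue_on {0..t - s}. \<kappa> r)) *\<^sub>R A (blinfun_apply (G s) z)))"

definition L2_control :: "real \<Rightarrow> (real \<Rightarrow> 'u::{real_inner, banach, second_countable_topology}) \<Rightarrow> bool" where
  "L2_control T u \<longleftrightarrow>
     u \<in> borel_measurable (lebesgue_on {0..T}) \<and> integrable (lebesgue_on {0..T}) (\<lambda>t. (norm (u t))\<^sup>2)"

definition mild_solution ::
    "(real \<Rightarrow> 'w \<Rightarrow>\<^sub>L 'w) \<Rightarrow> ('u \<Rightarrow>\<^sub>L 'w) \<Rightarrow> (real \<Rightarrow> 'w \<Rightarrow> 'w) \<Rightarrow> real \<Rightarrow> 'w \<Rightarrow>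
     (real \<Rightarrow> 'u::{real_inner, banach, second_countable_topology}) \<Rightarrow>
     (real \<Rightarrow> 'w::{banach, second_countable_topology}) \<Rightarrow> bool" where
  "mild_solution G B f T \<zeta> u w \<longleftrightarrow>
     continuous_on {0..T} w \<and>
     (\<forall>t\<in>{0..T}.
        integrable (lebesgue_on {0..t})
          (\<lambda>s. blinfun_apply (G (t - s)) (blinfun_apply B (u s) + f s (w s))) \<and>
        w t = blinfun_apply (G t) \<zeta> +
          (LINT s|lebesgue_on {0..t}.
             blinfun_apply (G (t - s)) (blinfun_apply B (u s) + f s (w s))))"

text \<open>
  Approximate controllability on \<open>[0, T]\<close> of \<open>w' = A w + \<kappa> * A w + B u + f(t, w)\<close>, \<open>w(0) = \<zeta>\<close>.  The
  resolvent family generated by \<open>A\<close> exists and is unique on \<open>[0, \<infinity>)\<close>, so \<open>\<exists>G\<close> only names it.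
\<close>

definition approximately_controllable ::
    "complex set \<Rightarrow> (complex \<Rightarrow> 'w \<Rightarrow> 'w) \<Rightarrow> 'w set \<Rightarrow> ('w \<Rightarrow> 'w) \<Rightarrow> (real \<Rightarrow> real) \<Rightarrow>
     ('u::{real_inner, banach, second_countable_topology} \<Rightarrow>\<^sub>L 'w) \<Rightarrow>
     (real \<Rightarrow> 'w \<Rightarrow> 'w::{banach, second_countable_topology}) \<Rightarrow> real \<Rightarrow> bool" where
  "approximately_controllable K c D A \<kappa> B f T \<longleftrightarrow>
     (\<exists>G. resolvent_family K c D A \<kappa> G \<and>
        (\<forall>\<zeta> \<zeta>\<^sub>1. \<forall>\<epsilon>>0. \<exists>u w. L2_control T u \<and> mild_solution G B f T \<zeta> u w \<and> norm (w T - \<zeta>\<^sub>1) < \<epsilon>))"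

end

theory Submission
  imports Defs "HOL-Probability.Characteristic_Functions" "HOL-Probability.Sinc_Integral"
begin

text \<open>
  The resolvent family is shown to be compact for positive times.  For a test function \<open>\<phi>\<close>, the Laplace
  transform of \<open>t \<mapsto> \<phi> t *\<^sub>R G t z\<close> at \<open>\<mu>\<close> solves the resolvent equation of \<open>A\<close> with a right-hand side
  built from \<open>\<phi>'\<close> and from the transforms of the left shifts of \<open>\<phi>\<close>, weighted by the damped kernel.
  Far enough to the right the damped kernel has small mass, so the sectorial estimate closes on the
  supremum over all shifts and gives decay like \<open>1 / \<bar>\<mu>\<bar>\<close>; if \<open>\<phi> 0 = 0\<close>, the oscillation of the kernel
  improves it to \<open>1 / \<bar>\<mu>\<bar>\<^sup>2\<close>, uniformly for bounded \<open>z\<close>.  By Fourier inversion \<open>G\<close> is continuous in the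
  operator norm on \<open>(0, \<infinity>)\<close>, and the same equation for real \<open>\<mu>\<close> yields \<open>n R(n) G t \<rightarrow> G t\<close> in norm, where
  \<open>R(n)\<close> is the compact resolvent.

  Consequently all functions \<open>t \<mapsto> \<integral>\<^sub>0\<^sup>t G (t - s) (f s (w s)) ds\<close> lie in one compact subset of
  \<open>C([0, T]; W)\<close>.  The linear system can be steered close to each of the finitely many targets which
  this leaves, up to a small error.  Gluing these controls by a partition of unity depending on the
  state \<open>w\<close> gives a continuous compact map of \<open>C([0, T]; W)\<close>, and its Schauder fixed point is the
  mild solution sought.
\<close>

section \<open>Fixed points and compactness\<close>

text \<open>The obstacle is that \<open>G\<close> is known only through its Volterra equation on
  \<open>D\<close> and is merely strongly continuous. Compactness needs the operator norm, and a
  bound involving \<open>A z\<close> would not survive the passage from \<open>D\<close> to the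
  whole space; all estimates therefore see an orbit only through a bound on \<open>G t z\<close>
  itself. Test functions of bounded support replace the Laplace transform on the half-line, which
  would need growth control of \<open>G\<close>; the price is that the memory term produces shifted
  test functions. Two powers of \<mu> are wanted because 1 / |\<mu>| is not integrable along a
  vertical line; \<phi> 0 = 0 removes the initial value, and with it a possible failure of norm
  continuity at time 0. All transforms live in pairs of vectors, even when the scalars are already
  complex, so that one argument serves both scalar fields and only the half-plane Re \<mu> > 0 is
  visited. On the control side no continuous dependence of a control on its target is given; a
  finite net of targets reduces the choice to finitely many controls.\<close>

text \<open>
  Label a grid point \<open>q\<close> of the subdivided cube in direction \<open>i\<close> by the sign of \<open>h (q / p) i - q i / p\<close>;
  in the cell given by Kuhn's lemma every coordinate of the displacement changes sign.
\<close>

lemma approximate_Brouwer_cube: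
  fixes h :: "(nat \<Rightarrow> real) \<Rightarrow> nat \<Rightarrow> real"
  assumes range: "\<And>c i. \<forall>j<m. 0 \<le> c j \<and> c j \<le> 1 \<Longrightarrow> i < m \<Longrightarrow> 0 \<le> h c i \<and> h c i \<le> 1"
    and ucont: "\<And>e. e > 0 \<Longrightarrow> \<exists>d>0. \<forall>c c'. (\<forall>j<m. 0 \<le> c j \<and> c j \<le> 1) \<longrightarrow> (\<forall>j<m. 0 \<le> c' j \<and> c' j \<le> 1) \<longrightarrow>
        (\<forall>j<m. \<bar>c j - c' j\<bar> < d) \<longrightarrow> (\<forall>i<m. \<bar>h c i - h c' i\<bar> < e)"
    and e: "e > 0"
  shows "\<exists>c. (\<forall>j<m. 0 \<le> c j \<and> c j \<le> 1) \<and> (\<forall>i<m. \<bar>h c i - c i\<bar> < e)"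
proof -
  obtain d where d: "d > 0" and dh: "\<And>c c' i. \<lbrakk>\<forall>j<m. 0 \<le> c j \<and> c j \<le> 1; \<forall>j<m. 0 \<le> c' j \<and> c' j \<le> 1;
      \<forall>j<m. \<bar>c j - c' j\<bar> < d; i < m\<rbrakk> \<Longrightarrow> \<bar>h c i - h c' i\<bar> < e / 3"
    using ucont[of "e/3"] e by (metis divide_pos_pos zero_less_numeral)
  obtain k :: nat where k: "1 / Suc k < min d (e/3)"
    using d e by (metis divide_pos_pos min_less_iff_conj nat_approx_posE zero_less_numeral)
  define p where "p = Suc k"
  have p: "0 < p" "1 / real p < d" "1 / real p < e / 3" using k by (auto simp: p_def)
  define g where "g q = (\<lambda>j. real (q j) / real p)" for q :: "nat \<Rightarrow> nat"
  \<comment> \<open>Kuhn's lemma prescribes label 0 on the face \<open>q i = 0\<close> and label 1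
    on the face \<open>q i = p\<close>; there the assumption \<open>range\<close> gives the
    displacement the sign which the label stands for.\<close>
  define lab where "lab q i = (if q i = 0 then 0 else if q i = p then 1
      else if h (g q) i \<ge> g q i then 0 else 1::nat)" for q i
  obtain q where q: "\<forall>i<m. q i < p" and rs: "\<forall>i<m. \<exists>r s. (\<forall>j<m. q j \<le> r j \<and> r j \<le> q j + 1) \<and>
      (\<forall>j<m. q j \<le> s j \<and> s j \<le> q j + 1) \<and> lab r i \<noteq> lab s i"
    by (rule kuhn_lemma[of p m lab]) (use p in \<open>auto simp: lab_def\<close>)
  have cube: "\<forall>j<m. 0 \<le> g r j \<and> g r j \<le> 1" if "\<forall>j<m. q j \<le> r j \<and> r j \<le> q j + 1" for r
  proof (intro allI impI)
    fix j assume "j < m"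
    then have "r j \<le> p" using that q by (metis Suc_eq_plus1 Suc_leI le_trans)
    then show "0 \<le> g r j \<and> g r j \<le> 1" using p by (simp add: g_def)
  qed
  have near: "\<bar>g r j - g q j\<bar> \<le> 1 / p" if "\<forall>j<m. q j \<le> r j \<and> r j \<le> q j + 1" "j < m" for r j
  proof -
    have "g r j - g q j = (real (r j) - real (q j)) / p" by (simp add: g_def diff_divide_distrib)
    moreover have "0 \<le> real (r j) - real (q j)" "real (r j) - real (q j) \<le> 1"
      using that by (auto simp: le_Suc_eq)
    ultimately show ?thesis using p by (simp add: divide_right_mono)
  qed
  have cq: "\<forall>j<m. 0 \<le> g q j \<and> g q j \<le> 1" by (rule cube) auto
  \<comment> \<open>Inside the cell \<open>h\<close> varies by less than e/3 and the point by at
    most 1/p, so the sign of the displacement at any vertex becomes a one-sided bound at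
    \<open>q\<close>; e/3 + 1/p stays below e.\<close>
  have lab0: "h (g q) i - g q i \<ge> - (e/3 + 1/p)" if r: "\<forall>j<m. q j \<le> r j \<and> r j \<le> q j + 1" and i: "i < m" and "lab r i = 0" for r i
  proof -
    have "h (g r) i \<ge> g r i" using range[OF cube[OF r] i] that by (auto simp: lab_def g_def split: if_splits)
    moreover have "\<bar>h (g r) i - h (g q) i\<bar> < e/3" using dh[OF cube[OF r] cq _ i] near[OF r] p by (meson order_le_less_trans)
    ultimately show ?thesis using near[OF r i] by linarith
  qed
  have lab1: "h (g q) i - g q i \<le> e/3 + 1/p" if r: "\<forall>j<m. q j \<le> r j \<and> r j \<le> q j + 1" and i: "i < m" and "lab r i \<noteq> 0" for r i
  proof -
    have "h (g r) i \<le> g r i" using range[OF cube[OF r] i] that p by (auto simp: lab_def g_def split: if_splits)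
    moreover have "\<bar>h (g r) i - h (g q) i\<bar> < e/3" using dh[OF cube[OF r] cq _ i] near[OF r] p by (meson order_le_less_trans)
    ultimately show ?thesis using near[OF r i] by linarith
  qed
  have "\<bar>h (g q) i - g q i\<bar> < e" if "i < m" for i
  proof -
    obtain r s where r: "\<forall>j<m. q j \<le> r j \<and> r j \<le> q j + 1" and s: "\<forall>j<m. q j \<le> s j \<and> s j \<le> q j + 1"
      and ne: "lab r i \<noteq> lab s i" using rs \<open>i < m\<close> by metis
    have "lab r i = 0 \<or> lab r i = 1" "lab s i = 0 \<or> lab s i = 1" by (auto simp: lab_def)
    with ne consider "lab r i = 0" "lab s i \<noteq> 0" | "lab s i = 0" "lab r i \<noteq> 0" by linarith
    then have "h (g q) i - g q i \<ge> - (e/3 + 1/p) \<and> h (g q) i - g q i \<le> e/3 + 1/p"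
    proof cases
      case 1
      show ?thesis using lab0[OF r \<open>i < m\<close> 1(1)] lab1[OF s \<open>i < m\<close> 1(2)] by blast
    next
      case 2
      show ?thesis using lab0[OF s \<open>i < m\<close> 2(1)] lab1[OF r \<open>i < m\<close> 2(2)] by blast
    qed
    then show ?thesis using p e by (simp add: abs_less_iff)
  qed
  with cq show ?thesis by blast
qed

text \<open>Each step of the induction adds a segment, and a sum of compact sets is compact. The
  coefficients fill a cube instead of a simplex because the finite-dimensional fixed point argument
  runs on a cube.\<close>

lemma compact_unit_combinations:
  fixes y :: "nat \<Rightarrow> 'a::real_normed_vector"
  shows "compact {\<Sum>j<m. c j *\<^sub>R y j |c. \<forall>j<m. 0 \<le> c j \<and> c j \<le> (1::real)}"
proof (induction m)
  case (Suc m)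
  let ?H = "\<lambda>m. {\<Sum>j<m. c j *\<^sub>R y j |c. \<forall>j<m. 0 \<le> c j \<and> c j \<le> (1::real)}"
  have "compact ((\<lambda>r. r *\<^sub>R y m) ` {0..1::real})"
    by (intro compact_continuous_image continuous_intros) simp
  then have "compact {a + b |a b. a \<in> ?H m \<and> b \<in> (\<lambda>r. r *\<^sub>R y m) ` {0..1::real}}"
    using compact_sums[OF Suc] by auto
  also have "{a + b |a b. a \<in> ?H m \<and> b \<in> (\<lambda>r. r *\<^sub>R y m) ` {0..1::real}} = ?H (Suc m)"
  proof (intro equalityI subsetI)
    fix x assume "x \<in> {a + b |a b. a \<in> ?H m \<and> b \<in> (\<lambda>r. r *\<^sub>R y m) ` {0..1::real}}"
    then obtain c r where c: "\<forall>j<m. 0 \<le> c j \<and> c j \<le> 1" "0 \<le> r" "r \<le> 1" and x: "x = (\<Sum>j<m. c j *\<^sub>R y j) + r *\<^sub>R y m"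
      by auto
    then have "x = (\<Sum>j<Suc m. (c(m := r)) j *\<^sub>R y j)" by simp
    moreover have "\<forall>j<Suc m. 0 \<le> (c(m := r)) j \<and> (c(m := r)) j \<le> 1" using c by (auto simp: less_Suc_eq)
    ultimately show "x \<in> ?H (Suc m)" by blast
  next
    fix x assume "x \<in> ?H (Suc m)"
    then obtain c where c: "\<forall>j<Suc m. 0 \<le> c j \<and> c j \<le> 1" and x: "x = (\<Sum>j<Suc m. c j *\<^sub>R y j)" by auto
    have "(\<Sum>j<m. c j *\<^sub>R y j) \<in> ?H m" "c m *\<^sub>R y m \<in> (\<lambda>r. r *\<^sub>R y m) ` {0..1::real}" using c by auto
    then show "x \<in> {a + b |a b. a \<in> ?H m \<and> b \<in> (\<lambda>r. r *\<^sub>R y m) ` {0..1::real}}" unfolding x by auto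
  qed
  finally show ?case .
qed simp

section \<open>Partitions of unity and Schauder's fixed point theorem\<close>

text \<open>The partition of unity behind the Schauder projection. If no \<open>y j\<close> lies
  within \<open>e\<close> of \<open>x\<close>, the quotient is 0 / 0, which is 0.\<close>

definition net_weight :: "real \<Rightarrow> nat \<Rightarrow> (nat \<Rightarrow> 'a::metric_space) \<Rightarrow> nat \<Rightarrow> 'a \<Rightarrow> real" where
  "net_weight e m y i x = max 0 (e - dist x (y i)) / (\<Sum>j<m. max 0 (e - dist x (y j)))"

lemma net_weight_sum_pos:
  fixes y :: "nat \<Rightarrow> 'a::metric_space"
  assumes "i < m" "dist x (y i) < e"
  shows "(\<Sum>j<m. max 0 (e - dist x (y j))) > 0"
  using assms by (intro sum_pos2[where i = i]) auto

lemma net_weight_nonneg: "0 \<le> net_weight e m y i x"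
  unfolding net_weight_def by (intro divide_nonneg_nonneg sum_nonneg) auto

lemma net_weight_sum:
  assumes "\<exists>i<m. dist x (y i) < e"
  shows "(\<Sum>j<m. net_weight e m y j x) = 1"
  using assms net_weight_sum_pos[of _ m x y e] by (auto simp: net_weight_def simp flip: sum_divide_distrib)

lemma net_weight_le_1:
  assumes "\<exists>i<m. dist x (y i) < e" "j < m"
  shows "net_weight e m y j x \<le> 1"
  using member_le_sum[of j "{..<m}" "\<lambda>j. net_weight e m y j x"] assms net_weight_sum[OF assms(1)]
  by (simp add: net_weight_nonneg)

text \<open>A weight is nonzero only if \<open>y j\<close> lies within \<open>e\<close> of
  \<open>x\<close>, so the average involves only points \<open>z j\<close> within e + e' of
  \<open>x\<close>. The \<open>z j\<close> are kept apart from the net because the steering argument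
  averages perturbed net points.\<close>

lemma net_weight_average:
  fixes y z :: "nat \<Rightarrow> 'a::real_normed_vector"
  assumes "\<exists>i<m. dist x (y i) < e" and "\<And>i. i < m \<Longrightarrow> dist (y i) (z i) \<le> e'"
  shows "norm ((\<Sum>j<m. net_weight e m y j x *\<^sub>R z j) - x) \<le> e + e'"
proof -
  have "norm ((\<Sum>j<m. net_weight e m y j x *\<^sub>R z j) - x) = norm (\<Sum>j<m. net_weight e m y j x *\<^sub>R (z j - x))"
    using net_weight_sum[OF assms(1)] by (simp add: scaleR_diff_right sum_subtractf flip: scaleR_sum_left)
  also have "\<dots> \<le> (\<Sum>j<m. net_weight e m y j x * (e + e'))"
  proof (intro sum_norm_le)
    fix j assume j: "j \<in> {..<m}"
    show "norm (net_weight e m y j x *\<^sub>R (z j - x)) \<le> net_weight e m y j x * (e + e')"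
    proof (cases "dist x (y j) < e")
      case True
      have "norm (z j - x) \<le> e + e'"
        using True assms(2)[of j] j dist_triangle[of "z j" x "y j"] by (simp add: dist_norm[symmetric] dist_commute)
      then show ?thesis by (simp add: net_weight_nonneg mult_left_mono)
    next
      case False
      then have "net_weight e m y j x = 0" by (simp add: net_weight_def)
      then show ?thesis by simp
    qed
  qed
  also have "\<dots> = e + e'" using net_weight_sum[OF assms(1)] by (simp flip: sum_distrib_right)
  finally show ?thesis .
qed

lemma continuous_on_net_weight:
  fixes F :: "'b::topological_space \<Rightarrow> 'a::metric_space"
  assumes "continuous_on S F" "\<And>x. x \<in> S \<Longrightarrow> \<exists>i<m. dist (F x) (y i) < e"
  shows "continuous_on S (\<lambda>x. net_weight e m y i (F x))"
proof -
  have "(\<Sum>j<m. max 0 (e - dist (F x) (y j))) \<noteq> 0" if "x \<in> S" for x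
    using assms(2)[OF that] net_weight_sum_pos[of _ m "F x" y e] by force
  with assms(1) show ?thesis unfolding net_weight_def by (intro continuous_intros) auto
qed

lemma totally_bounded_nat_net:
  fixes C :: "'a::metric_space set"
  assumes "compact C" "e > 0"
  obtains m and y :: "nat \<Rightarrow> 'a" where "\<And>x. x \<in> C \<Longrightarrow> \<exists>i<m. dist x (y i) < e"
proof -
  obtain k where k: "finite k" "C \<subseteq> (\<Union>x\<in>k. ball x e)"
    using assms unfolding compact_eq_totally_bounded by blast
  obtain y where y: "bij_betw y {0..<card k} k" using ex_bij_betw_nat_finite[OF k(1)] by blast
  have "\<exists>i<card k. dist x (y i) < e" if "x \<in> C" for x
  proof -
    have "x \<in> (\<Union>x\<in>k. ball x e)" using k(2) that by blast
    then obtain z where z: "z \<in> k" "dist x z < e" using dist_commute_lessI by auto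
    then obtain i where "i < card k" "z = y i" using y unfolding bij_betw_def by (metis atLeastLessThan_iff imageE)
    then show ?thesis using z by blast
  qed
  then show thesis by (rule that)
qed

text \<open>Brouwer is applied to coefficients and not to points: \<open>h\<close> sends
  \<open>c\<close> to the weights of \<open>F (X c)\<close>. If \<open>h c\<close> is close to
  \<open>c\<close>, then \<open>X (h c)\<close> is close to \<open>X c\<close>, while averaging puts
  \<open>X (h c)\<close> close to \<open>F (X c)\<close>.\<close>

lemma approximate_Schauder:
  fixes F :: "'a::real_normed_vector \<Rightarrow> 'a"
  assumes cont: "continuous_on UNIV F" and C: "compact C" "\<And>x. F x \<in> C" and e: "e > 0"
  shows "\<exists>x. norm (F x - x) < e"
proof -
  obtain m and y :: "nat \<Rightarrow> 'a" where y: "\<And>x. x \<in> C \<Longrightarrow> \<exists>i<m. dist x (y i) < e / 2"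
    using totally_bounded_nat_net[OF C(1), of "e/2"] e by (metis half_gt_zero)
  define X where "X c = (\<Sum>j<m. c j *\<^sub>R y j)" for c :: "nat \<Rightarrow> real"
  define H where "H = {\<Sum>j<m. c j *\<^sub>R y j |c. \<forall>j<m. 0 \<le> c j \<and> c j \<le> (1::real)}"
  define h where "h c i = net_weight (e/2) m y i (F (X c))" for c i
  have net: "\<exists>i<m. dist (F x) (y i) < e/2" for x using y C(2) by blast
  \<comment> \<open>A Lipschitz constant of \<open>X\<close> for the maximum norm of the
    coefficients; the summand 1 keeps it positive when all \<open>y j\<close> vanish or m =
    0.\<close>
  define N where "N = (\<Sum>j<m. norm (y j)) + 1"
  have N: "N > 0" by (simp add: N_def add_nonneg_pos sum_nonneg)
  have XH: "X c \<in> H" if "\<forall>j<m. 0 \<le> c j \<and> c j \<le> 1" for c using that by (auto simp: X_def H_def)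
  have Xlip: "norm (X c - X c') \<le> d * N" if "\<forall>j<m. \<bar>c j - c' j\<bar> \<le> d" "d \<ge> 0" for c c' d
  proof -
    have "X c - X c' = (\<Sum>j<m. (c j - c' j) *\<^sub>R y j)" by (simp add: X_def sum_subtractf scaleR_diff_left)
    also have "norm \<dots> \<le> (\<Sum>j<m. d * norm (y j))" using that by (intro sum_norm_le) (auto intro: mult_right_mono)
    also have "\<dots> \<le> d * N" using that by (simp add: N_def sum_distrib_left algebra_simps)
    finally show ?thesis .
  qed
  have "\<exists>c. (\<forall>j<m. 0 \<le> c j \<and> c j \<le> 1) \<and> (\<forall>i<m. \<bar>h c i - c i\<bar> < e / (2 * N))"
  proof (rule approximate_Brouwer_cube)
    show "0 \<le> h c i \<and> h c i \<le> 1" if "i < m" for c i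
      using net that by (simp add: h_def net_weight_nonneg net_weight_le_1)
    show "\<exists>d>0. \<forall>c c'. (\<forall>j<m. 0 \<le> c j \<and> c j \<le> 1) \<longrightarrow> (\<forall>j<m. 0 \<le> c' j \<and> c' j \<le> 1) \<longrightarrow>
        (\<forall>j<m. \<bar>c j - c' j\<bar> < d) \<longrightarrow> (\<forall>i<m. \<bar>h c i - h c' i\<bar> < \<eta>)" if \<eta>: "\<eta> > 0" for \<eta>
    proof -
      have "\<exists>d>0. \<forall>x\<in>H. \<forall>x'\<in>H. dist x' x < d \<longrightarrow>
          dist (net_weight (e/2) m y i (F x')) (net_weight (e/2) m y i (F x)) < \<eta>" for i
      proof -
        have "uniformly_continuous_on H (\<lambda>x. net_weight (e/2) m y i (F x))"
          using net cont by (intro compact_uniformly_continuous continuous_on_net_weight)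
            (auto simp: H_def compact_unit_combinations intro: continuous_on_subset)
        then show ?thesis using \<eta> by (simp add: uniformly_continuous_on_def)
      qed
      then obtain d where d: "\<And>i. d i > 0" "\<And>i x x'. \<lbrakk>x \<in> H; x' \<in> H; dist x' x < d i\<rbrakk> \<Longrightarrow>
          dist (net_weight (e/2) m y i (F x')) (net_weight (e/2) m y i (F x)) < \<eta>" by metis
      define \<delta> where "\<delta> = Min (insert 1 (d ` {..<m}))"
      have \<delta>: "\<delta> > 0" "\<And>i. i < m \<Longrightarrow> \<delta> \<le> d i" using d(1) by (auto simp: \<delta>_def)
      have "\<bar>h c i - h c' i\<bar> < \<eta>" if c: "\<forall>j<m. 0 \<le> c j \<and> c j \<le> 1" "\<forall>j<m. 0 \<le> c' j \<and> c' j \<le> 1"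
        "\<forall>j<m. \<bar>c j - c' j\<bar> < \<delta> / (2 * N)" "i < m" for c c' i
      proof -
        have "norm (X c - X c') \<le> \<delta> / (2 * N) * N" using c \<delta> N by (intro Xlip) (auto intro: less_imp_le)
        also have "\<dots> < d i" using N \<delta>(1) \<delta>(2)[OF c(4)] by simp
        finally have "dist (X c) (X c') < d i" by (simp add: dist_norm)
        from d(2)[OF XH[OF c(2)] XH[OF c(1)] this] show ?thesis by (simp add: h_def dist_real_def)
      qed
      then show ?thesis using \<delta> N by (intro exI[of _ "\<delta> / (2 * N)"]) auto
    qed
  qed (use e N in auto)
  then obtain c where c: "\<forall>j<m. 0 \<le> c j \<and> c j \<le> 1" "\<forall>i<m. \<bar>h c i - c i\<bar> < e / (2 * N)" by blast
  have "norm (X (h c) - F (X c)) \<le> e/2 + 0" unfolding X_def h_def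
    by (rule net_weight_average) (use net in \<open>auto simp: X_def\<close>)
  moreover have "norm (X (h c) - X c) < e/2"
  proof -
    \<comment> \<open>\<open>Max\<close> of an empty set is unspecified, hence the case m = 0 apart.
      The maximum keeps the inequality strict after scaling by \<open>N\<close>.\<close>
    define d where "d = (if m = 0 then 0 else Max ((\<lambda>i. \<bar>h c i - c i\<bar>) ` {..<m}))"
    have "d < e / (2 * N)" using c(2) e N by (auto simp: d_def intro!: Max_less_iff[THEN iffD2])
    moreover have "\<forall>i<m. \<bar>h c i - c i\<bar> \<le> d" by (auto simp: d_def)
    moreover have "d \<ge> 0"
    proof (cases "m = 0")
      case False
      then have "\<bar>h c 0 - c 0\<bar> \<le> d" using \<open>\<forall>i<m. \<bar>h c i - c i\<bar> \<le> d\<close> by blast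
      then show ?thesis by linarith
    qed (simp add: d_def)
    ultimately have "norm (X (h c) - X c) \<le> d * N" "d * N < e / (2*N) * N"
      using Xlip[of "h c" c d] N by (simp, metis mult_strict_right_mono)
    then show ?thesis using N by auto
  qed
  ultimately have "norm (F (X c) - X c) < e"
    using norm_triangle_ineq[of "F (X c) - X (h c)" "X (h c) - X c"] by (simp add: norm_minus_commute)
  then show ?thesis by blast
qed

text \<open>\<open>F\<close> is defined on the whole space with values in a compact set, so no
  convex domain has to be named. A limit point of the values \<open>F (x n)\<close> at almost fixed
  points is a limit point of the \<open>x n\<close> as well, hence fixed.\<close>

theorem Schauder_fixed_point:
  fixes F :: "'a::real_normed_vector \<Rightarrow> 'a"
  assumes cont: "continuous_on UNIV F" and C: "compact C" "\<And>x. F x \<in> C"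
  obtains x where "F x = x"
proof -
  have "\<exists>x. norm (F x - x) < 1 / Suc n" for n
    by (rule approximate_Schauder[OF assms]) simp
  then obtain x where x: "\<And>n::nat. norm (F (x n) - x n) < 1 / Suc n" by metis
  obtain p r where p: "strict_mono r" "(\<lambda>n. F (x (r n))) \<longlonglongrightarrow> p"
    using C(2) C(1)[unfolded compact_def, rule_format, of "\<lambda>n. F (x n)"] unfolding o_def by blast
  have "(\<lambda>n. F (x n) - x n) \<longlonglongrightarrow> 0"
    by (rule Lim_null_comparison[OF _ LIMSEQ_Suc[OF lim_inverse_n']]) (use x in \<open>auto intro!: always_eventually less_imp_le\<close>)
  from LIMSEQ_subseq_LIMSEQ[OF this p(1)] have "(\<lambda>n. F (x (r n)) - x (r n)) \<longlonglongrightarrow> 0" by (simp add: o_def)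
  from tendsto_diff[OF p(2) this] have xp: "(\<lambda>n. x (r n)) \<longlonglongrightarrow> p" by simp
  have "(\<lambda>n. F (x (r n))) \<longlonglongrightarrow> F p"
    by (rule continuous_on_tendsto_compose[OF cont xp]) auto
  with p(2) have "F p = p" using LIMSEQ_unique by blast
  then show thesis by (rule that)
qed

section \<open>Uniform boundedness\<close>

text \<open>Baire's theorem gives one level set \<open>F n\<close> with an interior point. A ball in
  it bounds all \<open>G i\<close> on a sphere, since \<open>G i u\<close> is a difference of two
  values on the ball.\<close>

lemma uniform_boundedness_principle:
  fixes G :: "'i \<Rightarrow> 'a::banach \<Rightarrow>\<^sub>L 'b::real_normed_vector"
  assumes ptw: "\<And>x. \<exists>M. \<forall>i\<in>I. norm (G i x) \<le> M"
  shows "\<exists>M\<ge>0. \<forall>i\<in>I. norm (G i) \<le> M"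
proof -
  define F where "F n = {x. \<forall>i\<in>I. norm (G i x) \<le> real n}" for n :: nat
  have clF: "closed (F n)" for n
  proof -
    have "F n = (\<Inter>i\<in>I. {x. norm (G i x) \<le> real n})" by (auto simp: F_def)
    then show ?thesis by (auto intro!: closed_INT closed_Collect_le continuous_intros)
  qed
  have "\<exists>n. interior (F n) \<noteq> {}"
  proof (rule ccontr)
    assume "\<not> ?thesis"
    then have "Met_TC.mtopology interior_of \<Union>(range F) = {}"
      using clF complete_UNIV[where 'a='a] by (intro Met_TC.metric_Baire_category_alt) (auto simp: mcomplete_iff_complete)
    moreover have "\<Union>(range F) = UNIV"
    proof -
      have "\<exists>n. x \<in> F n" for x
      proof -
        obtain M where "\<forall>i\<in>I. norm (G i x) \<le> M" using ptw by blast
        moreover obtain n :: nat where "M \<le> n" using real_arch_simple by blast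
        ultimately show ?thesis by (auto simp: F_def intro: order_trans)
      qed
      then show ?thesis by auto
    qed
    ultimately show False by simp
  qed
  then obtain n x0 where "x0 \<in> interior (F n)" by blast
  then obtain e where e: "e > 0" "cball x0 e \<subseteq> F n"
    by (meson mem_interior_cball)
  have "norm (G i) \<le> 2 * real n / e" if i: "i \<in> I" for i
  proof (rule norm_blinfun_bound)
    show "norm (G i x) \<le> 2 * real n / e * norm x" for x
    proof (cases "x = 0")
      case False
      define u where "u = (e / norm x) *\<^sub>R x"
      have nu: "norm u = e" using False e by (simp add: u_def)
      have "x0 \<in> F n" "x0 + u \<in> F n" using e nu by (auto simp: subset_iff dist_norm)
      then have "norm (G i x0) \<le> n" "norm (G i (x0 + u)) \<le> n" using i by (auto simp: F_def)
      moreover have "G i u = G i (x0 + u) - G i x0" by (simp add: blinfun.add_right)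
      ultimately have "norm (G i u) \<le> 2 * n" using norm_triangle_ineq4[of "G i (x0 + u)" "G i x0"] by simp
      then show ?thesis using False e by (simp add: u_def blinfun.scaleR_right field_simps)
    qed (simp add: blinfun.zero_right)
  qed (use e in auto)
  then show ?thesis using e by (intro exI[of _ "2 * real n / e"]) auto
qed

lemma strongly_continuous_locally_bounded:
  fixes G :: "real \<Rightarrow> 'a::banach \<Rightarrow>\<^sub>L 'b::real_normed_vector"
  assumes "\<And>z. continuous_on {0..} (\<lambda>t. blinfun_apply (G t) z)"
  shows "\<exists>M\<ge>0. \<forall>t\<in>{0..\<tau>}. norm (G t) \<le> M"
proof (rule uniform_boundedness_principle)
  fix x
  have "compact ((\<lambda>t. blinfun_apply (G t) x) ` {0..\<tau>})"
    by (intro compact_continuous_image continuous_on_subset[OF assms]) auto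
  then show "\<exists>M. \<forall>t\<in>{0..\<tau>}. norm (G t x) \<le> M"
    using compact_imp_bounded bounded_iff by (metis imageI)
qed

section \<open>Continuous functions on a compact interval as a Banach space type\<close>

text \<open>The fixed point theorem speaks about a whole type. Constant extension beyond both ends
  embeds the continuous functions on [0, T] isometrically into the type of bounded continuous
  functions on the line.\<close>

definition clamp_bcontfun :: "real \<Rightarrow> (real \<Rightarrow> 'b) \<Rightarrow> real \<Rightarrow>\<^sub>C 'b::real_normed_vector" where
  "clamp_bcontfun T w = Bcontfun (\<lambda>t. w (clamp 0 T t))"

lemma clamp_bcontfun_apply:
  assumes "continuous_on {0..T} w" "0 \<le> T"
  shows "apply_bcontfun (clamp_bcontfun T w) t = w (clamp 0 T t)"
proof -
  have "continuous_on UNIV (\<lambda>t. w (clamp 0 T t))"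
    using assms(1) by (intro clamp_continuous_on) simp
  moreover have "bounded (range (\<lambda>t. w (clamp 0 T t)))"
  proof -
    have "range (\<lambda>t. w (clamp 0 T t)) \<subseteq> w ` {0..T}"
      using assms(2) clamp_in_interval[of 0 T] by auto
    moreover have "bounded (w ` {0..T})"
      using assms(1) by (intro compact_imp_bounded compact_continuous_image) auto
    ultimately show ?thesis by (rule bounded_subset[rotated])
  qed
  ultimately show ?thesis by (simp add: clamp_bcontfun_def Bcontfun_inverse bcontfun_def)
qed

lemma clamp_bcontfun_apply_mem:
  assumes "continuous_on {0..T} w" "t \<in> {0..T}"
  shows "apply_bcontfun (clamp_bcontfun T w) t = w t"
  using assms by (simp add: clamp_bcontfun_apply)

lemma dist_clamp_bcontfun:
  assumes "continuous_on {0..T} w" "continuous_on {0..T} v" "0 \<le> T"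
    and "\<And>t. t \<in> {0..T} \<Longrightarrow> dist (w t) (v t) \<le> e"
  shows "dist (clamp_bcontfun T w) (clamp_bcontfun T v) \<le> e"
proof (rule dist_bound)
  fix t show "dist (clamp_bcontfun T w t) (clamp_bcontfun T v t) \<le> e"
    using assms clamp_in_interval[of 0 T t] by (simp add: clamp_bcontfun_apply)
qed

text \<open>
  Arzela-Ascoli with values in a Banach space: two functions which pick, at every point of a fine
  grid, the same member of a finite net are uniformly close.
\<close>

lemma compact_closure_clamp_bcontfun:
  fixes W :: "(real \<Rightarrow> 'b::banach) set"
  assumes T: "0 \<le> T" and cont: "\<And>w. w \<in> W \<Longrightarrow> continuous_on {0..T} w"
    and equi: "\<And>e. e > 0 \<Longrightarrow> \<exists>d>0. \<forall>w\<in>W. \<forall>s\<in>{0..T}. \<forall>t\<in>{0..T}. \<bar>s - t\<bar> < d \<longrightarrow> dist (w s) (w t) < e"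
    and ptw: "\<And>t e. t \<in> {0..T} \<Longrightarrow> e > 0 \<Longrightarrow> \<exists>k. finite k \<and> (\<forall>w\<in>W. \<exists>x\<in>k. dist x (w t) < e)"
  shows "compact (closure (clamp_bcontfun T ` W))"
proof -
  have net: "\<exists>k. finite k \<and> clamp_bcontfun T ` W \<subseteq> (\<Union>x\<in>k. cball x e)" if e: "e > 0" for e
  proof -
    obtain d where d: "d > 0" "\<And>w s t. \<lbrakk>w \<in> W; s \<in> {0..T}; t \<in> {0..T}; \<bar>s - t\<bar> < d\<rbrakk> \<Longrightarrow> dist (w s) (w t) < e/4"
      using equi[of "e/4"] e by (metis divide_pos_pos zero_less_numeral)
    have "compact {0..T}" by simp
    moreover have "{0..T} \<subseteq> (\<Union>t\<in>{0..T}. ball t d)" using d(1) by auto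
    ultimately obtain g where g: "g \<subseteq> {0..T}" "finite g" "{0..T} \<subseteq> (\<Union>t\<in>g. ball t d)"
      using compactE_image[of "{0..T}" "{0..T}" "\<lambda>t. ball t d"] open_ball by blast
    have "\<exists>k. finite k \<and> (\<forall>w\<in>W. \<exists>x\<in>k. dist x (w t) < e/4)" if "t \<in> g" for t
      using ptw[of t "e/4"] g that e by auto
    then obtain k where k: "\<And>t. t \<in> g \<Longrightarrow> finite (k t)" "\<And>t w. t \<in> g \<Longrightarrow> w \<in> W \<Longrightarrow> \<exists>x\<in>k t. dist x (w t) < e/4"
      by metis
    \<comment> \<open>Restricting the choice function to the grid makes the possible selections a
      finite product. One \<open>v\<close> per selection suffices: v t, v s, the common net point, w
      s and w t are consecutively e/4 apart.\<close>
    define sel where "sel w = (\<lambda>t\<in>g. SOME x. x \<in> k t \<and> dist x (w t) < e/4)" for w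
    have sel: "sel w t \<in> k t \<and> dist (sel w t) (w t) < e/4" if "t \<in> g" "w \<in> W" for w t
    proof -
      have "\<exists>x. x \<in> k t \<and> dist x (w t) < e/4" using k(2)[OF that] by blast
      from someI_ex[OF this] show ?thesis using that(1) unfolding sel_def by simp
    qed
    have "sel ` W \<subseteq> PiE g k"
    proof (intro image_subsetI PiE_I)
      show "sel w t \<in> k t" if "t \<in> g" "w \<in> W" for w t using sel[OF that] by blast
      show "sel w t = undefined" if "t \<notin> g" for w t using that by (simp add: sel_def)
    qed
    then have "finite (sel ` W)" by (rule finite_subset) (intro finite_PiE g k)
    from finite_subset_image[OF this order_refl] obtain V where V: "V \<subseteq> W" "finite V" "sel ` W = sel ` V"
      by (elim exE conjE) (rule that)
    have "clamp_bcontfun T ` W \<subseteq> (\<Union>x\<in>clamp_bcontfun T ` V. cball x e)"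
    proof
      fix x assume "x \<in> clamp_bcontfun T ` W"
      then obtain w where w: "w \<in> W" "x = clamp_bcontfun T w" by blast
      then have "sel w \<in> sel ` V" using V(3) by blast
      then obtain v where v: "v \<in> V" "sel w = sel v" by (elim imageE)
      have vW: "v \<in> W" using v(1) V(1) by blast
      have "dist (v t) (w t) \<le> e" if t: "t \<in> {0..T}" for t
      proof -
        have "t \<in> (\<Union>t\<in>g. ball t d)" using g(3) t by (rule subsetD)
        then obtain s where s: "s \<in> g" "t \<in> ball s d" by (rule UN_E)
        have sd: "\<bar>s - t\<bar> < d" using s(2) by (simp add: dist_real_def)
        have st: "s \<in> {0..T}" using s(1) g(1) by blast
        have "dist (v t) (v s) < e/4" "dist (w s) (w t) < e/4"
          using d(2)[OF vW t st] d(2)[OF w(1) st t] sd by (simp_all add: abs_minus_commute)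
        moreover have "dist (sel w s) (v s) < e/4" "dist (sel w s) (w s) < e/4"
          using sel[OF s(1) w(1)] sel[OF s(1) vW] unfolding v(2) by simp_all
        ultimately show ?thesis
          using dist_triangle[of "v t" "w t" "v s"] dist_triangle[of "v s" "w t" "w s"]
            dist_triangle3[of "v s" "w s" "sel w s"] by linarith
      qed
      then have "dist (clamp_bcontfun T v) x \<le> e"
        unfolding w(2) by (intro dist_clamp_bcontfun cont vW w(1) T)
      then show "x \<in> (\<Union>x\<in>clamp_bcontfun T ` V. cball x e)" using v(1) by (intro UN_I[OF imageI]) simp_all
    qed
    then show ?thesis using V(2) by blast
  qed
  have fin: "\<exists>k. finite k \<and> closure (clamp_bcontfun T ` W) \<subseteq> (\<Union>x\<in>k. cball x e)" if "e > 0" for e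
  proof -
    from net[OF that] obtain k where k: "finite k" "clamp_bcontfun T ` W \<subseteq> (\<Union>x\<in>k. cball x e)"
      by blast
    have "closed (\<Union>x\<in>k. cball x e)" using k(1) by (intro closed_UN) auto
    then have "closure (clamp_bcontfun T ` W) \<subseteq> (\<Union>x\<in>k. cball x e)" by (rule closure_minimal[OF k(2)])
    with k(1) show ?thesis by (intro exI conjI)
  qed
  show ?thesis unfolding compact_eq_totally_bounded
  proof (intro conjI allI impI)
    show "complete (closure (clamp_bcontfun T ` W))" by (simp add: complete_eq_closed)
    fix e :: real assume "e > 0"
    then have "e / 2 > 0" by simp
    from fin[OF this] obtain k where k: "finite k" "closure (clamp_bcontfun T ` W) \<subseteq> (\<Union>x\<in>k. cball x (e/2))"
      by (elim exE conjE) (rule that)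
    have "cball x (e/2) \<subseteq> ball x e" for x :: "real \<Rightarrow>\<^sub>C 'b"
    proof
      fix v assume "v \<in> cball x (e/2)"
      then have "dist x v \<le> e/2" by simp
      with \<open>e > 0\<close> show "v \<in> ball x e" by simp
    qed
    then have "(\<Union>x\<in>k. cball x (e/2)) \<subseteq> (\<Union>x\<in>k. ball x e)" by (intro UN_mono order_refl)
    with k(2) have "closure (clamp_bcontfun T ` W) \<subseteq> (\<Union>x\<in>k. ball x e)" by (rule order_trans)
    with k(1) show "\<exists>k. finite k \<and> closure (clamp_bcontfun T ` W) \<subseteq> (\<Union>x\<in>k. ball x e)" by (intro exI conjI)
  qed
qed

section \<open>Resolvents on the real axis and on vertical lines\<close>

lemma compact_closure_subset:
  fixes S :: "'a::metric_space set"
  assumes "S \<subseteq> C" "compact C"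
  shows "compact (closure S)"
proof -
  have "closure S \<subseteq> C" using assms by (simp add: closure_minimal compact_imp_closed)
  then show ?thesis using compact_Int_closed[OF assms(2), of "closure S"] by (simp add: Int_absorb1)
qed

text \<open>Real spectral parameters make sense in \<open>'a\<close> itself over either scalar
  field, so both cases share this notion.\<close>

definition real_resolvent :: "'a set \<Rightarrow> ('a \<Rightarrow> 'a) \<Rightarrow> real \<Rightarrow> ('a::real_normed_vector \<Rightarrow>\<^sub>L 'a) \<Rightarrow> bool" where
  "real_resolvent D A n R \<longleftrightarrow>
     (\<forall>x. R x \<in> D \<and> n *\<^sub>R R x - A (R x) = x) \<and> (\<forall>x\<in>D. R (n *\<^sub>R x - A x) = x)"

text \<open>A lower bound for \<mu> - A on pairs, which is what remains to be asked once the
  transforms are known to lie in \<open>D \<times> D\<close>. If \<open>'a\<close> is already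
  complex, the complex structure meant here is still that of the pairs.\<close>

definition vertical_estimate :: "'a set \<Rightarrow> ('a \<Rightarrow> 'a) \<Rightarrow> real \<Rightarrow> ('a::real_normed_vector) itself \<Rightarrow> bool" where
  "vertical_estimate D A M _ \<longleftrightarrow> (\<forall>\<mu>. Re \<mu> > 0 \<longrightarrow> (\<forall>x\<in>D \<times> D.
     cmod \<mu> * norm x \<le> M * norm (complexification_scale \<mu> x - map_prod A A x)))"

section \<open>Half-plane estimates from sectoriality\<close>

text \<open>The sector of half-opening \<theta>/2 + \<pi>/2 contains the open right half-plane, so
  the single choice \<omega> = \<theta>/2 in the definition serves all of it.\<close>

lemma complex_sectorial_right_half_plane:
  assumes "complex_sectorial c D A \<theta>"
  obtains M where "M \<ge> 1" "\<And>\<mu>. Re \<mu> > 0 \<Longrightarrow> \<exists>R. is_resolvent c D A \<mu> R \<and> norm R \<le> M / cmod \<mu>"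
proof -
  from assms have \<theta>: "0 < \<theta>" and sub: "sector \<theta> \<subseteq> resolvent_set c D A"
    and bnd: "\<And>\<omega>. 0 < \<omega> \<and> \<omega> < \<theta> \<Longrightarrow> \<exists>M\<ge>1. \<forall>\<mu>. \<mu> \<noteq> 0 \<and> \<mu> \<in> closure (sector (\<theta> - \<omega>)) \<longrightarrow>
           norm (resolvent c D A \<mu>) \<le> M / cmod \<mu>"
    by (auto simp: complex_sectorial_def)
  obtain M where M: "M \<ge> 1" "\<And>\<mu>. \<mu> \<noteq> 0 \<Longrightarrow> \<mu> \<in> closure (sector (\<theta> - \<theta>/2)) \<Longrightarrow> norm (resolvent c D A \<mu>) \<le> M / cmod \<mu>"
    using bnd[of "\<theta>/2"] \<theta> by auto
  show thesis
  proof (rule that[OF M(1)])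
    fix \<mu> assume \<mu>: "Re \<mu> > 0"
    then have arg: "\<bar>Arg \<mu>\<bar> < pi/2" using Re_Ln_pos_lt[of \<mu>] by (cases "\<mu> = 0") (auto simp: Arg_eq_Im_Ln)
    have nz: "\<mu> \<noteq> 0" using \<mu> by auto
    have "\<mu> \<in> sector \<theta>" "\<mu> \<in> sector (\<theta> - \<theta>/2)" using arg nz \<theta> by (auto simp: sector_def)
    then have "\<mu> \<in> resolvent_set c D A" "norm (resolvent c D A \<mu>) \<le> M / cmod \<mu>"
      using sub M(2)[OF nz] closure_subset by blast+
    then obtain R where R: "is_resolvent c D A \<mu> R" by (auto simp: resolvent_set_def)
    then have "resolvent c D A \<mu> = R"
      unfolding resolvent_def using is_resolvent_unique by (intro the_equality)
    then show "\<exists>R. is_resolvent c D A \<mu> R \<and> norm R \<le> M / cmod \<mu>"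
      using R \<open>norm (resolvent c D A \<mu>) \<le> M / cmod \<mu>\<close> by auto
  qed
qed

text \<open>Resolvent identity: R x = R0 (x + (\<mu>0 - \<mu>) R x). Thus \<open>R\<close> maps the
  unit ball into a multiple of the compact set belonging to \<open>R0\<close>. The constant
  \<open>C\<close> admits \<open>complexification_scale\<close>, which is not isometric for the
  product norm.\<close>

lemma compact_resolvent_transfer:
  assumes "complex_compact_resolvent c D A" and R: "is_resolvent c D A \<mu> R"
    and c: "\<And>a b x. c (a + b) x = c a x + c b x" "\<And>a x. norm (c a x) \<le> C * cmod a * norm x" "C \<ge> 0"
  shows "compact_operator R"
proof -
  obtain \<mu>0 where "\<mu>0 \<in> resolvent_set c D A" and comp: "compact_operator (resolvent c D A \<mu>0)"
    using assms(1) by (auto simp: complex_compact_resolvent_def)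
  then obtain R0 where R0: "is_resolvent c D A \<mu>0 R0" by (auto simp: resolvent_set_def)
  then have "resolvent c D A \<mu>0 = R0"
    unfolding resolvent_def using is_resolvent_unique by (intro the_equality)
  with comp have comp0: "compact (closure (blinfun_apply R0 ` cball 0 1))" by (simp add: compact_operator_def)
  define \<rho> where "\<rho> = 1 + C * cmod (\<mu>0 - \<mu>) * norm R"
  have \<rho>: "\<rho> > 0" using c(3) by (simp add: \<rho>_def add_pos_nonneg)
  have "blinfun_apply R ` cball 0 1 \<subseteq> (\<lambda>x. \<rho> *\<^sub>R x) ` closure (blinfun_apply R0 ` cball 0 1)"
  proof
    fix p assume "p \<in> blinfun_apply R ` cball 0 1"
    then obtain x where x: "norm x \<le> 1" and p: "p = R x" by auto
    have pD: "p \<in> D" "c \<mu> p - A p = x" using R by (auto simp: is_resolvent_def p)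
    define v where "v = x + c (\<mu>0 - \<mu>) p"
    have "c \<mu>0 p = c \<mu> p + c (\<mu>0 - \<mu>) p" by (simp flip: c(1))
    then have "v = c \<mu>0 p - A p" using pD(2) by (simp add: v_def)
    then have "R0 v = p" using R0 pD(1) unfolding is_resolvent_def by blast
    have "norm v \<le> norm x + C * cmod (\<mu>0 - \<mu>) * norm p"
      unfolding v_def using norm_triangle_ineq c(2) by (meson add_left_mono order_trans)
    also have "norm p \<le> norm R"
      using norm_blinfun[of R x] x unfolding p by (meson mult_left_le norm_ge_zero order_trans)
    finally have "norm v \<le> \<rho>" using x c(3) by (simp add: \<rho>_def mult_left_mono)
    then have "v /\<^sub>R \<rho> \<in> cball 0 1" using \<rho> by (simp add: field_simps)
    moreover have "p = \<rho> *\<^sub>R R0 (v /\<^sub>R \<rho>)" using \<rho> \<open>R0 v = p\<close> by (simp add: blinfun.scaleR_right)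
    ultimately show "p \<in> (\<lambda>x. \<rho> *\<^sub>R x) ` closure (blinfun_apply R0 ` cball 0 1)"
      by (metis closure_subset image_eqI subsetD)
  qed
  then show ?thesis unfolding compact_operator_def
    by (rule compact_closure_subset) (intro compact_scaling comp0)
qed

lemma complexification_scale_of_real: "complexification_scale (of_real r) x = r *\<^sub>R x"
  by (simp add: complexification_scale_def prod_eq_iff)

lemma complexification_scale_add_left:
  "complexification_scale (a + b) x = complexification_scale a x + complexification_scale b x"
  by (simp add: complexification_scale_def prod_eq_iff algebra_simps)

text \<open>The product norm on pairs is not a complex norm; the crude factor 4 bounds each of four
  terms by \<open>cmod a * norm x\<close>. It reappears in the constants of the later
  estimates.\<close>

lemma norm_complexification_scale:
  fixes x :: "'a::real_normed_vector \<times> 'a"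
  shows "norm (complexification_scale a x) \<le> 4 * cmod a * norm x"
proof -
  have "norm (complexification_scale a x) \<le> norm (fst (complexification_scale a x)) + norm (snd (complexification_scale a x))"
    by (metis norm_Pair_le prod.collapse)
  also have "\<dots> \<le> (\<bar>Re a\<bar> * norm (fst x) + \<bar>Im a\<bar> * norm (snd x)) + (\<bar>Re a\<bar> * norm (snd x) + \<bar>Im a\<bar> * norm (fst x))"
    unfolding complexification_scale_def fst_conv snd_conv
    by (intro add_mono order_trans[OF norm_triangle_ineq] order_trans[OF norm_triangle_ineq4]) auto
  also have "\<dots> \<le> (cmod a * norm x + cmod a * norm x) + (cmod a * norm x + cmod a * norm x)"
    by (intro add_mono mult_mono abs_Re_le_cmod abs_Im_le_cmod norm_fst_le norm_snd_le)
       (auto intro: norm_fst_le[of "fst x" "snd x", simplified] norm_snd_le[of "snd x" "fst x", simplified])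
  finally show ?thesis by simp
qed

text \<open>Apply the complexified resolvent to (x, 0) and keep the real part. With A 0 = 0, the
  complexified operator sends (x, 0) to (A x, 0), so real vectors stay real where the left inverse
  is checked.\<close>

lemma real_resolvent_of_complexification:
  assumes R: "is_resolvent complexification_scale (D \<times> D) (map_prod A A) (of_real n) R"
    and A0: "0 \<in> D" "A 0 = 0" and comp: "compact_operator R"
  obtains R' where "real_resolvent D A n R'" "norm R' \<le> norm R" "compact_operator R'"
proof -
  have "bounded_linear (\<lambda>x. fst (R (x, 0)))"
    by (intro bounded_linear_compose[OF bounded_linear_fst] bounded_linear_compose[OF blinfun.bounded_linear_right]
        bounded_linear_Pair bounded_linear_ident bounded_linear_zero)
  then obtain R' where R': "\<And>x. blinfun_apply R' x = fst (R (x, 0))"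
    by (metis bounded_linear_Blinfun_apply)
  show thesis
  proof (rule that)
    show "real_resolvent D A n R'"
      unfolding real_resolvent_def
    proof (intro conjI allI ballI)
      fix x
      have "R (x, 0) \<in> D \<times> D" and eq: "n *\<^sub>R R (x, 0) - map_prod A A (R (x, 0)) = (x, 0)"
        using R by (auto simp: is_resolvent_def complexification_scale_of_real)
      then show "R' x \<in> D" by (auto simp: R')
      show "n *\<^sub>R R' x - A (R' x) = x" using arg_cong[OF eq, of fst] by (simp add: R')
    next
      fix x assume "x \<in> D"
      then have "R (n *\<^sub>R (x, 0) - map_prod A A (x, 0)) = (x, 0)"
        using R A0(1) unfolding is_resolvent_def complexification_scale_of_real by blast
      then show "R' (n *\<^sub>R x - A x) = x" by (simp add: R' A0)
    qed
    show "norm R' \<le> norm R"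
    proof (rule norm_blinfun_bound)
      fix x
      have "norm (R' x) \<le> norm (R (x, 0))"
        using norm_fst_le[of "fst (R (x, 0))" "snd (R (x, 0))"] by (simp add: R')
      also have "\<dots> \<le> norm R * norm x" using norm_blinfun[of R "(x, 0)"] by (simp add: norm_Pair)
      finally show "norm (R' x) \<le> norm R * norm x" .
    qed simp
    have "blinfun_apply R' ` cball 0 1 \<subseteq> fst ` closure (blinfun_apply R ` cball 0 1)"
    proof
      fix p assume "p \<in> blinfun_apply R' ` cball 0 1"
      then obtain x where x: "norm x \<le> 1" "p = fst (R (x, 0))" by (auto simp: R')
      then have "(x, 0 :: 'a) \<in> cball 0 1" unfolding mem_cball_0 by (simp add: norm_Pair)
      then have "R (x, 0) \<in> closure (blinfun_apply R ` cball 0 1)"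
        by (intro subsetD[OF closure_subset] imageI)
      then show "p \<in> fst ` closure (blinfun_apply R ` cball 0 1)" unfolding x(2) by (rule imageI)
    qed
    then show "compact_operator R'" unfolding compact_operator_def
      by (rule compact_closure_subset)
         (use comp in \<open>auto simp: compact_operator_def intro!: compact_continuous_image continuous_intros\<close>)
  qed
qed

lemma resolvent_lower_bound:
  assumes "is_resolvent c D A \<mu> R" "norm R \<le> M / cmod \<mu>" "x \<in> D" "\<mu> \<noteq> 0"
  shows "cmod \<mu> * norm x \<le> M * norm (c \<mu> x - A x)"
proof -
  have "norm x = norm (R (c \<mu> x - A x))" using assms by (simp add: is_resolvent_def)
  also have "\<dots> \<le> M / cmod \<mu> * norm (c \<mu> x - A x)"
    by (rule order_trans[OF norm_blinfun mult_right_mono[OF assms(2)]]) simp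
  finally show ?thesis using assms(4) by (simp add: field_simps)
qed

text \<open>With J the multiplication by the imaginary unit of the space itself, a pair decouples
  into x1 + J x2 and x1 - J x2. On the first the pair equation is the resolvent equation at \<mu>,
  on the second at the conjugate of \<mu>, which has the same positive real part. Of the 4, one
  factor 2 comes from adding both halves, the other from comparing the sum of the component norms
  with the product norm.\<close>

lemma vertical_estimate_of_complex:
  fixes cW :: "complex \<Rightarrow> 'w \<Rightarrow> 'w::real_normed_vector"
  assumes act: "scalar_action UNIV cW TYPE('w)" and D: "subspace_over UNIV cW D" and A: "linear_over UNIV cW cW D A"
    and R: "\<And>\<mu>. Re \<mu> > 0 \<Longrightarrow> \<exists>R. is_resolvent cW D A \<mu> R \<and> norm R \<le> M / cmod \<mu>" and M: "M \<ge> 1"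
  shows "vertical_estimate D A (4 * M) TYPE('w)"
  unfolding vertical_estimate_def
proof (intro allI impI ballI)
  fix \<mu> :: complex and x assume \<mu>: "Re \<mu> > 0" and x: "x \<in> D \<times> D"
  have c: "cW (of_real r) v = r *\<^sub>R v" "cW a (u + v) = cW a u + cW a v" "cW (a + b) v = cW a v + cW b v"
    "cW (a * b) v = cW a (cW b v)" "norm (cW a v) = cmod a * norm v" for r a b u v
    using act by (auto simp: scalar_action_def)
  obtain x1 x2 where x12: "x = (x1, x2)" "x1 \<in> D" "x2 \<in> D" using x by auto
  define y1 y2 where "y1 = Re \<mu> *\<^sub>R x1 - Im \<mu> *\<^sub>R x2 - A x1" and "y2 = Re \<mu> *\<^sub>R x2 + Im \<mu> *\<^sub>R x1 - A x2"
  have y: "complexification_scale \<mu> x - map_prod A A x = (y1, y2)"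
    by (simp add: x12 y1_def y2_def complexification_scale_def)
  have Dc: "cW a v \<in> D" "u + v \<in> D" if "u \<in> D" "v \<in> D" for a u v
    using D that by (auto simp: subspace_over_def subspace_def)
  have Ac: "A (cW a v) = cW a (A v)" "A (u + v) = A u + A v" if "u \<in> D" "v \<in> D" for a u v
    using A that by (auto simp: linear_over_def)
  have neg: "cW (- a) v = - cW a v" for a v
  proof -
    have "cW (-a) v + cW a v = cW 0 v" by (simp flip: c(3))
    also have "\<dots> = 0" using c(1)[of 0 v] by simp
    finally show ?thesis by (simp add: eq_neg_iff_add_eq_0)
  qed
  have sc: "cW (Complex a b) v = a *\<^sub>R v + b *\<^sub>R cW \<i> v" for a b v
  proof -
    have "Complex a b = of_real a + of_real b * \<i>" by (simp add: complex_eq_iff)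
    then show ?thesis by (simp only: c)
  qed
  have J: "cW \<i> (u + v) = cW \<i> u + cW \<i> v" "cW \<i> (u - v) = cW \<i> u - cW \<i> v"
    "cW \<i> (r *\<^sub>R v) = r *\<^sub>R cW \<i> v" for u v r
  proof -
    show "cW \<i> (u + v) = cW \<i> u + cW \<i> v" by (rule c)
    have "cW \<i> (u - v) + cW \<i> v = cW \<i> u" by (simp flip: c(2))
    then show "cW \<i> (u - v) = cW \<i> u - cW \<i> v" by (simp add: algebra_simps)
    have "cW \<i> (cW (of_real r) v) = cW (of_real r) (cW \<i> v)" by (simp add: mult.commute flip: c(4))
    then show "cW \<i> (r *\<^sub>R v) = r *\<^sub>R cW \<i> v" by (simp only: c(1))
  qed
  have key: "cmod \<mu> * norm (x1 + cW (Complex 0 s) x2) \<le> M * (norm y1 + norm y2)" if s: "s = 1 \<or> s = -1" for s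
  proof -
    define \<eta> where "\<eta> = Complex (Re \<mu>) (s * Im \<mu>)"
    define X where "X = x1 + cW (Complex 0 s) x2"
    have XD: "X \<in> D" using Dc x12 by (simp add: X_def)
    have \<eta>: "Re \<eta> > 0" "cmod \<eta> = cmod \<mu>" "\<eta> \<noteq> 0" using \<mu> s by (auto simp: \<eta>_def cmod_def complex_eq_iff)
    obtain R where R': "is_resolvent cW D A \<eta> R" "norm R \<le> M / cmod \<eta>" using R[OF \<eta>(1)] by blast
    have "cW \<eta> X - A X = y1 + cW (Complex 0 s) y2"
    proof -
      have "A X = A x1 + cW (Complex 0 s) (A x2)" using Ac Dc x12 by (simp add: X_def)
      moreover have "cW \<eta> X = cW \<eta> x1 + cW (\<eta> * Complex 0 s) x2" by (simp add: X_def c)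
      moreover have "\<eta> * Complex 0 s = Complex (- Im \<mu>) (s * Re \<mu>)" using s by (auto simp: \<eta>_def complex_eq_iff)
      moreover have "cW \<i> y2 = Re \<mu> *\<^sub>R cW \<i> x2 + Im \<mu> *\<^sub>R cW \<i> x1 - cW \<i> (A x2)"
        by (simp add: y2_def J)
      ultimately show ?thesis
        by (simp add: sc y1_def \<eta>_def scaleR_add_right scaleR_diff_right)
    qed
    with resolvent_lower_bound[OF R' XD \<eta>(3)] have "cmod \<mu> * norm X \<le> M * norm (y1 + cW (Complex 0 s) y2)"
      by (simp add: \<eta>(2))
    also have "norm (y1 + cW (Complex 0 s) y2) \<le> norm y1 + norm y2"
      using norm_triangle_ineq[of y1 "cW (Complex 0 s) y2"] s by (auto simp: c cmod_def)
    finally show ?thesis using M by (simp add: X_def)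
  qed
  define X Y where "X = x1 + cW (Complex 0 1) x2" and "Y = x1 + cW (Complex 0 (-1)) x2"
  have "2 *\<^sub>R x1 = X + Y" "2 *\<^sub>R cW (Complex 0 1) x2 = X - Y"
    by (simp_all add: X_def Y_def sc scaleR_2)
  then have "2 * norm x1 \<le> norm X + norm Y" "2 * norm (cW (Complex 0 1) x2) \<le> norm X + norm Y"
    by (metis norm_scaleR norm_triangle_ineq norm_triangle_ineq4 abs_numeral real_norm_def)+
  moreover have "norm (cW (Complex 0 1) x2) = norm x2" by (simp add: c cmod_def)
  ultimately have "norm x1 + norm x2 \<le> norm X + norm Y" by simp
  then have "cmod \<mu> * (norm x1 + norm x2) \<le> 2 * (M * (norm y1 + norm y2))"
    using key[of 1] key[of "-1"] mult_left_mono[of "norm x1 + norm x2" "norm X + norm Y" "cmod \<mu>"]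
    by (simp add: X_def Y_def distrib_left)
  also have "\<dots> \<le> 2 * (M * (2 * norm (y1, y2)))"
    using M norm_fst_le[of y1 y2] norm_snd_le[of y2 y1] by (intro mult_left_mono) auto
  finally have "cmod \<mu> * (norm x1 + norm x2) \<le> 4 * M * norm (y1, y2)" by simp
  moreover have "cmod \<mu> * norm x \<le> cmod \<mu> * (norm x1 + norm x2)"
    by (simp add: x12 norm_Pair_le mult_left_mono)
  ultimately show "cmod \<mu> * norm x \<le> 4 * M * norm (complexification_scale \<mu> x - map_prod A A x)"
    by (simp add: y)
qed

text \<open>Removes the scalar field: the smoothing argument works only with real resolvents and an
  estimate on pairs, which both cases deliver in the same form.\<close>

lemma sectorial_compact_resolvent_real:
  fixes cW :: "complex \<Rightarrow> 'w \<Rightarrow> 'w::real_normed_vector"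
  assumes K: "scalar_field K" and act: "scalar_action K cW TYPE('w)"
    and D: "subspace_over K cW D" and A: "linear_over K cW cW D A"
    and sec: "sectorial K cW D A \<theta>" and comp: "compact_resolvent K cW D A"
  obtains M where "M \<ge> 1" "vertical_estimate D A M TYPE('w)"
    "\<And>n. n > 0 \<Longrightarrow> \<exists>R. real_resolvent D A n R \<and> norm R \<le> M / n \<and> compact_operator R"
proof (cases "K = UNIV")
  case True
  have "complex_sectorial cW D A \<theta>" using sec True by (simp add: sectorial_def)
  then obtain M where M: "M \<ge> 1" and R: "\<And>\<mu>. Re \<mu> > 0 \<Longrightarrow> \<exists>R. is_resolvent cW D A \<mu> R \<and> norm R \<le> M / cmod \<mu>"
    using complex_sectorial_right_half_plane by blast
  show thesis
  proof (rule that)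
    show "4 * M \<ge> 1" using M by simp
    show "vertical_estimate D A (4 * M) TYPE('w)"
      using vertical_estimate_of_complex[OF act[unfolded True] D[unfolded True] A[unfolded True] R M] .
    fix n :: real assume n: "n > 0"
    obtain R where R': "is_resolvent cW D A (of_real n) R" "norm R \<le> M / n"
      using R[of "of_real n"] n by auto
    have "real_resolvent D A n R"
      using R'(1) act by (auto simp: is_resolvent_def real_resolvent_def scalar_action_def)
    moreover have "norm R \<le> 4 * M / n" using R'(2) M n by (simp add: field_simps)
    moreover have "compact_operator R"
      by (rule compact_resolvent_transfer[OF _ R'(1), of 1])
         (use comp act True in \<open>auto simp: compact_resolvent_def scalar_action_def\<close>)
    ultimately show "\<exists>R. real_resolvent D A n R \<and> norm R \<le> 4 * M / n \<and> compact_operator R" by blast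
  qed
next
  case False
  have "complex_sectorial complexification_scale (D \<times> D) (map_prod A A) \<theta>" using sec False by (simp add: sectorial_def)
  then obtain M where M: "M \<ge> 1" and R: "\<And>\<mu>. Re \<mu> > 0 \<Longrightarrow> \<exists>R. is_resolvent complexification_scale (D \<times> D) (map_prod A A) \<mu> R \<and> norm R \<le> M / cmod \<mu>"
    using complex_sectorial_right_half_plane by blast
  have D0: "0 \<in> D" using D by (simp add: subspace_over_def subspace_0)
  have "A (0 + 0) = A 0 + A 0" using A D0 unfolding linear_over_def by blast
  then have A0: "A 0 = 0" by simp
  show thesis
  proof (rule that[OF M])
    show "vertical_estimate D A M TYPE('w)"
      unfolding vertical_estimate_def
    proof (intro allI impI ballI)
      fix \<mu> :: complex and x assume \<mu>: "Re \<mu> > 0" and x: "x \<in> D \<times> D"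
      obtain R' where "is_resolvent complexification_scale (D \<times> D) (map_prod A A) \<mu> R'" "norm R' \<le> M / cmod \<mu>"
        using R[OF \<mu>] by blast
      then show "cmod \<mu> * norm x \<le> M * norm (complexification_scale \<mu> x - map_prod A A x)"
        by (rule resolvent_lower_bound) (use x \<mu> in auto)
    qed
    fix n :: real assume n: "n > 0"
    obtain R' where R': "is_resolvent complexification_scale (D \<times> D) (map_prod A A) (of_real n) R'" "norm R' \<le> M / n"
      using R[of "of_real n"] n by auto
    have "compact_operator R'"
      by (rule compact_resolvent_transfer[OF _ R'(1) complexification_scale_add_left norm_complexification_scale])
         (use comp False in \<open>auto simp: compact_resolvent_def\<close>)
    from real_resolvent_of_complexification[OF R'(1) D0 A0 this]
    show "\<exists>R. real_resolvent D A n R \<and> norm R \<le> M / n \<and> compact_operator R"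
      using R'(2) by (metis order_trans)
  qed
qed

section \<open>Laplace transforms of orbits against test functions\<close>

text \<open>One fixed finite measure carries all integrals. Shorter intervals are written with
  \<open>if\<close>, so the domains of integration stay independent of the variables which Fubini
  exchanges.\<close>

definition interval_measure_from_0 :: "real \<Rightarrow> real measure" where
  "interval_measure_from_0 L = restrict_space lborel {0..L}"

abbreviation "\<I> \<equiv> interval_measure_from_0"

lemma space_I [simp]: "space (\<I> L) = {0..L}"
  by (simp add: interval_measure_from_0_def space_restrict_space)

lemma borel_measurable_I: "f \<in> borel_measurable borel \<Longrightarrow> f \<in> borel_measurable (\<I> L)"
  by (simp add: interval_measure_from_0_def measurable_restrict_space1)

lemma ident_borel_measurable_I [measurable]: "(\<lambda>x. x) \<in> borel_measurable (\<I> L)"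
  by (rule borel_measurable_I) simp

lemma finite_measure_I: "finite_measure (\<I> L)"
proof
  show "emeasure (\<I> L) (space (\<I> L)) \<noteq> \<infinity>"
    by (simp add: interval_measure_from_0_def emeasure_restrict_space emeasure_lborel_Icc_eq)
qed

interpretation I: finite_measure "\<I> L" for L by (rule finite_measure_I)

interpretation II: pair_sigma_finite "\<I> L" "\<I> L'" for L L' by standard

lemma measure_I: "0 \<le> L \<Longrightarrow> measure (\<I> L) {0..L} = L"
  by (simp add: interval_measure_from_0_def measure_restrict_space)

lemma integral_I:
  fixes f :: "real \<Rightarrow> 'b::{banach, second_countable_topology}"
  shows "(\<integral>x. f x \<partial>\<I> L) = (\<integral>x. indicator {0..L} x *\<^sub>R f x \<partial>lborel)"
  by (simp add: interval_measure_from_0_def integral_restrict_space)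

lemma integrable_I:
  fixes f :: "real \<Rightarrow> 'b::{banach, second_countable_topology}"
  shows "integrable (\<I> L) f \<longleftrightarrow> integrable lborel (\<lambda>x. indicator {0..L} x *\<^sub>R f x)"
  by (simp add: interval_measure_from_0_def integrable_restrict_space)

lemma integrable_bounded_I:
  fixes f :: "real \<Rightarrow> 'b::{banach, second_countable_topology}"
  assumes "f \<in> borel_measurable (\<I> L)" "\<And>x. 0 \<le> x \<Longrightarrow> x \<le> L \<Longrightarrow> norm (f x) \<le> C"
  shows "integrable (\<I> L) f"
  using assms by (intro I.integrable_const_bound[of _ C] AE_I2) auto

lemma norm_integral_I_le:
  fixes f :: "real \<Rightarrow> 'b::{banach, second_countable_topology}"
  assumes "\<And>x. 0 \<le> x \<Longrightarrow> x \<le> L \<Longrightarrow> norm (f x) \<le> C" "0 \<le> C" "0 \<le> L"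
  shows "norm (\<integral>x. f x \<partial>\<I> L) \<le> L * C"
proof (cases "integrable (\<I> L) f")
  case True
  have "norm (\<integral>x. f x \<partial>\<I> L) \<le> (\<integral>x. C \<partial>\<I> L)"
    using True assms by (intro order_trans[OF integral_norm_bound integral_mono']) auto
  then show ?thesis using assms by (simp add: measure_I)
qed (use assms in \<open>simp add: not_integrable_integral_eq\<close>)

lemma norm_integral_le_AE:
  fixes f :: "'m \<Rightarrow> 'b::{banach, second_countable_topology}"
  assumes g: "integrable M g" and le: "AE x in M. norm (f x) \<le> g x"
  shows "norm (\<integral>x. f x \<partial>M) \<le> (\<integral>x. g x \<partial>M)"
proof (cases "integrable M f")
  case True
  then show ?thesis using g le by (intro order_trans[OF integral_norm_bound integral_mono_AE]) auto
next
  case False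
  \<comment> \<open>The Bochner integral of a non-integrable \<open>f\<close> is 0, so in this case
    only the sign of the majorant matters.\<close>
  have "0 \<le> (\<integral>x. g x \<partial>M)"
    by (rule integral_nonneg_AE) (use le in \<open>auto elim!: eventually_mono intro: order_trans[OF norm_ge_zero]\<close>)
  with False show ?thesis by (simp add: not_integrable_integral_eq)
qed

lemma norm_integral_le:
  fixes f :: "real \<Rightarrow> 'b::{banach, second_countable_topology}"
  assumes "integrable M g" "\<And>x. x \<in> space M \<Longrightarrow> norm (f x) \<le> g x"
  shows "norm (\<integral>x. f x \<partial>M) \<le> (\<integral>x. g x \<partial>M)"
  using assms by (intro norm_integral_le_AE AE_I2)

lemma continuous_on_Icc_bounded:
  fixes f :: "real \<Rightarrow> 'b::real_normed_vector"
  assumes "continuous_on UNIV f"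
  obtains C where "\<And>t. t \<in> {a..b} \<Longrightarrow> norm (f t) \<le> C"
proof -
  have "compact (f ` {a..b})" by (intro compact_continuous_image continuous_on_subset[OF assms]) auto
  then show thesis using that by (meson bounded_iff compact_imp_bounded imageI)
qed

lemma integrable_continuous_I:
  fixes f :: "real \<Rightarrow> 'b::{banach, second_countable_topology}"
  assumes "continuous_on UNIV f"
  shows "integrable (\<I> L) f"
proof -
  obtain C where "\<And>t. t \<in> {0..L} \<Longrightarrow> norm (f t) \<le> C" using continuous_on_Icc_bounded[OF assms, of 0 L] by blast
  then show ?thesis
    by (intro integrable_bounded_I[of _ _ C] borel_measurable_I borel_measurable_continuous_onI assms) auto
qed

text \<open>Domination by a product of one integrable function of each variable yields integrability
  on the product measure; it allows for the unbounded kernel as one of the factors.\<close>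

lemma Fubini_I:
  fixes f :: "real \<Rightarrow> real \<Rightarrow> 'b::{banach, second_countable_topology}"
  assumes meas: "(\<lambda>(x, y). f x y) \<in> borel_measurable (\<I> L \<Otimes>\<^sub>M \<I> L)"
    and g: "integrable (\<I> L) g" and h: "integrable (\<I> L) h"
    and bnd: "\<And>x y. 0 \<le> x \<Longrightarrow> x \<le> L \<Longrightarrow> 0 \<le> y \<Longrightarrow> y \<le> L \<Longrightarrow> norm (f x y) \<le> g x * h y"
  shows "(\<integral>x. (\<integral>y. f x y \<partial>\<I> L) \<partial>\<I> L) = (\<integral>y. (\<integral>x. f x y \<partial>\<I> L) \<partial>\<I> L)"
    and "integrable (\<I> L) (\<lambda>x. \<integral>y. f x y \<partial>\<I> L)" "integrable (\<I> L) (\<lambda>y. \<integral>x. f x y \<partial>\<I> L)"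
proof -
  have gm[measurable]: "g \<in> borel_measurable (\<I> L)" and hm[measurable]: "h \<in> borel_measurable (\<I> L)"
    using g h by auto
  have "integrable (\<I> L \<Otimes>\<^sub>M \<I> L) (\<lambda>(x, y). g x * h y)"
  proof (rule II.Fubini_integrable)
    show "(\<lambda>(x, y). g x * h y) \<in> borel_measurable (\<I> L \<Otimes>\<^sub>M \<I> L)" by measurable
    have "integrable (\<I> L) (\<lambda>x. norm (g x) * (\<integral>y. norm (h y) \<partial>\<I> L))"
      using g by (intro integrable_mult_left integrable_norm)
    then show "integrable (\<I> L) (\<lambda>x. \<integral>y. norm (case (x, y) of (x, y) \<Rightarrow> g x * h y) \<partial>\<I> L)"
      by (simp add: abs_mult)
    show "AE x in \<I> L. integrable (\<I> L) (\<lambda>y. case (x, y) of (x, y) \<Rightarrow> g x * h y)"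
      using h by (auto intro: integrable_mult_right)
  qed
  then have int: "integrable (\<I> L \<Otimes>\<^sub>M \<I> L) (\<lambda>(x, y). f x y)"
    by (rule Bochner_Integration.integrable_bound[OF _ meas])
       (auto intro!: AE_I2 order_trans[OF bnd] simp: space_pair_measure)
  from II.Fubini_integral[OF int] show "(\<integral>x. (\<integral>y. f x y \<partial>\<I> L) \<partial>\<I> L) = (\<integral>y. (\<integral>x. f x y \<partial>\<I> L) \<partial>\<I> L)" by simp
  show "integrable (\<I> L) (\<lambda>x. \<integral>y. f x y \<partial>\<I> L)" using II.integrable_fst[OF int] .
  show "integrable (\<I> L) (\<lambda>y. \<integral>x. f x y \<partial>\<I> L)" using II.integrable_snd[OF int] .
qed

section \<open>Pairs as complexified vectors\<close>

text \<open>The elementary tensor of \<mu> and \<open>x\<close> in the complexification.\<close>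

definition complexify :: "complex \<Rightarrow> 'a \<Rightarrow> 'a \<times> 'a::real_vector" where
  "complexify \<mu> x = (Re \<mu> *\<^sub>R x, Im \<mu> *\<^sub>R x)"

lemma norm_complexify: "norm (complexify \<mu> x) \<le> 2 * cmod \<mu> * norm x" for x :: "'a::real_normed_vector"
proof -
  have "norm (complexify \<mu> x) \<le> \<bar>Re \<mu>\<bar> * norm x + \<bar>Im \<mu>\<bar> * norm x"
    unfolding complexify_def by (rule order_trans[OF norm_Pair_le]) simp
  also have "\<dots> \<le> cmod \<mu> * norm x + cmod \<mu> * norm x"
    by (intro add_mono mult_right_mono abs_Re_le_cmod abs_Im_le_cmod) auto
  finally show ?thesis by (simp add: mult.commute)
qed

lemma bounded_bilinear_complexify: "bounded_bilinear (complexify :: complex \<Rightarrow> 'a \<Rightarrow> 'a \<times> 'a::real_normed_vector)"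
proof
  show "\<exists>K. \<forall>\<mu> (x::'a). norm (complexify \<mu> x) \<le> norm \<mu> * norm x * K"
    using norm_complexify by (metis mult.commute mult.assoc)
qed (auto simp: complexify_def algebra_simps)

interpretation cpx: bounded_bilinear "complexify :: complex \<Rightarrow> 'a \<Rightarrow> 'a \<times> 'a::real_normed_vector"
  by (rule bounded_bilinear_complexify)

lemma bounded_bilinear_complexification_scale:
  "bounded_bilinear (complexification_scale :: complex \<Rightarrow> 'a \<times> 'a \<Rightarrow> 'a \<times> 'a::real_normed_vector)"
proof
  show "\<exists>K. \<forall>\<mu> (x::'a \<times> 'a). norm (complexification_scale \<mu> x) \<le> norm \<mu> * norm x * K"
    using norm_complexification_scale by (metis mult.commute mult.assoc)
qed (auto simp: complexification_scale_def algebra_simps)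

interpretation cs: bounded_bilinear "complexification_scale :: complex \<Rightarrow> 'a \<times> 'a \<Rightarrow> 'a \<times> 'a::real_normed_vector"
  by (rule bounded_bilinear_complexification_scale)

lemma complexification_scale_complexify: "complexification_scale \<nu> (complexify \<mu> x) = complexify (\<nu> * \<mu>) x"
  by (simp add: complexify_def complexification_scale_def algebra_simps)

lemma measurable_complexify [measurable (raw)]:
  fixes f :: "'m \<Rightarrow> complex" and g :: "'m \<Rightarrow> 'a::{real_normed_vector, second_countable_topology}"
  shows "f \<in> borel_measurable M \<Longrightarrow> g \<in> borel_measurable M \<Longrightarrow> (\<lambda>x. complexify (f x) (g x)) \<in> borel_measurable M"
  by (rule borel_measurable_continuous_Pair, assumption, assumption)
     (intro cpx.continuous_on continuous_intros)

lemma measurable_complexification_scale [measurable (raw)]: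
  fixes f :: "'m \<Rightarrow> complex" and g :: "'m \<Rightarrow> 'a \<times> 'a::{real_normed_vector, second_countable_topology}"
  shows "f \<in> borel_measurable M \<Longrightarrow> g \<in> borel_measurable M \<Longrightarrow>
    (\<lambda>x. complexification_scale (f x) (g x)) \<in> borel_measurable M"
  by (rule borel_measurable_continuous_Pair, assumption, assumption)
     (intro cs.continuous_on continuous_intros)

text \<open>Vanishing on all of \<open>[L, \<infinity>)\<close> makes the class of test functions stable under shifts to the left.\<close>

definition test_function :: "real \<Rightarrow> (real \<Rightarrow> 'a::real_normed_vector) \<Rightarrow> (real \<Rightarrow> 'a) \<Rightarrow> bool" where
  "test_function L f f' \<longleftrightarrow> (\<forall>t. (f has_vector_derivative f' t) (at t)) \<and> continuous_on UNIV f' \<and>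
     (\<forall>t\<ge>L. f t = 0 \<and> f' t = 0)"

lemma test_function_continuous: "test_function L f f' \<Longrightarrow> continuous_on UNIV f"
  by (auto simp: test_function_def continuous_on_eq_continuous_within intro: has_vector_derivative_continuous)

lemma test_function_shift:
  assumes "test_function L f f'" "0 \<le> \<sigma>"
  shows "test_function L (\<lambda>s. f (s + \<sigma>)) (\<lambda>s. f' (s + \<sigma>))"
  unfolding test_function_def
proof (intro conjI allI impI)
  fix t
  have "(f has_vector_derivative f' (t + \<sigma>)) (at (t + \<sigma>))" using assms by (simp add: test_function_def)
  moreover have "((\<lambda>s. s + \<sigma>) has_vector_derivative 1) (at t)" by (auto intro!: derivative_eq_intros)
  ultimately show "((\<lambda>s. f (s + \<sigma>)) has_vector_derivative f' (t + \<sigma>)) (at t)"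
    using vector_diff_chain_at[of "\<lambda>s. s + \<sigma>" 1 t f "f' (t + \<sigma>)"] by (simp add: o_def)
  show "continuous_on UNIV (\<lambda>s. f' (s + \<sigma>))"
    by (rule continuous_on_compose2[of UNIV f']) (use assms in \<open>auto simp: test_function_def intro!: continuous_intros\<close>)
qed (use assms in \<open>auto simp: test_function_def\<close>)

lemma test_function_bounded:
  assumes "test_function L f f'"
  obtains C where "C \<ge> 0" "\<And>t. 0 \<le> t \<Longrightarrow> norm (f t) \<le> C"
proof -
  obtain C where C: "\<And>t. t \<in> {0..L} \<Longrightarrow> norm (f t) \<le> C"
    using continuous_on_Icc_bounded[OF test_function_continuous[OF assms], of 0 L] by blast
  show thesis
  proof (rule that[of "max 0 C"])
    show "norm (f t) \<le> max 0 C" if "0 \<le> t" for t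
    proof (cases "t \<le> L")
      case True
      then show ?thesis using C[of t] that by (simp add: le_max_iff_disj)
    qed (use assms in \<open>auto simp: test_function_def\<close>)
  qed simp
qed

lemma integral_test_function_derivative:
  fixes f :: "real \<Rightarrow> 'b::euclidean_space"
  assumes f: "test_function L f f'" and u: "0 \<le> u"
  shows "(\<integral>t. (if u \<le> t then f' t else 0) \<partial>\<I> L) = - f u"
proof (cases "u \<le> L")
  case True
  have "(\<integral>t. (if u \<le> t then f' t else 0) \<partial>\<I> L) = (\<integral>t. indicator {u..L} t *\<^sub>R f' t \<partial>lborel)"
    unfolding integral_I using u by (intro Bochner_Integration.integral_cong refl) (auto simp: indicator_def)
  also have "\<dots> = f L - f u"
    using f True by (intro integral_FTC_Icc)
      (auto simp: test_function_def intro: has_vector_derivative_at_within continuous_on_subset)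
  finally show ?thesis using f by (simp add: test_function_def)
next
  case False
  then have "(\<integral>t. (if u \<le> t then f' t else 0) \<partial>\<I> L) = (\<integral>t. 0 \<partial>\<I> L)"
    by (intro Bochner_Integration.integral_cong refl) auto
  then show ?thesis using f False by (simp add: test_function_def)
qed

section \<open>Volterra kernels and tested orbits\<close>

text \<open>The fractional kernel enters only through sign, monotonicity and integrability. Its
  derivative is considered at positive arguments, as the kernel may be unbounded near 0.\<close>

locale volterra_kernel =
  fixes \<kappa> \<kappa>' :: "real \<Rightarrow> real" and L :: real
  assumes L_pos: "0 < L"
    and kernel_measurable [measurable]: "\<kappa> \<in> borel_measurable borel"
    and kernel_nonneg: "\<And>t. 0 \<le> \<kappa> t"
    and kernel_integrable: "integrable (\<I> L) \<kappa>"
    and kernel_deriv: "\<And>t. 0 < t \<Longrightarrow> (\<kappa> has_real_derivative \<kappa>' t) (at t)"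
    and kernel_deriv_continuous: "continuous_on {0<..} \<kappa>'"
    and kernel_deriv_nonpos: "\<And>t. 0 < t \<Longrightarrow> \<kappa>' t \<le> 0"
begin

lemma kernel_measurable_I [measurable]: "\<kappa> \<in> borel_measurable (\<I> L)"
  by (rule borel_measurable_I) measurable

text \<open>An integration by parts, done by Fubini instead of differentiating the primitive of an
  unbounded kernel: integrating \<psi>' from s + r on gives - \<psi> (s + r), the boundary value at
  \<open>L\<close> being 0.\<close>

lemma kernel_primitive_deriv_swap:
  fixes \<psi> \<psi>' :: "real \<Rightarrow> complex"
  assumes \<psi>: "test_function L \<psi> \<psi>'" and s: "0 \<le> s" "s \<le> L"
  shows "(\<integral>t. (if s \<le> t then (1 + (\<integral>r. (if r \<le> t - s then \<kappa> r else 0) \<partial>\<I> L)) *\<^sub>R \<psi>' t else 0) \<partial>\<I> L)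
       = - (\<psi> s + (\<integral>r. \<kappa> r *\<^sub>R \<psi> (s + r) \<partial>\<I> L))"
proof -
  have cont': "continuous_on UNIV \<psi>'" using \<psi> by (simp add: test_function_def)
  have [measurable]: "\<psi>' \<in> borel_measurable borel" "\<psi> \<in> borel_measurable borel"
    using cont' test_function_continuous[OF \<psi>] by (auto intro: borel_measurable_continuous_onI)
  have [measurable]: "\<psi>' \<in> borel_measurable (\<I> L)" by (rule borel_measurable_I) measurable
  obtain C where C: "\<And>t. t \<in> {0..L} \<Longrightarrow> norm (\<psi>' t) \<le> C"
    using continuous_on_Icc_bounded[OF cont', of 0 L] by blast
  define f where "f t r = (if s \<le> t then if r \<le> t - s then \<kappa> r *\<^sub>R \<psi>' t else 0 else 0)" for t r
  have fm: "(\<lambda>(t, r). f t r) \<in> borel_measurable (\<I> L \<Otimes>\<^sub>M \<I> L)"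
    unfolding f_def by measurable
  have fb: "norm (f t r) \<le> C * \<kappa> r" if "0 \<le> t" "t \<le> L" for t r
  proof -
    have "norm (\<psi>' t) * \<kappa> r \<le> C * \<kappa> r" "0 \<le> norm (\<psi>' t) * \<kappa> r"
      using C[of t] that kernel_nonneg by (auto intro: mult_right_mono)
    moreover from this have "0 \<le> C * \<kappa> r" by (rule order_trans[rotated])
    ultimately show ?thesis using kernel_nonneg[of r] by (auto simp: f_def mult.commute)
  qed
  have C_int: "integrable (\<I> L) (\<lambda>t. C)" by simp
  note Fub = Fubini_I[OF fm C_int kernel_integrable fb]
  have "(\<integral>t. (if s \<le> t then (1 + (\<integral>r. (if r \<le> t - s then \<kappa> r else 0) \<partial>\<I> L)) *\<^sub>R \<psi>' t else 0) \<partial>\<I> L)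
      = (\<integral>t. (if s \<le> t then \<psi>' t else 0) + (\<integral>r. f t r \<partial>\<I> L) \<partial>\<I> L)"
  proof (intro Bochner_Integration.integral_cong refl)
    fix t
    have "integrable (\<I> L) (\<lambda>r. if r \<le> t - s then \<kappa> r else 0)"
      by (rule Bochner_Integration.integrable_bound[OF kernel_integrable]) (use kernel_nonneg in auto)
    then have "(\<integral>r. (if r \<le> t - s then \<kappa> r else 0) \<partial>\<I> L) *\<^sub>R \<psi>' t = (\<integral>r. (if r \<le> t - s then \<kappa> r else 0) *\<^sub>R \<psi>' t \<partial>\<I> L)"
      by simp
    also have "\<dots> = (\<integral>r. f t r \<partial>\<I> L)" if "s \<le> t"
      using that by (intro Bochner_Integration.integral_cong refl) (simp add: f_def)
    finally show "(if s \<le> t then (1 + (\<integral>r. (if r \<le> t - s then \<kappa> r else 0) \<partial>\<I> L)) *\<^sub>R \<psi>' t else 0) =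
      (if s \<le> t then \<psi>' t else 0) + (\<integral>r. f t r \<partial>\<I> L)"
      by (cases "s \<le> t") (simp_all add: scaleR_add_left f_def)
  qed
  also have "\<dots> = (\<integral>t. (if s \<le> t then \<psi>' t else 0) \<partial>\<I> L) + (\<integral>t. (\<integral>r. f t r \<partial>\<I> L) \<partial>\<I> L)"
  proof (intro Bochner_Integration.integral_add Fub(2))
    show "integrable (\<I> L) (\<lambda>t. if s \<le> t then \<psi>' t else 0)"
      by (rule integrable_bounded_I[of _ _ "max C 0"]) (use C in \<open>auto simp: le_max_iff_disj\<close>)
  qed
  also have "(\<integral>t. (if s \<le> t then \<psi>' t else 0) \<partial>\<I> L) = - \<psi> s"
    by (rule integral_test_function_derivative[OF \<psi> s(1)])
  also have "(\<integral>t. (\<integral>r. f t r \<partial>\<I> L) \<partial>\<I> L) = (\<integral>r. (\<integral>t. f t r \<partial>\<I> L) \<partial>\<I> L)" by (rule Fub(1))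
  also have "\<dots> = (\<integral>r. - (\<kappa> r *\<^sub>R \<psi> (s + r)) \<partial>\<I> L)"
  proof (intro Bochner_Integration.integral_cong refl)
    fix r assume "r \<in> space (\<I> L)"
    then have r: "0 \<le> r" by simp
    have "(\<integral>t. f t r \<partial>\<I> L) = (\<integral>t. \<kappa> r *\<^sub>R (if s + r \<le> t then \<psi>' t else 0) \<partial>\<I> L)"
      using r by (intro Bochner_Integration.integral_cong refl) (auto simp: f_def)
    also have "\<dots> = \<kappa> r *\<^sub>R (- \<psi> (s + r))"
      using integral_test_function_derivative[OF \<psi>, of "s + r"] r s by simp
    finally show "(\<integral>t. f t r \<partial>\<I> L) = - (\<kappa> r *\<^sub>R \<psi> (s + r))" by simp
  qed
  finally show ?thesis by simp
qed

end

text \<open>An orbit starting in the domain, with its image under \<open>A\<close> as a separate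
  continuous function. The bound \<open>B\<close> concerns \<open>w\<close> alone; a bound for
  \<open>y\<close> is used only for integrability, so that the resulting estimates extend by density
  to all initial values.\<close>

locale volterra_orbit = volterra_kernel +
  fixes D :: "('w::{banach, second_countable_topology}) set" and A :: "'w \<Rightarrow> 'w" and R1 :: "'w \<Rightarrow>\<^sub>L 'w"
    and w y :: "real \<Rightarrow> 'w" and B :: real
  assumes R1: "real_resolvent D A 1 R1"
    and orbit_continuous: "continuous_on UNIV w" and image_continuous: "continuous_on UNIV y"
    and orbit_domain: "\<And>t. 0 \<le> t \<Longrightarrow> w t \<in> D" and image_eq: "\<And>t. 0 \<le> t \<Longrightarrow> y t = A (w t)"
    and orbit_eq: "\<And>t. 0 \<le> t \<Longrightarrow> t \<le> L \<Longrightarrow> w t = w 0 +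
      (\<integral>s. (if s \<le> t then (1 + (\<integral>r. (if r \<le> t - s then \<kappa> r else 0) \<partial>\<I> L)) *\<^sub>R y s else 0) \<partial>\<I> L)"
    and orbit_bound: "\<And>t. 0 \<le> t \<Longrightarrow> t \<le> L \<Longrightarrow> norm (w t) \<le> B"
begin

lemma orbit_measurable [measurable]: "w \<in> borel_measurable borel" "y \<in> borel_measurable borel"
  using orbit_continuous image_continuous by (auto intro: borel_measurable_continuous_onI)

lemma orbit_measurable_I [measurable]: "w \<in> borel_measurable (\<I> L)" "y \<in> borel_measurable (\<I> L)"
  by (auto intro: borel_measurable_I orbit_measurable)

lemma image_bounded: obtains Y where "Y \<ge> 0" "\<And>t. 0 \<le> t \<Longrightarrow> t \<le> L \<Longrightarrow> norm (y t) \<le> Y"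
proof -
  obtain C where C: "\<And>t. t \<in> {0..L} \<Longrightarrow> norm (y t) \<le> C"
    using continuous_on_Icc_bounded[OF image_continuous, of 0 L] by blast
  then have "C \<ge> 0" using C[of 0] L_pos norm_ge_zero by (meson atLeastAtMost_iff less_imp_le order_refl order_trans)
  with C show thesis by (intro that) auto
qed

lemma bound_nonneg: "B \<ge> 0"
  using orbit_bound[of 0] L_pos norm_ge_zero[of "w 0"] by linarith

text \<open>Weak form of the orbit equation: test it with \<psi>' and exchange the integrals. The
  primitive of the kernel then meets \<psi>', and \<open>kernel_primitive_deriv_swap\<close> turns
  it back into the kernel itself.\<close>

lemma orbit_tested:
  fixes \<psi> \<psi>' :: "real \<Rightarrow> complex"
  assumes \<psi>: "test_function L \<psi> \<psi>'"
  shows "(\<integral>t. complexify (\<psi>' t) (w t) \<partial>\<I> L) = - complexify (\<psi> 0) (w 0)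
       - (\<integral>s. complexify (\<psi> s + (\<integral>r. \<kappa> r *\<^sub>R \<psi> (s + r) \<partial>\<I> L)) (y s) \<partial>\<I> L)"
proof -
  have cont': "continuous_on UNIV \<psi>'" using \<psi> by (simp add: test_function_def)
  have [measurable]: "\<psi>' \<in> borel_measurable borel" "\<psi> \<in> borel_measurable borel"
    using cont' test_function_continuous[OF \<psi>] by (auto intro: borel_measurable_continuous_onI)
  have [measurable]: "\<psi>' \<in> borel_measurable (\<I> L)" "\<psi> \<in> borel_measurable (\<I> L)"
    by (auto intro: borel_measurable_I)
  obtain C where C: "\<And>t. t \<in> {0..L} \<Longrightarrow> norm (\<psi>' t) \<le> C"
    using continuous_on_Icc_bounded[OF cont', of 0 L] by blast
  have C0: "C \<ge> 0" using C[of 0] L_pos norm_ge_zero by (meson atLeastAtMost_iff less_imp_le order_refl order_trans)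
  obtain Y where Y: "Y \<ge> 0" "\<And>t. 0 \<le> t \<Longrightarrow> t \<le> L \<Longrightarrow> norm (y t) \<le> Y"
    using image_bounded by blast
  define a where "a u = 1 + (\<integral>r. (if r \<le> u then \<kappa> r else 0) \<partial>\<I> L)" for u
  define a0 where "a0 = 1 + (\<integral>r. \<kappa> r \<partial>\<I> L)"
  have am[measurable]: "a \<in> borel_measurable borel"
    unfolding a_def by measurable
  have ab: "\<bar>a u\<bar> \<le> a0" for u
  proof -
    have "norm (\<integral>r. (if r \<le> u then \<kappa> r else 0) \<partial>\<I> L) \<le> (\<integral>r. \<kappa> r \<partial>\<I> L)"
      by (rule norm_integral_le[OF kernel_integrable]) (use kernel_nonneg in auto)
    then show ?thesis by (simp add: a_def a0_def)
  qed
  have a0: "a0 \<ge> 0" using ab[of 0] abs_ge_zero order_trans by blast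
  define F where "F t s = complexify (if s \<le> t then a (t - s) *\<^sub>R \<psi>' t else 0) (y s)" for t s
  have Fm: "(\<lambda>(t, s). F t s) \<in> borel_measurable (\<I> L \<Otimes>\<^sub>M \<I> L)" unfolding F_def by measurable
  have Fb: "norm (F t s) \<le> (2 * (a0 * C)) * Y" if "0 \<le> t" "t \<le> L" "0 \<le> s" "s \<le> L" for t s
  proof -
    have "cmod (if s \<le> t then a (t - s) *\<^sub>R \<psi>' t else 0) \<le> a0 * C"
      using C[of t] ab[of "t - s"] that C0 by (auto intro!: mult_mono simp: order_trans[OF abs_ge_zero ab])
    then show ?thesis unfolding F_def
      using Y that a0 C0 by (intro order_trans[OF norm_complexify] mult_mono) auto
  qed
  have cint: "integrable (\<I> L) (\<lambda>t. 2 * (a0 * C))" "integrable (\<I> L) (\<lambda>s. Y)" by simp_all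
  note Fub = Fubini_I[OF Fm cint Fb]
  have psi_int: "integrable (\<I> L) \<psi>'" by (rule integrable_bounded_I[of _ _ C]) (use C in auto)
  have "(\<integral>t. complexify (\<psi>' t) (w t) \<partial>\<I> L) = (\<integral>t. complexify (\<psi>' t) (w 0) + (\<integral>s. F t s \<partial>\<I> L) \<partial>\<I> L)"
  proof (intro Bochner_Integration.integral_cong refl)
    fix t assume "t \<in> space (\<I> L)"
    then have t: "0 \<le> t" "t \<le> L" by auto
    have int: "integrable (\<I> L) (\<lambda>s. if s \<le> t then a (t - s) *\<^sub>R y s else 0)"
    proof (rule integrable_bounded_I[of _ _ "a0 * Y"])
      fix s assume "0 \<le> s" "s \<le> L"
      then show "norm (if s \<le> t then a (t - s) *\<^sub>R y s else 0) \<le> a0 * Y"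
        using Y ab[of "t - s"] by (auto intro!: mult_mono simp: order_trans[OF abs_ge_zero ab])
    qed measurable
    have "(\<integral>s. F t s \<partial>\<I> L) = (\<integral>s. complexify (\<psi>' t) (if s \<le> t then a (t - s) *\<^sub>R y s else 0) \<partial>\<I> L)"
      by (intro Bochner_Integration.integral_cong refl) (simp add: F_def cpx.scaleR_left cpx.scaleR_right cpx.zero_left cpx.zero_right)
    also have "\<dots> = complexify (\<psi>' t) (\<integral>s. (if s \<le> t then a (t - s) *\<^sub>R y s else 0) \<partial>\<I> L)"
      by (rule integral_bounded_linear[OF cpx.bounded_linear_right int])
    also have "(\<integral>s. (if s \<le> t then a (t - s) *\<^sub>R y s else 0) \<partial>\<I> L) = w t - w 0"
      using orbit_eq[OF t] unfolding a_def[symmetric] by simp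
    finally show "complexify (\<psi>' t) (w t) = complexify (\<psi>' t) (w 0) + (\<integral>s. F t s \<partial>\<I> L)"
      by (simp add: cpx.diff_right)
  qed
  also have "\<dots> = (\<integral>t. complexify (\<psi>' t) (w 0) \<partial>\<I> L) + (\<integral>t. (\<integral>s. F t s \<partial>\<I> L) \<partial>\<I> L)"
    by (intro Bochner_Integration.integral_add Fub(2) integrable_bounded_linear[OF cpx.bounded_linear_left psi_int])
  also have "(\<integral>t. complexify (\<psi>' t) (w 0) \<partial>\<I> L) = complexify (\<integral>t. \<psi>' t \<partial>\<I> L) (w 0)"
    by (rule integral_bounded_linear[OF cpx.bounded_linear_left psi_int])
  also have "(\<integral>t. \<psi>' t \<partial>\<I> L) = (\<integral>t. (if 0 \<le> t then \<psi>' t else 0) \<partial>\<I> L)"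
    by (intro Bochner_Integration.integral_cong refl) auto
  also have "\<dots> = - \<psi> 0" by (rule integral_test_function_derivative[OF \<psi>]) simp
  also have "(\<integral>t. (\<integral>s. F t s \<partial>\<I> L) \<partial>\<I> L) = (\<integral>s. (\<integral>t. F t s \<partial>\<I> L) \<partial>\<I> L)" by (rule Fub(1))
  also have "\<dots> = (\<integral>s. - complexify (\<psi> s + (\<integral>r. \<kappa> r *\<^sub>R \<psi> (s + r) \<partial>\<I> L)) (y s) \<partial>\<I> L)"
  proof (intro Bochner_Integration.integral_cong refl)
    fix s assume "s \<in> space (\<I> L)"
    then have s: "0 \<le> s" "s \<le> L" by auto
    have int: "integrable (\<I> L) (\<lambda>t. if s \<le> t then a (t - s) *\<^sub>R \<psi>' t else 0)"
    proof (rule integrable_bounded_I[of _ _ "a0 * C"])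
      fix t assume "0 \<le> t" "t \<le> L"
      then show "norm (if s \<le> t then a (t - s) *\<^sub>R \<psi>' t else 0) \<le> a0 * C"
        using C[of t] ab[of "t - s"] C0 by (auto intro!: mult_mono simp: order_trans[OF abs_ge_zero ab])
    qed measurable
    have "(\<integral>t. F t s \<partial>\<I> L) = complexify (\<integral>t. (if s \<le> t then a (t - s) *\<^sub>R \<psi>' t else 0) \<partial>\<I> L) (y s)"
      unfolding F_def by (rule integral_bounded_linear[OF cpx.bounded_linear_left int])
    also have "\<dots> = complexify (- (\<psi> s + (\<integral>r. \<kappa> r *\<^sub>R \<psi> (s + r) \<partial>\<I> L))) (y s)"
      using kernel_primitive_deriv_swap[OF \<psi> s] unfolding a_def[symmetric] by (simp only:)
    finally show "(\<integral>t. F t s \<partial>\<I> L) = - complexify (\<psi> s + (\<integral>r. \<kappa> r *\<^sub>R \<psi> (s + r) \<partial>\<I> L)) (y s)"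
      by (simp only: cpx.minus_left)
  qed
  finally show ?thesis by (simp add: cpx.minus_left)
qed

text \<open>\<open>A\<close> passes through the integral by means of the bounded operator
  \<open>R1\<close>: as R1 (w - y) = w, the integral of h w is \<open>R1\<close>, taken
  componentwise, of the integral of h (w - y). Hence it lies in the domain, and A R1 = R1 - 1 gives
  its image.\<close>

lemma operator_of_integral:
  fixes h :: "real \<Rightarrow> complex"
  assumes hm[measurable]: "h \<in> borel_measurable (\<I> L)" and hb: "\<And>s. 0 \<le> s \<Longrightarrow> s \<le> L \<Longrightarrow> norm (h s) \<le> C"
  shows "(\<integral>s. complexify (h s) (w s) \<partial>\<I> L) \<in> D \<times> D"
    and "map_prod A A (\<integral>s. complexify (h s) (w s) \<partial>\<I> L) = (\<integral>s. complexify (h s) (y s) \<partial>\<I> L)"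
proof -
  obtain Y where Y: "Y \<ge> 0" "\<And>t. 0 \<le> t \<Longrightarrow> t \<le> L \<Longrightarrow> norm (y t) \<le> Y"
    using image_bounded by blast
  have C0: "C \<ge> 0" using hb[of 0] L_pos norm_ge_zero by (meson less_imp_le order_refl order_trans)
  have wint: "integrable (\<I> L) (\<lambda>s. complexify (h s) (w s))"
  proof (rule integrable_bounded_I[of _ _ "2 * C * B"])
    show "norm (complexify (h s) (w s)) \<le> 2 * C * B" if "0 \<le> s" "s \<le> L" for s
      using hb[OF that] orbit_bound[OF that] C0 by (intro order_trans[OF norm_complexify] mult_mono) auto
  qed measurable
  have yint: "integrable (\<I> L) (\<lambda>s. complexify (h s) (y s))"
  proof (rule integrable_bounded_I[of _ _ "2 * C * Y"])
    show "norm (complexify (h s) (y s)) \<le> 2 * C * Y" if "0 \<le> s" "s \<le> L" for s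
      using hb[OF that] Y(2)[OF that] C0 by (intro order_trans[OF norm_complexify] mult_mono) auto
  qed measurable
  define v where "v = (\<integral>s. complexify (h s) (w s) \<partial>\<I> L) - (\<integral>s. complexify (h s) (y s) \<partial>\<I> L)"
  have v: "v = (\<integral>s. complexify (h s) (w s - y s) \<partial>\<I> L)"
    unfolding v_def by (subst Bochner_Integration.integral_diff[OF wint yint, symmetric]) (simp add: cpx.diff_right)
  have vint: "integrable (\<I> L) (\<lambda>s. complexify (h s) (w s - y s))"
    using Bochner_Integration.integrable_diff[OF wint yint] by (simp add: cpx.diff_right)
  have bl: "bounded_linear (map_prod R1 R1)"
  proof -
    have "map_prod R1 R1 = (\<lambda>p. (R1 (fst p), R1 (snd p)))" by (auto simp: map_prod_def split: prod.splits)
    then show ?thesis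
      by (auto intro!: bounded_linear_Pair bounded_linear_compose[OF blinfun.bounded_linear_right] bounded_linear_fst bounded_linear_snd)
  qed
  have "map_prod R1 R1 v = (\<integral>s. map_prod R1 R1 (complexify (h s) (w s - y s)) \<partial>\<I> L)"
    unfolding v by (rule integral_bounded_linear[OF bl vint, symmetric])
  also have "\<dots> = (\<integral>s. complexify (h s) (w s) \<partial>\<I> L)"
  proof (intro Bochner_Integration.integral_cong refl)
    fix s assume "s \<in> space (\<I> L)"
    then have "R1 (w s - y s) = w s"
      using R1 orbit_domain[of s] image_eq[of s] by (simp add: real_resolvent_def)
    then show "map_prod R1 R1 (complexify (h s) (w s - y s)) = complexify (h s) (w s)"
      by (simp add: complexify_def blinfun.scaleR_right)
  qed
  finally have Rv: "map_prod R1 R1 v = (\<integral>s. complexify (h s) (w s) \<partial>\<I> L)" .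
  have "A (R1 x) = R1 x - x" for x
    using R1 unfolding real_resolvent_def by (metis scaleR_one diff_diff_eq2 add_diff_cancel_left' diff_add_cancel)
  then have "map_prod A A (map_prod R1 R1 v) = map_prod R1 R1 v - v"
    by (cases v) simp
  then show "map_prod A A (\<integral>s. complexify (h s) (w s) \<partial>\<I> L) = (\<integral>s. complexify (h s) (y s) \<partial>\<I> L)"
    unfolding Rv by (simp add: v_def)
  show "(\<integral>s. complexify (h s) (w s) \<partial>\<I> L) \<in> D \<times> D"
    unfolding Rv[symmetric] using R1 by (cases v) (auto simp: real_resolvent_def)
qed

end

context volterra_kernel
begin

text \<open>Integration by parts on [\<sigma>, L], away from the singularity. As the kernel
  decreases, its variation there is \<kappa> \<sigma> - \<kappa> L, which together with both
  boundary terms adds up to 2 \<kappa> \<sigma>.\<close>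

lemma kernel_tail_oscillation:
  assumes \<sigma>: "0 < \<sigma>" and \<mu>: "0 \<le> Re \<mu>" "\<mu> \<noteq> 0"
  shows "cmod (\<integral>\<tau>. (if \<sigma> \<le> \<tau> then of_real (\<kappa> \<tau>) * exp (- (\<mu> * of_real \<tau>)) else 0) \<partial>\<I> L) \<le> 2 * \<kappa> \<sigma> / cmod \<mu>"
proof (cases "\<sigma> \<le> L")
  case True
  define e where "e \<tau> = exp (- (\<mu> * of_real \<tau>))" for \<tau> :: real
  have e1: "cmod (e \<tau>) \<le> 1" if "0 \<le> \<tau>" for \<tau> using \<mu> that by (simp add: e_def)
  have ed: "(e has_vector_derivative (- \<mu> * e t)) (at t within S)" for t S
    unfolding e_def by (auto intro!: derivative_eq_intros has_vector_derivative_real_field)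
  have kd: "((\<lambda>t. complex_of_real (\<kappa> t)) has_vector_derivative of_real (\<kappa>' t)) (at t within S)" if "0 < t" for t S
    using has_vector_derivative_of_real[OF kernel_deriv[OF that]]
    by (rule has_vector_derivative_at_within)
  have ec: "continuous_on S e" for S unfolding e_def by (intro continuous_intros)
  have kc: "continuous_on {\<sigma>..L} \<kappa>"
    using \<sigma> by (intro DERIV_continuous_on[of _ _ \<kappa>'] has_field_derivative_at_within[OF kernel_deriv]) auto
  have kc': "continuous_on {\<sigma>..L} \<kappa>'" using \<sigma> by (intro continuous_on_subset[OF kernel_deriv_continuous]) auto
  define G where "G t = of_real (\<kappa>' t) * e t" for t
  have F: "(\<integral>t. indicator {\<sigma>..L} t *\<^sub>R (G t - \<mu> * (of_real (\<kappa> t) * e t)) \<partial>lborel) = of_real (\<kappa> L) * e L - of_real (\<kappa> \<sigma>) * e \<sigma>"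
  proof (rule integral_FTC_Icc[OF True])
    show "((\<lambda>t. of_real (\<kappa> t) * e t) has_vector_derivative G t - \<mu> * (of_real (\<kappa> t) * e t)) (at t within {\<sigma>..L})"
      if "\<sigma> \<le> t" "t \<le> L" for t
      using has_vector_derivative_mult[OF kd ed, of t "{\<sigma>..L}" ] that \<sigma> by (simp add: G_def algebra_simps)
    show "continuous_on {\<sigma>..L} (\<lambda>t. G t - \<mu> * (of_real (\<kappa> t) * e t))"
      unfolding G_def by (intro continuous_intros kc kc' ec)
  qed
  have Gi: "integrable lborel (\<lambda>t. indicator {\<sigma>..L} t *\<^sub>R G t)"
    unfolding G_def by (intro borel_integrable_compact continuous_intros kc' ec) simp
  have Ki: "integrable lborel (\<lambda>t. indicator {\<sigma>..L} t *\<^sub>R (of_real (\<kappa> t) * e t))"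
    by (intro borel_integrable_compact continuous_intros kc ec) simp
  define J where "J = (\<integral>t. indicator {\<sigma>..L} t *\<^sub>R (of_real (\<kappa> t) * e t) \<partial>lborel)"
  have "(\<integral>t. indicator {\<sigma>..L} t *\<^sub>R (G t - \<mu> * (of_real (\<kappa> t) * e t)) \<partial>lborel)
    = (\<integral>t. indicator {\<sigma>..L} t *\<^sub>R G t - \<mu> * (indicator {\<sigma>..L} t *\<^sub>R (of_real (\<kappa> t) * e t)) \<partial>lborel)"
    by (intro Bochner_Integration.integral_cong refl) (simp add: algebra_simps)
  also have "\<dots> = (\<integral>t. indicator {\<sigma>..L} t *\<^sub>R G t \<partial>lborel) - \<mu> * J"
    unfolding J_def by (subst Bochner_Integration.integral_diff[OF Gi integrable_mult_right[OF Ki]])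
      (simp only: integral_mult_right_zero)
  finally have E: "(\<integral>t. indicator {\<sigma>..L} t *\<^sub>R (G t - \<mu> * (of_real (\<kappa> t) * e t)) \<partial>lborel)
    = (\<integral>t. indicator {\<sigma>..L} t *\<^sub>R G t \<partial>lborel) - \<mu> * J" .
  have muJ: "\<mu> * J = (\<integral>t. indicator {\<sigma>..L} t *\<^sub>R G t \<partial>lborel) - of_real (\<kappa> L) * e L + of_real (\<kappa> \<sigma>) * e \<sigma>"
    using F unfolding E by (simp add: algebra_simps)
  have "(\<integral>t. indicator {\<sigma>..L} t *\<^sub>R (- \<kappa>' t) \<partial>lborel) = - \<kappa> L - (- \<kappa> \<sigma>)"
    using \<sigma> kc' has_field_derivative_at_within[OF kernel_deriv]
    by (intro integral_FTC_Icc[OF True]) (auto intro!: derivative_intros continuous_intros simp flip: has_real_derivative_iff_has_vector_derivative)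
  moreover have "cmod (\<integral>t. indicator {\<sigma>..L} t *\<^sub>R G t \<partial>lborel) \<le> (\<integral>t. indicator {\<sigma>..L} t *\<^sub>R (- \<kappa>' t) \<partial>lborel)"
  proof (rule norm_integral_le)
    show "integrable lborel (\<lambda>t. indicator {\<sigma>..L} t *\<^sub>R (- \<kappa>' t))"
      by (intro borel_integrable_compact continuous_intros kc') simp
    show "norm (indicator {\<sigma>..L} t *\<^sub>R G t) \<le> indicator {\<sigma>..L} t *\<^sub>R - \<kappa>' t" for t
      using \<sigma> kernel_deriv_nonpos[of t] e1[of t] mult_left_mono[of "cmod (e t)" 1 "- \<kappa>' t"]
      by (auto simp: indicator_def G_def norm_mult)
  qed
  ultimately have G: "cmod (\<integral>t. indicator {\<sigma>..L} t *\<^sub>R G t \<partial>lborel) \<le> \<kappa> \<sigma> - \<kappa> L" by simp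
  have "cmod (of_real (\<kappa> L) * e L) \<le> \<kappa> L" "cmod (of_real (\<kappa> \<sigma>) * e \<sigma>) \<le> \<kappa> \<sigma>"
    using e1[of L] e1[of \<sigma>] \<sigma> L_pos kernel_nonneg by (auto simp: norm_mult intro!: mult_left_le)
  then have "cmod (\<mu> * J) \<le> 2 * \<kappa> \<sigma>"
    unfolding muJ using G norm_triangle_ineq[of "(\<integral>t. indicator {\<sigma>..L} t *\<^sub>R G t \<partial>lborel) - of_real (\<kappa> L) * e L" "of_real (\<kappa> \<sigma>) * e \<sigma>"]
      norm_triangle_ineq4[of "(\<integral>t. indicator {\<sigma>..L} t *\<^sub>R G t \<partial>lborel)" "of_real (\<kappa> L) * e L"] by linarith
  moreover have "(\<integral>\<tau>. (if \<sigma> \<le> \<tau> then of_real (\<kappa> \<tau>) * exp (- (\<mu> * of_real \<tau>)) else 0) \<partial>\<I> L) = J"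
    unfolding integral_I J_def e_def using \<sigma> by (intro Bochner_Integration.integral_cong refl) (auto simp: indicator_def)
  ultimately show ?thesis using \<mu>(2) by (simp add: field_simps norm_mult)
next
  case False
  then have "(\<integral>\<tau>. (if \<sigma> \<le> \<tau> then of_real (\<kappa> \<tau>) * exp (- (\<mu> * of_real \<tau>)) else 0) \<partial>\<I> L) = (\<integral>\<tau>. (0::complex) \<partial>\<I> L)"
    by (intro Bochner_Integration.integral_cong refl) auto
  then show ?thesis using kernel_nonneg by simp
qed

end

section \<open>The Laplace transform of an orbit\<close>

context volterra_orbit
begin

text \<open>No growth bound on the orbit is involved, because the integral stops at
  \<open>L\<close>, beyond which the test functions vanish.\<close>

definition transform :: "complex \<Rightarrow> (real \<Rightarrow> real) \<Rightarrow> 'w \<times> 'w" where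
  "transform \<mu> \<phi> = (\<integral>s. complexify (exp (- (\<mu> * of_real s)) * of_real (\<phi> s)) (w s) \<partial>\<I> L)"

lemma transform_bound:
  assumes "0 \<le> Re \<mu>" "\<And>s. 0 \<le> s \<Longrightarrow> \<bar>\<phi> s\<bar> \<le> C"
  shows "norm (transform \<mu> \<phi>) \<le> L * (2 * C * B)"
proof -
  have C: "C \<ge> 0" using assms(2)[of 0] by simp
  show ?thesis unfolding transform_def
  proof (rule norm_integral_I_le)
    fix s assume s: "0 \<le> s" "s \<le> L"
    have "cmod (exp (- (\<mu> * of_real s)) * of_real (\<phi> s)) \<le> 1 * C"
      unfolding norm_mult using assms s by (intro mult_mono) auto
    then show "norm (complexify (exp (- (\<mu> * of_real s)) * of_real (\<phi> s)) (w s)) \<le> 2 * C * B"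
      using orbit_bound[OF s] C by (intro order_trans[OF norm_complexify] mult_mono) auto
  qed (use C bound_nonneg L_pos in auto)
qed

text \<open>Fubini: averaging the shifts of \<phi> under the transform is averaging the transforms
  of the shifts. It serves both the damped kernel and its oscillating tails, hence the general
  weight \<open>g\<close> with integrable majorant \<open>k\<close>.\<close>

lemma transform_shift_average:
  assumes g: "g \<in> borel_measurable (\<I> L)" "integrable (\<I> L) k" "\<And>\<sigma>. 0 \<le> \<sigma> \<Longrightarrow> \<sigma> \<le> L \<Longrightarrow> cmod (g \<sigma>) \<le> k \<sigma>"
    and \<phi>: "continuous_on UNIV \<phi>" "\<And>s. 0 \<le> s \<Longrightarrow> \<bar>\<phi> s\<bar> \<le> C" and \<mu>: "0 \<le> Re \<mu>"
  shows "(\<integral>s. complexify (exp (- (\<mu> * of_real s)) * (\<integral>\<sigma>. g \<sigma> * of_real (\<phi> (s + \<sigma>)) \<partial>\<I> L)) (w s) \<partial>\<I> L)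
      = (\<integral>\<sigma>. complexification_scale (g \<sigma>) (transform \<mu> (\<lambda>s. \<phi> (s + \<sigma>))) \<partial>\<I> L)"
    and "integrable (\<I> L) (\<lambda>\<sigma>. complexification_scale (g \<sigma>) (transform \<mu> (\<lambda>s. \<phi> (s + \<sigma>))))"
proof -
  note g(1)[measurable]
  have [measurable]: "\<phi> \<in> borel_measurable borel" using \<phi>(1) by (rule borel_measurable_continuous_onI)
  have C: "C \<ge> 0" using \<phi>(2)[of 0] by simp
  define f where "f s \<sigma> = complexify (exp (- (\<mu> * of_real s)) * (g \<sigma> * of_real (\<phi> (s + \<sigma>)))) (w s)" for s \<sigma>
  have e1: "cmod (exp (- (\<mu> * of_real s))) \<le> 1" if "0 \<le> s" for s :: real using \<mu> that by simp
  have fm: "(\<lambda>(s, \<sigma>). f s \<sigma>) \<in> borel_measurable (\<I> L \<Otimes>\<^sub>M \<I> L)" unfolding f_def by measurable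
  have fb: "norm (f s \<sigma>) \<le> (2 * C * B) * k \<sigma>" if s: "0 \<le> s" "s \<le> L" and \<sigma>: "0 \<le> \<sigma>" "\<sigma> \<le> L" for s \<sigma>
  proof -
    have "k \<sigma> \<ge> 0" using g(3)[OF \<sigma>] norm_ge_zero order_trans by blast
    have "cmod (exp (- (\<mu> * of_real s)) * (g \<sigma> * of_real (\<phi> (s + \<sigma>)))) \<le> 1 * (k \<sigma> * C)"
      unfolding norm_mult using e1[OF s(1)] g(3)[OF \<sigma>] \<phi>(2)[of "s + \<sigma>"] s \<sigma> \<open>k \<sigma> \<ge> 0\<close> by (intro mult_mono) auto
    then have "norm (f s \<sigma>) \<le> (2 * (1 * (k \<sigma> * C))) * B"
      unfolding f_def using orbit_bound[OF s] C \<open>k \<sigma> \<ge> 0\<close> by (intro order_trans[OF norm_complexify] mult_mono) auto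
    then show ?thesis by (simp add: mult_ac)
  qed
  have cint: "integrable (\<I> L) (\<lambda>s. 2 * C * B)" by simp
  note Fub = Fubini_I[OF fm cint g(2) fb]
  have inner: "(\<integral>\<sigma>. f s \<sigma> \<partial>\<I> L) = complexify (exp (- (\<mu> * of_real s)) * (\<integral>\<sigma>. g \<sigma> * of_real (\<phi> (s + \<sigma>)) \<partial>\<I> L)) (w s)"
    if s: "0 \<le> s" for s
  proof -
    have "integrable (\<I> L) (\<lambda>\<sigma>. g \<sigma> * of_real (\<phi> (s + \<sigma>)))"
    proof (rule Bochner_Integration.integrable_bound)
      show "integrable (\<I> L) (\<lambda>\<sigma>. k \<sigma> * C)" using g(2) by simp
      show "AE \<sigma> in \<I> L. norm (g \<sigma> * complex_of_real (\<phi> (s + \<sigma>))) \<le> norm (k \<sigma> * C)"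
      proof (rule AE_I2)
        fix \<sigma> assume "\<sigma> \<in> space (\<I> L)"
        then have "cmod (g \<sigma>) \<le> \<bar>k \<sigma>\<bar>" "\<bar>\<phi> (s + \<sigma>)\<bar> \<le> \<bar>C\<bar>" using g(3)[of \<sigma>] \<phi>(2)[of "s + \<sigma>"] s by auto
        then show "norm (g \<sigma> * complex_of_real (\<phi> (s + \<sigma>))) \<le> norm (k \<sigma> * C)"
          by (simp add: norm_mult abs_mult mult_mono)
      qed
    qed measurable
    then have "integrable (\<I> L) (\<lambda>\<sigma>. exp (- (\<mu> * of_real s)) * (g \<sigma> * of_real (\<phi> (s + \<sigma>))))"
      by (rule integrable_mult_right)
    from integral_bounded_linear[OF cpx.bounded_linear_left this, of "w s"] show ?thesis
      by (simp add: f_def)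
  qed
  have outer: "(\<integral>s. f s \<sigma> \<partial>\<I> L) = complexification_scale (g \<sigma>) (transform \<mu> (\<lambda>s. \<phi> (s + \<sigma>)))"
    if \<sigma>: "0 \<le> \<sigma>" for \<sigma>
  proof -
    have "integrable (\<I> L) (\<lambda>s. complexify (exp (- (\<mu> * of_real s)) * of_real (\<phi> (s + \<sigma>))) (w s))"
    proof (rule integrable_bounded_I[of _ _ "2 * C * B"])
      fix s assume s: "0 \<le> s" "s \<le> L"
      have "cmod (exp (- (\<mu> * of_real s)) * of_real (\<phi> (s + \<sigma>))) \<le> 1 * C"
        unfolding norm_mult using e1[OF s(1)] \<phi>(2)[of "s + \<sigma>"] s \<sigma> by (intro mult_mono) auto
      then show "norm (complexify (exp (- (\<mu> * of_real s)) * of_real (\<phi> (s + \<sigma>))) (w s)) \<le> 2 * C * B"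
        using orbit_bound[OF s] C by (intro order_trans[OF norm_complexify] mult_mono) auto
    qed measurable
    from integral_bounded_linear[OF cs.bounded_linear_right this, of "g \<sigma>"] show ?thesis
      by (simp add: f_def transform_def complexification_scale_complexify mult_ac)
  qed
  have "(\<integral>s. complexify (exp (- (\<mu> * of_real s)) * (\<integral>\<sigma>. g \<sigma> * of_real (\<phi> (s + \<sigma>)) \<partial>\<I> L)) (w s) \<partial>\<I> L)
      = (\<integral>s. (\<integral>\<sigma>. f s \<sigma> \<partial>\<I> L) \<partial>\<I> L)"
    by (intro Bochner_Integration.integral_cong refl) (simp add: inner)
  also have "\<dots> = (\<integral>\<sigma>. (\<integral>s. f s \<sigma> \<partial>\<I> L) \<partial>\<I> L)" by (rule Fub(1))
  also have "\<dots> = (\<integral>\<sigma>. complexification_scale (g \<sigma>) (transform \<mu> (\<lambda>s. \<phi> (s + \<sigma>))) \<partial>\<I> L)"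
    by (intro Bochner_Integration.integral_cong refl) (simp add: outer)
  finally show "(\<integral>s. complexify (exp (- (\<mu> * of_real s)) * (\<integral>\<sigma>. g \<sigma> * of_real (\<phi> (s + \<sigma>)) \<partial>\<I> L)) (w s) \<partial>\<I> L)
      = (\<integral>\<sigma>. complexification_scale (g \<sigma>) (transform \<mu> (\<lambda>s. \<phi> (s + \<sigma>))) \<partial>\<I> L)" .
  have "integrable (\<I> L) (\<lambda>\<sigma>. \<integral>s. f s \<sigma> \<partial>\<I> L)" by (rule Fub(3))
  then show "integrable (\<I> L) (\<lambda>\<sigma>. complexification_scale (g \<sigma>) (transform \<mu> (\<lambda>s. \<phi> (s + \<sigma>))))"
    by (rule Bochner_Integration.integrable_cong[THEN iffD1, rotated -1]) (auto simp: outer)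
qed

lemma shift_average_bound:
  fixes X :: "real \<Rightarrow> 'w \<times> 'w"
  assumes "integrable (\<I> L) k" "\<And>\<sigma>. 0 \<le> \<sigma> \<Longrightarrow> \<sigma> \<le> L \<Longrightarrow> cmod (g \<sigma>) \<le> k \<sigma>"
    and "\<And>\<sigma>. 0 \<le> \<sigma> \<Longrightarrow> \<sigma> \<le> L \<Longrightarrow> norm (X \<sigma>) \<le> S"
  shows "norm (\<integral>\<sigma>. complexification_scale (g \<sigma>) (X \<sigma>) \<partial>\<I> L) \<le> 4 * (\<integral>\<sigma>. k \<sigma> \<partial>\<I> L) * S"
proof -
  have "norm (\<integral>\<sigma>. complexification_scale (g \<sigma>) (X \<sigma>) \<partial>\<I> L) \<le> (\<integral>\<sigma>. k \<sigma> * (4 * S) \<partial>\<I> L)"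
  proof (rule norm_integral_le)
    fix \<sigma> assume "\<sigma> \<in> space (\<I> L)"
    then have \<sigma>: "0 \<le> \<sigma>" "\<sigma> \<le> L" by auto
    have "norm (complexification_scale (g \<sigma>) (X \<sigma>)) \<le> 4 * cmod (g \<sigma>) * norm (X \<sigma>)" by (rule norm_complexification_scale)
    also have "\<dots> \<le> 4 * k \<sigma> * S"
      using assms(2,3)[OF \<sigma>] order_trans[OF norm_ge_zero assms(2)[OF \<sigma>]] by (intro mult_mono) auto
    finally show "norm (complexification_scale (g \<sigma>) (X \<sigma>)) \<le> k \<sigma> * (4 * S)" by (simp add: mult_ac)
  qed (use assms in simp)
  then show ?thesis by (simp add: mult_ac)
qed

text \<open>The weak orbit equation for \<psi> s = exp (- \<mu> s) \<phi> s. The exponential factors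
  over s + r, so the memory term becomes the average \<open>Q\<close> of transforms of left
  shifts.\<close>

lemma transform_equation:
  assumes \<phi>: "test_function L \<phi> \<phi>'" and \<mu>: "0 \<le> Re \<mu>"
  defines "Q \<equiv> (\<integral>\<sigma>. complexification_scale (of_real (\<kappa> \<sigma>) * exp (- (\<mu> * of_real \<sigma>))) (transform \<mu> (\<lambda>s. \<phi> (s + \<sigma>))) \<partial>\<I> L)"
  shows "transform \<mu> \<phi> + Q \<in> D \<times> D"
    and "complexification_scale \<mu> (transform \<mu> \<phi>) - transform \<mu> \<phi>' - complexify (of_real (\<phi> 0)) (w 0)
      = map_prod A A (transform \<mu> \<phi> + Q)"
proof -
  define e where "e s = exp (- (\<mu> * of_real s))" for s :: real
  define \<psi> \<psi>' where "\<psi> s = e s * of_real (\<phi> s)" and "\<psi>' s = e s * of_real (\<phi>' s) - \<mu> * (e s * of_real (\<phi> s))" for s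
  have \<phi>c: "continuous_on UNIV \<phi>" "continuous_on UNIV \<phi>'"
    using \<phi> test_function_continuous by (auto simp: test_function_def)
  have ec: "continuous_on UNIV e" unfolding e_def by (intro continuous_intros)
  have [measurable]: "\<phi> \<in> borel_measurable borel" "\<phi>' \<in> borel_measurable borel" "e \<in> borel_measurable borel"
    using \<phi>c ec by (auto intro: borel_measurable_continuous_onI)
  have [measurable]: "\<phi> \<in> borel_measurable (\<I> L)" "\<phi>' \<in> borel_measurable (\<I> L)" "e \<in> borel_measurable (\<I> L)"
    by (auto intro: borel_measurable_I)
  have e1: "cmod (e s) \<le> 1" if "0 \<le> s" for s using \<mu> that by (simp add: e_def)
  have ed: "(e has_vector_derivative (- \<mu> * e t)) (at t)" for t
    unfolding e_def by (auto intro!: derivative_eq_intros has_vector_derivative_real_field)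
  have test: "test_function L \<psi> \<psi>'"
    unfolding test_function_def
  proof (intro conjI allI impI)
    fix t
    have "(\<phi> has_real_derivative \<phi>' t) (at t)"
      using \<phi> by (simp add: test_function_def has_real_derivative_iff_has_vector_derivative)
    from has_vector_derivative_mult[OF ed has_vector_derivative_of_real[OF this]]
    show "(\<psi> has_vector_derivative \<psi>' t) (at t)"
      unfolding \<psi>_def \<psi>'_def by (simp add: algebra_simps)
    show "continuous_on UNIV \<psi>'" unfolding \<psi>'_def by (intro continuous_intros ec \<phi>c)
  qed (use \<phi> in \<open>auto simp: test_function_def \<psi>_def \<psi>'_def\<close>)
  obtain C where C: "C \<ge> 0" "\<And>t. 0 \<le> t \<Longrightarrow> norm (\<phi> t) \<le> C" using test_function_bounded[OF \<phi>] by blast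
  have Cc: "\<bar>\<phi> t\<bar> \<le> C" if "0 \<le> t" for t using C(2)[OF that] by simp
  obtain C' where C': "\<And>t. t \<in> {0..L} \<Longrightarrow> norm (\<phi>' t) \<le> C'"
    using continuous_on_Icc_bounded[OF \<phi>c(2), of 0 L] by blast
  define g where "g \<sigma> = of_real (\<kappa> \<sigma>) * e \<sigma>" for \<sigma>
  have gm: "g \<in> borel_measurable (\<I> L)" unfolding g_def by measurable
  have gb: "cmod (g \<sigma>) \<le> \<kappa> \<sigma>" if "0 \<le> \<sigma>" "\<sigma> \<le> L" for \<sigma>
    using e1[OF that(1)] kernel_nonneg[of \<sigma>] mult_left_mono[of "cmod (e \<sigma>)" 1 "\<kappa> \<sigma>"] by (simp add: g_def norm_mult)
  note avg = transform_shift_average[OF gm kernel_integrable gb \<phi>c(1) Cc \<mu>]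
  have Kpsi: "(\<integral>r. \<kappa> r *\<^sub>R \<psi> (s + r) \<partial>\<I> L) = e s * (\<integral>\<sigma>. g \<sigma> * of_real (\<phi> (s + \<sigma>)) \<partial>\<I> L)" for s
  proof -
    have "e (s + r) = e s * e r" for r by (simp add: e_def distrib_left flip: exp_add)
    then show ?thesis
      by (simp add: \<psi>_def g_def scaleR_conv_of_real mult_ac flip: integral_mult_right_zero)
  qed
  define h where "h s = \<psi> s + (\<integral>r. \<kappa> r *\<^sub>R \<psi> (s + r) \<partial>\<I> L)" for s
  have hm: "h \<in> borel_measurable (\<I> L)" unfolding h_def \<psi>_def by measurable
  have psib: "cmod (\<psi> s) \<le> C" if "0 \<le> s" for s
    using mult_mono[OF e1[OF that] Cc[OF that]] by (simp add: \<psi>_def norm_mult)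
  have hb: "cmod (h s) \<le> C + (\<integral>r. \<kappa> r * C \<partial>\<I> L)" if s: "0 \<le> s" "s \<le> L" for s
  proof -
    have "norm (\<integral>r. \<kappa> r *\<^sub>R \<psi> (s + r) \<partial>\<I> L) \<le> (\<integral>r. \<kappa> r * C \<partial>\<I> L)"
    proof (rule norm_integral_le)
      show "norm (\<kappa> r *\<^sub>R \<psi> (s + r)) \<le> \<kappa> r * C" if "r \<in> space (\<I> L)" for r
        using psib[of "s + r"] s that kernel_nonneg[of r] by (auto intro: mult_left_mono)
    qed (use kernel_integrable in simp)
    then show ?thesis unfolding h_def using psib[OF s(1)] norm_triangle_ineq order_trans add_mono by meson
  qed
  have int1: "integrable (\<I> L) (\<lambda>s. complexify (\<psi> s) (w s))"
  proof (rule integrable_bounded_I[of _ _ "2 * C * B"])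
    show "norm (complexify (\<psi> s) (w s)) \<le> 2 * C * B" if "0 \<le> s" "s \<le> L" for s
      using psib[OF that(1)] orbit_bound[OF that] C by (intro order_trans[OF norm_complexify] mult_mono) auto
  qed (simp add: \<psi>_def)
  have int2: "integrable (\<I> L) (\<lambda>s. complexify (e s * of_real (\<phi>' s)) (w s))"
  proof (rule integrable_bounded_I[of _ _ "2 * (1 * C') * B"])
    show "norm (complexify (e s * of_real (\<phi>' s)) (w s)) \<le> 2 * (1 * C') * B" if "0 \<le> s" "s \<le> L" for s
    proof -
      have "cmod (e s * of_real (\<phi>' s)) \<le> 1 * C'"
        unfolding norm_mult using e1[of s] C'[of s] that by (intro mult_mono) auto
      moreover have "0 \<le> C'" using C'[of s] that norm_ge_zero order_trans by (meson atLeastAtMost_iff)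
      ultimately show ?thesis
        using orbit_bound[OF that] by (intro order_trans[OF norm_complexify] mult_mono) auto
    qed
  qed measurable
  have int3: "integrable (\<I> L) (\<lambda>s. complexify (e s * (\<integral>\<sigma>. g \<sigma> * of_real (\<phi> (s + \<sigma>)) \<partial>\<I> L)) (w s))"
  proof (rule integrable_bounded_I[of _ _ "2 * (C + (C + (\<integral>r. \<kappa> r * C \<partial>\<I> L))) * B"])
    show "norm (complexify (e s * (\<integral>\<sigma>. g \<sigma> * of_real (\<phi> (s + \<sigma>)) \<partial>\<I> L)) (w s)) \<le> 2 * (C + (C + (\<integral>r. \<kappa> r * C \<partial>\<I> L))) * B"
      if "0 \<le> s" "s \<le> L" for s
    proof -
      have "e s * (\<integral>\<sigma>. g \<sigma> * of_real (\<phi> (s + \<sigma>)) \<partial>\<I> L) = h s - \<psi> s" by (simp add: h_def Kpsi)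
      then have b: "cmod (e s * (\<integral>\<sigma>. g \<sigma> * of_real (\<phi> (s + \<sigma>)) \<partial>\<I> L)) \<le> C + (C + (\<integral>r. \<kappa> r * C \<partial>\<I> L))"
        using hb[OF that] psib[OF that(1)] norm_triangle_ineq4[of "h s" "\<psi> s"] by simp
      show ?thesis
        using b order_trans[OF norm_ge_zero b] orbit_bound[OF that]
        by (intro order_trans[OF norm_complexify] mult_mono) auto
    qed
  qed (use gm in measurable)
  have "(\<integral>s. complexify (h s) (w s) \<partial>\<I> L)
      = (\<integral>s. complexify (\<psi> s) (w s) + complexify (e s * (\<integral>\<sigma>. g \<sigma> * of_real (\<phi> (s + \<sigma>)) \<partial>\<I> L)) (w s) \<partial>\<I> L)"
    by (simp add: h_def Kpsi cpx.add_left)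
  also have "\<dots> = transform \<mu> \<phi> + Q"
    using int1 int3 avg(1) by (simp add: transform_def \<psi>_def e_def Q_def g_def)
  finally have hT: "(\<integral>s. complexify (h s) (w s) \<partial>\<I> L) = transform \<mu> \<phi> + Q" .
  have "(\<integral>t. complexify (\<psi>' t) (w t) \<partial>\<I> L)
      = (\<integral>s. complexify (e s * of_real (\<phi>' s)) (w s) - complexification_scale \<mu> (complexify (\<psi> s) (w s)) \<partial>\<I> L)"
    by (simp add: \<psi>'_def \<psi>_def cpx.diff_left complexification_scale_complexify)
  also have "\<dots> = transform \<mu> \<phi>' - complexification_scale \<mu> (transform \<mu> \<phi>)"
    using int1 int2 integral_bounded_linear[OF cs.bounded_linear_right int1, of \<mu>]
      integrable_bounded_linear[OF cs.bounded_linear_right int1, of \<mu>]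
    by (simp add: transform_def \<psi>_def e_def)
  finally have "transform \<mu> \<phi>' - complexification_scale \<mu> (transform \<mu> \<phi>)
      = - complexify (\<psi> 0) (w 0) - (\<integral>s. complexify (h s) (y s) \<partial>\<I> L)"
    using orbit_tested[OF test] by (simp add: h_def)
  then show "complexification_scale \<mu> (transform \<mu> \<phi>) - transform \<mu> \<phi>' - complexify (of_real (\<phi> 0)) (w 0)
      = map_prod A A (transform \<mu> \<phi> + Q)"
    using operator_of_integral(2)[OF hm hb] by (simp add: hT \<psi>_def e_def algebra_simps)
  show "transform \<mu> \<phi> + Q \<in> D \<times> D" using operator_of_integral(1)[OF hm hb] by (simp add: hT)
qed

end

section \<open>Decay of the transform\<close>

context volterra_kernel
begin

text \<open>The Laplace transform at \<open>b\<close> of the kernel cut off at \<open>L\<close>. For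
  Re \<mu> = b it is the total mass of the modulus of the weight in the memory term.\<close>

definition damped_mass :: "real \<Rightarrow> real" where
  "damped_mass b = (\<integral>\<sigma>. \<kappa> \<sigma> * exp (- (b * \<sigma>)) \<partial>\<I> L)"

lemma damped_kernel_integrable: "0 \<le> b \<Longrightarrow> integrable (\<I> L) (\<lambda>\<sigma>. \<kappa> \<sigma> * exp (- (b * \<sigma>)))"
  by (rule Bochner_Integration.integrable_bound[OF kernel_integrable])
     (use kernel_nonneg in \<open>auto intro!: AE_I2 mult_left_le\<close>)

lemma damped_mass_nonneg: "0 \<le> damped_mass b"
  unfolding damped_mass_def using kernel_nonneg by (intro integral_nonneg_AE) auto

lemma damped_mass_tendsto_0: "(damped_mass \<longlongrightarrow> 0) at_top"
proof -
  have "((\<lambda>b. \<integral>\<sigma>. \<kappa> \<sigma> * exp (- (b * \<sigma>)) \<partial>\<I> L) \<longlongrightarrow> (\<integral>\<sigma>. 0 \<partial>\<I> L)) at_top"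
  proof (rule integral_dominated_convergence_at_top[OF _ _ kernel_integrable])
    \<comment> \<open>At \<sigma> = 0 the exponential is constantly 1 and does not decay, but this
      point is a null set.\<close>
    have "AE \<sigma> in \<I> L. \<sigma> \<noteq> 0"
      unfolding interval_measure_from_0_def by (subst AE_restrict_space_iff) (auto intro: AE_lborel_singleton eventually_mono[OF AE_lborel_singleton[of 0]])
    then show "AE \<sigma> in \<I> L. ((\<lambda>b. \<kappa> \<sigma> * exp (- (b * \<sigma>))) \<longlongrightarrow> 0) at_top"
    proof (rule AE_mp[OF _ AE_I2], intro impI)
      fix \<sigma> :: real assume "\<sigma> \<in> space (\<I> L)" "\<sigma> \<noteq> 0"
      then have "\<sigma> > 0" by simp
      then have "filterlim (\<lambda>b. b * \<sigma>) at_top at_top"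
        using filterlim_tendsto_pos_mult_at_top[OF tendsto_const _ filterlim_ident, of \<sigma>] by (simp add: mult.commute)
      then have "((\<lambda>b. exp (- (b * \<sigma>))) \<longlongrightarrow> 0) at_top"
        by (intro filterlim_compose[OF exp_at_bot]) (simp add: filterlim_uminus_at_top)
      then show "((\<lambda>b. \<kappa> \<sigma> * exp (- (b * \<sigma>))) \<longlongrightarrow> 0) at_top"
        using tendsto_mult_right_zero by blast
    qed
    show "\<forall>\<^sub>F b in at_top. AE \<sigma> in \<I> L. norm (\<kappa> \<sigma> * exp (- (b * \<sigma>))) \<le> \<kappa> \<sigma>"
      using eventually_ge_at_top[of 0]
      by eventually_elim (use kernel_nonneg in \<open>auto intro!: AE_I2 mult_left_le\<close>)
  qed measurable
  then show ?thesis by (simp add: damped_mass_def[abs_def])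
qed

end

lemma integral_test_function_shift:
  fixes \<phi> :: "real \<Rightarrow> real"
  assumes \<phi>: "test_function L \<phi> \<phi>'" and \<tau>: "0 \<le> \<tau>" "\<tau> \<le> L"
  shows "(\<integral>\<sigma>. (if 0 < \<sigma> \<and> \<sigma> \<le> \<tau> then \<phi>' (s + \<sigma>) else 0) \<partial>\<I> L) = \<phi> (s + \<tau>) - \<phi> s"
proof -
  have c: "continuous_on UNIV \<phi>'" using \<phi> by (simp add: test_function_def)
  then have [measurable]: "\<phi>' \<in> borel_measurable borel" by (rule borel_measurable_continuous_onI)
  have "(\<integral>\<sigma>. (if 0 < \<sigma> \<and> \<sigma> \<le> \<tau> then \<phi>' (s + \<sigma>) else 0) \<partial>\<I> L)
      = (\<integral>\<sigma>. indicator {0..\<tau>} \<sigma> *\<^sub>R \<phi>' (s + \<sigma>) \<partial>lborel)"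
    unfolding integral_I using \<tau>
    by (intro integral_cong_AE eventually_mono[OF AE_lborel_singleton[of 0]])
       (auto simp: indicator_def)
  also have "\<dots> = \<phi> (s + \<tau>) - \<phi> (s + 0)"
  proof (rule integral_FTC_Icc[OF \<tau>(1)])
    show "((\<lambda>\<sigma>. \<phi> (s + \<sigma>)) has_vector_derivative \<phi>' (s + \<sigma>)) (at \<sigma> within {0..\<tau>})" for \<sigma>
    proof -
      have "(\<phi> has_real_derivative \<phi>' (s + \<sigma>)) (at (s + \<sigma>))"
        using \<phi> by (simp add: test_function_def has_real_derivative_iff_has_vector_derivative)
      moreover have "((\<lambda>\<sigma>. s + \<sigma>) has_real_derivative 1) (at \<sigma>)" by (auto intro!: derivative_eq_intros)
      ultimately have "((\<lambda>\<sigma>. \<phi> (s + \<sigma>)) has_real_derivative \<phi>' (s + \<sigma>)) (at \<sigma>)"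
        using DERIV_chain2 by fastforce
      then show ?thesis
        by (simp add: has_real_derivative_iff_has_vector_derivative has_vector_derivative_at_within)
    qed
    show "continuous_on {0..\<tau>} (\<lambda>\<sigma>. \<phi>' (s + \<sigma>))"
      by (rule continuous_on_compose2[OF c]) (auto intro!: continuous_intros)
  qed
  finally show ?thesis by simp
qed

context volterra_orbit
begin

text \<open>The transform plus \<open>Q\<close> lies in the domain and solves the resolvent equation
  with an additional \<mu> Q on the right. The factor 4 M + 1 collects 4 M from that term and 1 from
  subtracting \<open>Q\<close> again.\<close>

lemma transform_equation_estimate:
  assumes \<phi>: "test_function L \<phi> \<phi>'" and \<mu>: "0 < Re \<mu>" and est: "vertical_estimate D A M TYPE('w)" and M: "1 \<le> M"
  defines "Q \<equiv> (\<integral>\<sigma>. complexification_scale (of_real (\<kappa> \<sigma>) * exp (- (\<mu> * of_real \<sigma>))) (transform \<mu> (\<lambda>s. \<phi> (s + \<sigma>))) \<partial>\<I> L)"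
  shows "cmod \<mu> * norm (transform \<mu> \<phi>) \<le> M * (norm (transform \<mu> \<phi>') + 2 * \<bar>\<phi> 0\<bar> * B) + (4 * M + 1) * (cmod \<mu> * norm Q)"
proof -
  have \<mu>': "0 \<le> Re \<mu>" using \<mu> by simp
  define x where "x = transform \<mu> \<phi> + Q"
  have xD: "x \<in> D \<times> D" using transform_equation(1)[OF \<phi> \<mu>'] by (simp add: x_def Q_def)
  have eq: "complexification_scale \<mu> x - map_prod A A x
      = transform \<mu> \<phi>' + complexify (of_real (\<phi> 0)) (w 0) + complexification_scale \<mu> Q"
    using transform_equation(2)[OF \<phi> \<mu>'] unfolding x_def Q_def[symmetric] by (simp add: cs.add_right algebra_simps)
  have "cmod \<mu> * norm x \<le> M * norm (complexification_scale \<mu> x - map_prod A A x)"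
    using est \<mu> xD by (auto simp: vertical_estimate_def)
  also have "\<dots> \<le> M * (norm (transform \<mu> \<phi>') + 2 * \<bar>\<phi> 0\<bar> * B + 4 * cmod \<mu> * norm Q)"
  proof (rule mult_left_mono)
    have "norm (complexify (of_real (\<phi> 0)) (w 0)) \<le> 2 * \<bar>\<phi> 0\<bar> * B"
      using orbit_bound[of 0] L_pos by (intro order_trans[OF norm_complexify] mult_mono) auto
    then show "norm (complexification_scale \<mu> x - map_prod A A x) \<le> norm (transform \<mu> \<phi>') + 2 * \<bar>\<phi> 0\<bar> * B + 4 * cmod \<mu> * norm Q"
      unfolding eq by (intro order_trans[OF norm_triangle_ineq] add_mono norm_complexification_scale order_refl)
  qed (use M in simp)
  finally have "cmod \<mu> * norm x \<le> M * (norm (transform \<mu> \<phi>') + 2 * \<bar>\<phi> 0\<bar> * B + 4 * cmod \<mu> * norm Q)" .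
  moreover have "cmod \<mu> * norm (transform \<mu> \<phi>) \<le> cmod \<mu> * (norm x + norm Q)"
    using norm_triangle_ineq4[of x Q] by (intro mult_left_mono) (auto simp: x_def)
  ultimately show ?thesis by (simp add: algebra_simps)
qed

lemma kernel_exp_bound:
  "cmod (of_real (\<kappa> \<sigma>) * exp (- (\<mu> * of_real \<sigma>))) \<le> \<kappa> \<sigma> * exp (- (Re \<mu> * \<sigma>))"
  using kernel_nonneg by (simp add: norm_mult)

lemma transform_decay:
  assumes \<phi>: "test_function L \<phi> \<phi>'" and \<mu>: "0 < Re \<mu>" and est: "vertical_estimate D A M TYPE('w)" and M: "1 \<le> M"
    and small: "(4 * M + 1) * (4 * damped_mass (Re \<mu>)) \<le> 1/2"
    and C0: "\<And>s. 0 \<le> s \<Longrightarrow> \<bar>\<phi> s\<bar> \<le> C0" and C1: "\<And>s. 0 \<le> s \<Longrightarrow> \<bar>\<phi>' s\<bar> \<le> C1"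
    and \<tau>: "0 \<le> \<tau>"
  shows "cmod \<mu> * norm (transform \<mu> (\<lambda>s. \<phi> (s + \<tau>))) \<le> 4 * M * (L * C1 + C0) * B"
proof -
  define t where "t \<tau> = norm (transform \<mu> (\<lambda>s. \<phi> (s + \<tau>)))" for \<tau>
  define S where "S = (SUP \<tau>\<in>{0..}. t \<tau>)"
  have \<mu>': "0 \<le> Re \<mu>" "\<mu> \<noteq> 0" using \<mu> by auto
  \<comment> \<open>The trivial bound makes the supremum \<open>S\<close> finite; only then may S /
    2 be absorbed on the left.\<close>
  have bdd: "bdd_above (t ` {0..})"
  proof (rule bdd_aboveI2)
    show "t \<tau> \<le> L * (2 * C0 * B)" if "\<tau> \<in> {0..}" for \<tau>
      unfolding t_def using that by (intro transform_bound[OF \<mu>'(1)] C0) auto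
  qed
  have tS: "t \<tau> \<le> S" if "0 \<le> \<tau>" for \<tau> unfolding S_def using that by (intro cSUP_upper bdd) auto
  have S0: "0 \<le> S" using tS[of 0] norm_ge_zero order_trans unfolding t_def by blast
  define X where "X = M * (2 * L * C1 * B + 2 * C0 * B)"
  have step: "t \<tau> \<le> X / cmod \<mu> + S / 2" if \<tau>: "0 \<le> \<tau>" for \<tau>
  proof -
    let ?Q = "\<integral>\<sigma>. complexification_scale (of_real (\<kappa> \<sigma>) * exp (- (\<mu> * of_real \<sigma>))) (transform \<mu> (\<lambda>s. \<phi> ((s + \<sigma>) + \<tau>))) \<partial>\<I> L"
    have "cmod \<mu> * t \<tau> \<le> M * (norm (transform \<mu> (\<lambda>s. \<phi>' (s + \<tau>))) + 2 * \<bar>\<phi> (0 + \<tau>)\<bar> * B) + (4 * M + 1) * (cmod \<mu> * norm ?Q)"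
      unfolding t_def by (rule transform_equation_estimate[OF test_function_shift[OF \<phi> \<tau>] \<mu> est M])
    also have "\<dots> \<le> X + (4 * M + 1) * (cmod \<mu> * (4 * damped_mass (Re \<mu>) * S))"
    proof (intro add_mono mult_left_mono)
      have "norm (transform \<mu> (\<lambda>s. \<phi>' (s + \<tau>))) \<le> L * (2 * C1 * B)"
        using \<tau> by (intro transform_bound[OF \<mu>'(1)] C1) auto
      moreover have "2 * \<bar>\<phi> (0 + \<tau>)\<bar> * B \<le> 2 * C0 * B"
        using C0[of "0 + \<tau>"] \<tau> bound_nonneg by (intro mult_right_mono) auto
      ultimately show "M * (norm (transform \<mu> (\<lambda>s. \<phi>' (s + \<tau>))) + 2 * \<bar>\<phi> (0 + \<tau>)\<bar> * B) \<le> X"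
        unfolding X_def using M by (intro mult_left_mono) (auto simp: mult_ac)
      show "norm ?Q \<le> 4 * damped_mass (Re \<mu>) * S"
        unfolding damped_mass_def
      proof (rule shift_average_bound[OF damped_kernel_integrable[OF \<mu>'(1)] kernel_exp_bound])
        show "norm (transform \<mu> (\<lambda>s. \<phi> (s + \<sigma> + \<tau>))) \<le> S" if "0 \<le> \<sigma>" for \<sigma>
          using tS[of "\<sigma> + \<tau>"] that \<tau> by (simp add: t_def add_ac)
      qed
    qed (use M in auto)
    also have "(4 * M + 1) * (cmod \<mu> * (4 * damped_mass (Re \<mu>) * S)) = cmod \<mu> * (((4 * M + 1) * (4 * damped_mass (Re \<mu>))) * S)"
      by (simp add: mult_ac)
    also have "\<dots> \<le> cmod \<mu> * (1/2 * S)" using small S0 by (intro mult_left_mono mult_right_mono) auto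
    finally show ?thesis using \<mu>'(2) by (simp add: field_simps)
  qed
  have "S \<le> X / cmod \<mu> + S / 2" unfolding S_def by (rule cSUP_least) (use step in \<open>auto simp: S_def\<close>)
  then have "t \<tau> \<le> 2 * (X / cmod \<mu>)" using tS[OF \<tau>] by linarith
  then have "cmod \<mu> * t \<tau> \<le> 2 * X" using \<mu>'(2) by (simp add: field_simps)
  then show ?thesis by (simp add: X_def t_def algebra_simps)
qed

text \<open>
  Since \<open>\<phi> 0 = 0\<close>, the memory term is \<open>transform \<mu> \<phi>\<close> times the transform of the kernel, up to an average
  of shifts of \<open>\<phi>'\<close> with the oscillating tails of the kernel as weights; both factors gain a power of
  \<open>\<mu>\<close>.
\<close>

lemma transform_decay_square:
  assumes \<phi>: "test_function L \<phi> \<phi>'" "test_function L \<phi>' \<phi>''" "\<phi> 0 = 0"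
    and \<mu>: "0 < Re \<mu>" and est: "vertical_estimate D A M TYPE('w)" and M: "1 \<le> M"
    and small: "(4 * M + 1) * (4 * damped_mass (Re \<mu>)) \<le> 1/2"
    and C1: "\<And>s. 0 \<le> s \<Longrightarrow> \<bar>\<phi>' s\<bar> \<le> C1" and C2: "\<And>s. 0 \<le> s \<Longrightarrow> \<bar>\<phi>'' s\<bar> \<le> C2"
  shows "(cmod \<mu>)\<^sup>2 * norm (transform \<mu> \<phi>) \<le> 8 * M * (M + 8 * (4 * M + 1) * (\<integral>\<sigma>. \<kappa> \<sigma> \<partial>\<I> L)) * (L * C2 + C1) * B"
proof -
  have \<mu>': "0 \<le> Re \<mu>" "\<mu> \<noteq> 0" using \<mu> by auto
  have \<phi>c: "continuous_on UNIV \<phi>" "continuous_on UNIV \<phi>'"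
    using \<phi> test_function_continuous by (auto simp: test_function_def)
  have [measurable]: "\<phi> \<in> borel_measurable borel" "\<phi>' \<in> borel_measurable borel"
    using \<phi>c by (auto intro: borel_measurable_continuous_onI)
  have [measurable]: "\<phi> \<in> borel_measurable (\<I> L)" "\<phi>' \<in> borel_measurable (\<I> L)" by (auto intro: borel_measurable_I)
  define k0 where "k0 = (\<integral>\<sigma>. \<kappa> \<sigma> \<partial>\<I> L)"
  have k0: "k0 \<ge> 0" unfolding k0_def using kernel_nonneg by (intro integral_nonneg_AE) auto
  define g where "g \<sigma> = of_real (\<kappa> \<sigma>) * exp (- (\<mu> * of_real \<sigma>))" for \<sigma>
  have gm[measurable]: "g \<in> borel_measurable (\<I> L)" unfolding g_def by measurable
  have gb: "cmod (g \<sigma>) \<le> \<kappa> \<sigma> * exp (- (Re \<mu> * \<sigma>))" for \<sigma> unfolding g_def by (rule kernel_exp_bound)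
  have gb': "cmod (g \<sigma>) \<le> \<kappa> \<sigma>" if "0 \<le> \<sigma>" for \<sigma>
    using that \<mu>' kernel_nonneg[of \<sigma>] by (intro order_trans[OF gb] mult_left_le) auto
  define kh where "kh = (\<integral>\<tau>. g \<tau> \<partial>\<I> L)"
  have g_int: "integrable (\<I> L) g"
    by (rule Bochner_Integration.integrable_bound[OF kernel_integrable gm]) (use gb' in \<open>auto intro!: AE_I2 intro: order_trans[OF _ abs_ge_self]\<close>)
  have kh: "cmod kh \<le> damped_mass (Re \<mu>)"
    unfolding kh_def damped_mass_def by (rule norm_integral_le[OF damped_kernel_integrable[OF \<mu>'(1)] gb])
  \<comment> \<open>The tail of the damped kernel. The condition 0 < \<sigma> forces the value 0 at
    \<sigma> = 0, where the tail estimate, stated for positive \<sigma>, does not apply.\<close>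
  define \<rho> where "\<rho> \<sigma> = (\<integral>\<tau>. (if 0 < \<sigma> \<and> \<sigma> \<le> \<tau> then g \<tau> else 0) \<partial>\<I> L)" for \<sigma>
  have \<rho>m[measurable]: "\<rho> \<in> borel_measurable (\<I> L)" unfolding \<rho>_def by measurable
  have \<rho>b: "cmod (\<rho> \<sigma>) \<le> 2 / cmod \<mu> * \<kappa> \<sigma>" for \<sigma>
  proof (cases "0 < \<sigma>")
    case True
    then show ?thesis using kernel_tail_oscillation[OF True \<mu>'] unfolding \<rho>_def g_def[symmetric] by simp
  qed (use kernel_nonneg in \<open>simp add: \<rho>_def\<close>)
  obtain C0 where C0: "C0 \<ge> 0" "\<And>t. 0 \<le> t \<Longrightarrow> norm (\<phi> t) \<le> C0" using test_function_bounded[OF \<phi>(1)] by blast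
  have C0': "\<bar>\<phi> t\<bar> \<le> C0" if "0 \<le> t" for t using C0(2)[OF that] by simp
  have C1': "C1 \<ge> 0" using C1[of 0] by simp
  \<comment> \<open>Write \<phi> (s + \<tau>) as \<phi> s plus the integral of \<phi>' (s +
    \<sigma>) over 0 < \<sigma> \<le> \<tau>, then exchange the integrals: the one over \<tau>
    produces the tail \<rho> \<sigma>.\<close>
  have scalar: "(\<integral>\<sigma>. g \<sigma> * of_real (\<phi> (s + \<sigma>)) \<partial>\<I> L) = kh * of_real (\<phi> s) + (\<integral>\<sigma>. \<rho> \<sigma> * of_real (\<phi>' (s + \<sigma>)) \<partial>\<I> L)"
    if s: "0 \<le> s" for s
  proof -
    define f where "f \<sigma> \<tau> = (if 0 < \<sigma> \<and> \<sigma> \<le> \<tau> then g \<tau> * of_real (\<phi>' (s + \<sigma>)) else 0)" for \<sigma> \<tau>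
    have fm: "(\<lambda>(\<sigma>, \<tau>). f \<sigma> \<tau>) \<in> borel_measurable (\<I> L \<Otimes>\<^sub>M \<I> L)" unfolding f_def by measurable
    have fb: "norm (f \<sigma> \<tau>) \<le> C1 * \<kappa> \<tau>" if "0 \<le> \<sigma>" "0 \<le> \<tau>" for \<sigma> \<tau>
    proof -
      have "cmod (g \<tau>) * \<bar>\<phi>' (s + \<sigma>)\<bar> \<le> \<kappa> \<tau> * C1"
        using gb'[OF that(2)] C1[of "s + \<sigma>"] s that kernel_nonneg by (intro mult_mono) auto
      then show ?thesis using C1' kernel_nonneg[of \<tau>] by (auto simp: f_def norm_mult mult.commute)
    qed
    have cint: "integrable (\<I> L) (\<lambda>\<sigma>. C1)" by simp
    have "(\<integral>\<sigma>. \<rho> \<sigma> * of_real (\<phi>' (s + \<sigma>)) \<partial>\<I> L) = (\<integral>\<sigma>. (\<integral>\<tau>. f \<sigma> \<tau> \<partial>\<I> L) \<partial>\<I> L)"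
    proof (intro Bochner_Integration.integral_cong refl)
      fix \<sigma>
      have "\<rho> \<sigma> * of_real (\<phi>' (s + \<sigma>)) = (\<integral>\<tau>. (if 0 < \<sigma> \<and> \<sigma> \<le> \<tau> then g \<tau> else 0) * of_real (\<phi>' (s + \<sigma>)) \<partial>\<I> L)"
        by (simp add: \<rho>_def)
      also have "\<dots> = (\<integral>\<tau>. f \<sigma> \<tau> \<partial>\<I> L)"
        by (intro Bochner_Integration.integral_cong refl) (simp add: f_def)
      finally show "\<rho> \<sigma> * of_real (\<phi>' (s + \<sigma>)) = (\<integral>\<tau>. f \<sigma> \<tau> \<partial>\<I> L)" .
    qed
    also have "\<dots> = (\<integral>\<tau>. (\<integral>\<sigma>. f \<sigma> \<tau> \<partial>\<I> L) \<partial>\<I> L)" by (rule Fubini_I(1)[OF fm cint kernel_integrable fb])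
    also have "\<dots> = (\<integral>\<tau>. g \<tau> * of_real (\<phi> (s + \<tau>)) - g \<tau> * of_real (\<phi> s) \<partial>\<I> L)"
    proof (intro Bochner_Integration.integral_cong refl)
      fix \<tau> assume "\<tau> \<in> space (\<I> L)"
      then have \<tau>: "0 \<le> \<tau>" "\<tau> \<le> L" by auto
      have "(\<integral>\<sigma>. f \<sigma> \<tau> \<partial>\<I> L) = (\<integral>\<sigma>. g \<tau> * of_real (if 0 < \<sigma> \<and> \<sigma> \<le> \<tau> then \<phi>' (s + \<sigma>) else 0) \<partial>\<I> L)"
        by (intro Bochner_Integration.integral_cong refl) (simp add: f_def)
      also have "\<dots> = g \<tau> * of_real (\<phi> (s + \<tau>) - \<phi> s)"
        by (simp only: integral_mult_right_zero integral_complex_of_real integral_test_function_shift[OF \<phi>(1) \<tau>])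
      finally show "(\<integral>\<sigma>. f \<sigma> \<tau> \<partial>\<I> L) = g \<tau> * of_real (\<phi> (s + \<tau>)) - g \<tau> * of_real (\<phi> s)"
        by (simp add: algebra_simps)
    qed
    also have "\<dots> = (\<integral>\<tau>. g \<tau> * of_real (\<phi> (s + \<tau>)) \<partial>\<I> L) - kh * of_real (\<phi> s)"
    proof (subst Bochner_Integration.integral_diff)
      show "integrable (\<I> L) (\<lambda>\<tau>. g \<tau> * of_real (\<phi> (s + \<tau>)))"
      proof (rule Bochner_Integration.integrable_bound)
        show "integrable (\<I> L) (\<lambda>\<tau>. \<kappa> \<tau> * C0)" using kernel_integrable by simp
        show "AE \<tau> in \<I> L. norm (g \<tau> * complex_of_real (\<phi> (s + \<tau>))) \<le> norm (\<kappa> \<tau> * C0)"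
          using gb' C0' s kernel_nonneg C0(1) by (auto intro!: AE_I2 mult_mono simp: norm_mult abs_mult)
      qed measurable
    qed (use g_int in \<open>simp_all add: kh_def\<close>)
    finally show ?thesis by simp
  qed
  let ?Q = "\<integral>\<sigma>. complexification_scale (g \<sigma>) (transform \<mu> (\<lambda>s. \<phi> (s + \<sigma>))) \<partial>\<I> L"
  let ?P = "\<integral>\<sigma>. complexification_scale (\<rho> \<sigma>) (transform \<mu> (\<lambda>s. \<phi>' (s + \<sigma>))) \<partial>\<I> L"
  have \<rho>k: "integrable (\<I> L) (\<lambda>\<sigma>. 2 / cmod \<mu> * \<kappa> \<sigma>)" using kernel_integrable by simp
  note avg = transform_shift_average[OF gm kernel_integrable gb' \<phi>c(1) C0' \<mu>'(1)]
  note avg' = transform_shift_average[OF \<rho>m \<rho>k \<rho>b \<phi>c(2) C1 \<mu>'(1)]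
  define e where "e s = exp (- (\<mu> * of_real s))" for s :: real
  have ec: "continuous_on UNIV e" unfolding e_def by (intro continuous_intros)
  have [measurable]: "e \<in> borel_measurable borel" using ec by (rule borel_measurable_continuous_onI)
  have [measurable]: "e \<in> borel_measurable (\<I> L)" by (rule borel_measurable_I) measurable
  have e1: "cmod (e s) \<le> 1" if "0 \<le> s" for s using \<mu>'(1) that by (simp add: e_def)
  have intT: "integrable (\<I> L) (\<lambda>s. complexify (e s * of_real (\<phi> s)) (w s))"
  proof (rule integrable_bounded_I[of _ _ "2 * C0 * B"])
    fix s assume s: "0 \<le> s" "s \<le> L"
    have "cmod (e s * of_real (\<phi> s)) \<le> 1 * C0"
      unfolding norm_mult using e1[OF s(1)] C0'[of s] s by (intro mult_mono) auto
    then show "norm (complexify (e s * of_real (\<phi> s)) (w s)) \<le> 2 * C0 * B"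
      using orbit_bound[OF s] C0 by (intro order_trans[OF norm_complexify] mult_mono) auto
  qed measurable
  have intP: "integrable (\<I> L) (\<lambda>s. complexify (e s * (\<integral>\<sigma>. \<rho> \<sigma> * of_real (\<phi>' (s + \<sigma>)) \<partial>\<I> L)) (w s))"
  proof (rule integrable_bounded_I[of _ _ "2 * (1 * (\<integral>\<sigma>. 2 / cmod \<mu> * \<kappa> \<sigma> * C1 \<partial>\<I> L)) * B"])
    fix s assume s: "0 \<le> s" "s \<le> L"
    have "cmod (\<integral>\<sigma>. \<rho> \<sigma> * of_real (\<phi>' (s + \<sigma>)) \<partial>\<I> L) \<le> (\<integral>\<sigma>. 2 / cmod \<mu> * \<kappa> \<sigma> * C1 \<partial>\<I> L)"
    proof (rule norm_integral_le)
      show "integrable (\<I> L) (\<lambda>\<sigma>. 2 / cmod \<mu> * \<kappa> \<sigma> * C1)" using kernel_integrable by simp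
      show "cmod (\<rho> \<sigma> * of_real (\<phi>' (s + \<sigma>))) \<le> 2 / cmod \<mu> * \<kappa> \<sigma> * C1" if "\<sigma> \<in> space (\<I> L)" for \<sigma>
        unfolding norm_mult using \<rho>b[of \<sigma>] C1[of "s + \<sigma>"] s that kernel_nonneg[of \<sigma>] by (intro mult_mono) auto
    qed
    then have bb: "cmod (e s * (\<integral>\<sigma>. \<rho> \<sigma> * of_real (\<phi>' (s + \<sigma>)) \<partial>\<I> L)) \<le> 1 * (\<integral>\<sigma>. 2 / cmod \<mu> * \<kappa> \<sigma> * C1 \<partial>\<I> L)"
      unfolding norm_mult using e1[OF s(1)] by (intro mult_mono) auto
    show "norm (complexify (e s * (\<integral>\<sigma>. \<rho> \<sigma> * of_real (\<phi>' (s + \<sigma>)) \<partial>\<I> L)) (w s)) \<le> 2 * (1 * (\<integral>\<sigma>. 2 / cmod \<mu> * \<kappa> \<sigma> * C1 \<partial>\<I> L)) * B"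
      using bb orbit_bound[OF s] order_trans[OF norm_ge_zero bb] by (intro order_trans[OF norm_complexify] mult_mono) auto
  qed measurable
  have "?Q = (\<integral>s. complexify (e s * (\<integral>\<sigma>. g \<sigma> * of_real (\<phi> (s + \<sigma>)) \<partial>\<I> L)) (w s) \<partial>\<I> L)"
    unfolding e_def by (rule avg(1)[symmetric])
  also have "\<dots> = (\<integral>s. complexification_scale kh (complexify (e s * of_real (\<phi> s)) (w s))
      + complexify (e s * (\<integral>\<sigma>. \<rho> \<sigma> * of_real (\<phi>' (s + \<sigma>)) \<partial>\<I> L)) (w s) \<partial>\<I> L)"
    by (intro Bochner_Integration.integral_cong refl)
       (simp add: scalar complexification_scale_complexify distrib_left cpx.add_left mult_ac)
  also have "\<dots> = complexification_scale kh (transform \<mu> \<phi>) + ?P"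
    using integral_bounded_linear[OF cs.bounded_linear_right intT, of kh]
      integrable_bounded_linear[OF cs.bounded_linear_right intT, of kh] intP avg'(1)
    by (simp add: transform_def e_def)
  finally have Q: "?Q = complexification_scale kh (transform \<mu> \<phi>) + ?P" .
  \<comment> \<open>\<phi>' is itself a test function but need not vanish at 0, so it has
    first-order decay only. As \<phi> 0 = 0, its transform is the only source left besides the
    memory term.\<close>
  define T1 where "T1 = 4 * M * (L * C2 + C1) * B / cmod \<mu>"
  have T1: "norm (transform \<mu> (\<lambda>s. \<phi>' (s + \<sigma>))) \<le> T1" if "0 \<le> \<sigma>" for \<sigma>
    using transform_decay[OF \<phi>(2) \<mu> est M small C1 C2 that] \<mu>'(2) by (simp add: T1_def field_simps)
  have T1n: "norm (transform \<mu> \<phi>') \<le> T1" using T1[of 0] by simp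
  have "norm ?P \<le> 4 * (\<integral>\<sigma>. 2 / cmod \<mu> * \<kappa> \<sigma> \<partial>\<I> L) * T1"
    by (rule shift_average_bound[OF \<rho>k \<rho>b T1])
  \<comment> \<open>Two factors 1 / |\<mu>|: one from the tails \<rho>, one hidden in
    \<open>T1\<close>. The other part of the memory term carries the small factor \<open>kh\<close>
    and is absorbed below.\<close>
  then have P: "norm ?P \<le> 8 * k0 * T1 / cmod \<mu>" by (simp add: k0_def)
  define t where "t = norm (transform \<mu> \<phi>)"
  have "norm ?Q \<le> 4 * damped_mass (Re \<mu>) * t + 8 * k0 * T1 / cmod \<mu>"
  proof -
    have "norm (complexification_scale kh (transform \<mu> \<phi>)) \<le> 4 * damped_mass (Re \<mu>) * t"
      unfolding t_def using kh damped_mass_nonneg by (intro order_trans[OF norm_complexification_scale] mult_mono) auto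
    then show ?thesis unfolding Q using P by (intro order_trans[OF norm_triangle_ineq] add_mono)
  qed
  then have "cmod \<mu> * norm ?Q \<le> cmod \<mu> * (4 * damped_mass (Re \<mu>) * t + 8 * k0 * T1 / cmod \<mu>)"
    by (rule mult_left_mono) simp
  also have "\<dots> = 4 * damped_mass (Re \<mu>) * (cmod \<mu> * t) + 8 * k0 * T1"
    using \<mu>'(2) by (simp add: field_simps)
  finally have Qb: "(4 * M + 1) * (cmod \<mu> * norm ?Q) \<le> (4 * M + 1) * (4 * damped_mass (Re \<mu>) * (cmod \<mu> * t) + 8 * k0 * T1)"
    using M by (intro mult_left_mono) auto
  have "cmod \<mu> * t \<le> M * norm (transform \<mu> \<phi>') + (4 * M + 1) * (cmod \<mu> * norm ?Q)"
    using transform_equation_estimate[OF \<phi>(1) \<mu> est M] \<phi>(3) by (simp add: t_def g_def)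
  also have "\<dots> \<le> M * T1 + (4 * M + 1) * (4 * damped_mass (Re \<mu>) * (cmod \<mu> * t) + 8 * k0 * T1)"
    using T1n Qb M by (intro add_mono mult_left_mono) auto
  also have "\<dots> = ((4 * M + 1) * (4 * damped_mass (Re \<mu>))) * (cmod \<mu> * t) + (M + 8 * (4 * M + 1) * k0) * T1"
    by (simp add: algebra_simps)
  also have "\<dots> \<le> 1/2 * (cmod \<mu> * t) + (M + 8 * (4 * M + 1) * k0) * T1"
    using small by (intro add_right_mono mult_right_mono) (auto simp: t_def)
  finally have "cmod \<mu> * t \<le> 2 * ((M + 8 * (4 * M + 1) * k0) * T1)" by simp
  then have "cmod \<mu> * (cmod \<mu> * t) \<le> cmod \<mu> * (2 * ((M + 8 * (4 * M + 1) * k0) * T1))"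
    by (rule mult_left_mono) simp
  also have "\<dots> = 2 * (M + 8 * (4 * M + 1) * k0) * (cmod \<mu> * T1)" by simp
  also have "cmod \<mu> * T1 = 4 * M * (L * C2 + C1) * B" using \<mu>'(2) by (simp add: T1_def)
  also have "2 * (M + 8 * (4 * M + 1) * k0) * (4 * M * (L * C2 + C1) * B) = 8 * M * (M + 8 * (4 * M + 1) * k0) * (L * C2 + C1) * B"
    by simp
  finally show ?thesis by (simp add: t_def k0_def power2_eq_square mult.assoc)
qed

text \<open>On the domain n R(n) - 1 equals R(n) A. Applied to the transform plus memory term it is
  therefore R(n) of the remaining terms of \<open>transform_equation\<close>, which gains a factor M
  / n. The memory term alone is absorbed through the supremum over shifts; \<mu> stays fixed here,
  and no decay in it is sought.\<close>

lemma transform_resolvent_defect: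
  assumes \<phi>: "test_function L \<phi> \<phi>'" and \<mu>: "0 < Re \<mu>" and small: "4 * damped_mass (Re \<mu>) \<le> 1/2"
    and Rn: "real_resolvent D A n Rn" "norm Rn \<le> M / n" "0 < n"
    and C0: "\<And>s. 0 \<le> s \<Longrightarrow> \<bar>\<phi> s\<bar> \<le> C0" and C1: "\<And>s. 0 \<le> s \<Longrightarrow> \<bar>\<phi>' s\<bar> \<le> C1"
  defines "J \<equiv> \<lambda>x. n *\<^sub>R Rn x - x"
  shows "norm (map_prod J J (transform \<mu> \<phi>)) \<le> 4 * M / n * (8 * cmod \<mu> * L * C0 + 2 * L * C1 + 2 * C0) * B"
proof -
  have \<mu>': "0 \<le> Re \<mu>" using \<mu> by simp
  have Mn: "0 \<le> M / n" using Rn(2) norm_ge_zero order_trans by blast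
  have JA: "J x = Rn (A x)" if "x \<in> D" for x
  proof -
    have "Rn (n *\<^sub>R x - A x) = x" using Rn(1) that by (simp add: real_resolvent_def)
    then show ?thesis by (simp add: J_def blinfun.diff_right blinfun.scaleR_right algebra_simps)
  qed
  have Jl: "bounded_linear J"
    unfolding J_def by (intro bounded_linear_sub bounded_linear_scaleR_right bounded_linear_compose[OF bounded_linear_scaleR_right]
      blinfun.bounded_linear_right bounded_linear_ident)
  have "map_prod J J = (\<lambda>p. (J (fst p), J (snd p)))" by (auto simp: map_prod_def split: prod.splits)
  then have PJ: "bounded_linear (map_prod J J)"
    by (auto intro!: bounded_linear_Pair bounded_linear_compose[OF Jl] bounded_linear_fst bounded_linear_snd)
  interpret J: bounded_linear J by (rule Jl)
  interpret PJ: bounded_linear "map_prod J J" by (rule PJ)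
  have Jcs: "map_prod J J (complexification_scale a x) = complexification_scale a (map_prod J J x)" for a x
    by (cases x) (simp add: complexification_scale_def J.add J.diff J.scaleR)
  have PR: "norm (map_prod Rn Rn x) \<le> 2 * (M / n) * norm x" for x
  proof -
    have "norm (map_prod Rn Rn x) \<le> norm (Rn (fst x)) + norm (Rn (snd x))"
      by (cases x) (simp add: norm_Pair_le)
    also have "\<dots> \<le> M / n * norm x + M / n * norm x"
      using Rn(2) norm_fst_le[of "fst x" "snd x"] norm_snd_le[of "snd x" "fst x"] Mn
      by (intro add_mono order_trans[OF norm_blinfun] mult_mono) auto
    finally show ?thesis by simp
  qed
  define j where "j \<tau> = norm (map_prod J J (transform \<mu> (\<lambda>s. \<phi> (s + \<tau>))))" for \<tau>
  define S where "S = (SUP \<tau>\<in>{0..}. j \<tau>)"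
  \<comment> \<open>\<open>KJ\<close> serves to make the supremum finite; the final bound does not
    contain it.\<close>
  obtain KJ where KJ: "KJ > 0" "\<And>x. norm (map_prod J J x) \<le> norm x * KJ" using PJ.pos_bounded by blast
  have Tb: "norm (transform \<mu> (\<lambda>s. \<phi> (s + \<tau>))) \<le> L * (2 * C0 * B)" if "0 \<le> \<tau>" for \<tau>
    using that by (intro transform_bound[OF \<mu>'] C0) auto
  have bdd: "bdd_above (j ` {0..})"
  proof (rule bdd_aboveI2)
    show "j \<tau> \<le> (L * (2 * C0 * B)) * KJ" if "\<tau> \<in> {0..}" for \<tau>
      unfolding j_def using that KJ Tb[of \<tau>] by (intro order_trans[OF KJ(2)] mult_right_mono) auto
  qed
  have jS: "j \<tau> \<le> S" if "0 \<le> \<tau>" for \<tau> unfolding S_def using that by (intro cSUP_upper bdd) auto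
  have S0: "0 \<le> S" using jS[of 0] norm_ge_zero order_trans unfolding j_def by blast
  define X where "X = 2 * (M / n) * (4 * cmod \<mu> * (L * (2 * C0 * B)) + L * (2 * C1 * B) + 2 * C0 * B)"
  have step: "j \<tau> \<le> X + S / 2" if \<tau>: "0 \<le> \<tau>" for \<tau>
  proof -
    note test = test_function_shift[OF \<phi> \<tau>]
    define g where "g \<sigma> = of_real (\<kappa> \<sigma>) * exp (- (\<mu> * of_real \<sigma>))" for \<sigma>
    define Tt where "Tt = transform \<mu> (\<lambda>s. \<phi> (s + \<tau>))"
    define Q where "Q = (\<integral>\<sigma>. complexification_scale (g \<sigma>) (transform \<mu> (\<lambda>s. \<phi> ((s + \<sigma>) + \<tau>))) \<partial>\<I> L)"
    have "map_prod J J (Tt + Q) = map_prod Rn Rn (map_prod A A (Tt + Q))"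
      using transform_equation(1)[OF test \<mu>'] by (cases "Tt + Q") (auto simp: JA Tt_def Q_def g_def)
    also have "map_prod A A (Tt + Q) = complexification_scale \<mu> Tt - transform \<mu> (\<lambda>s. \<phi>' (s + \<tau>)) - complexify (of_real (\<phi> (0 + \<tau>))) (w 0)"
      using transform_equation(2)[OF test \<mu>'] by (simp add: Tt_def Q_def g_def)
    finally have eq: "map_prod J J (Tt + Q) = map_prod Rn Rn (complexification_scale \<mu> Tt - transform \<mu> (\<lambda>s. \<phi>' (s + \<tau>)) - complexify (of_real (\<phi> (0 + \<tau>))) (w 0))" .
    have "norm (map_prod J J (Tt + Q)) \<le> X"
      unfolding eq X_def
    proof (rule order_trans[OF PR], rule mult_left_mono)
      have "norm (complexification_scale \<mu> Tt) \<le> 4 * cmod \<mu> * (L * (2 * C0 * B))"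
        unfolding Tt_def using Tb[OF \<tau>] by (intro order_trans[OF norm_complexification_scale] mult_left_mono) auto
      moreover have "norm (transform \<mu> (\<lambda>s. \<phi>' (s + \<tau>))) \<le> L * (2 * C1 * B)"
        using \<tau> by (intro transform_bound[OF \<mu>'] C1) auto
      moreover have "norm (complexify (of_real (\<phi> (0 + \<tau>))) (w 0)) \<le> 2 * C0 * B"
        using orbit_bound[of 0] L_pos C0[of "0 + \<tau>"] \<tau> by (intro order_trans[OF norm_complexify] mult_mono) auto
      ultimately show "norm (complexification_scale \<mu> Tt - transform \<mu> (\<lambda>s. \<phi>' (s + \<tau>)) - complexify (of_real (\<phi> (0 + \<tau>))) (w 0))
          \<le> 4 * cmod \<mu> * (L * (2 * C0 * B)) + L * (2 * C1 * B) + 2 * C0 * B"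
        by (intro order_trans[OF norm_triangle_ineq4] add_mono) auto
    qed (use Mn in auto)
    moreover have "norm (map_prod J J Q) \<le> S / 2"
    proof -
      have gm: "g \<in> borel_measurable (\<I> L)" unfolding g_def by measurable
      have gb: "cmod (g \<sigma>) \<le> \<kappa> \<sigma> * exp (- (Re \<mu> * \<sigma>))" for \<sigma> unfolding g_def by (rule kernel_exp_bound)
      have \<phi>c: "continuous_on UNIV (\<lambda>s. \<phi> (s + \<tau>))" using test_function_continuous[OF test] .
      have C0t: "\<bar>\<phi> (s + \<tau>)\<bar> \<le> C0" if "0 \<le> s" for s using C0[of "s + \<tau>"] that \<tau> by simp
      have "integrable (\<I> L) (\<lambda>\<sigma>. complexification_scale (g \<sigma>) (transform \<mu> (\<lambda>s. \<phi> ((s + \<sigma>) + \<tau>))))"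
        using transform_shift_average(2)[OF gm damped_kernel_integrable[OF \<mu>'] gb \<phi>c C0t \<mu>'] by simp
      from integral_bounded_linear[OF PJ this]
      have "map_prod J J Q = (\<integral>\<sigma>. complexification_scale (g \<sigma>) (map_prod J J (transform \<mu> (\<lambda>s. \<phi> ((s + \<sigma>) + \<tau>)))) \<partial>\<I> L)"
        by (simp add: Q_def Jcs)
      also have "norm \<dots> \<le> 4 * damped_mass (Re \<mu>) * S"
        unfolding damped_mass_def
      proof (rule shift_average_bound[OF damped_kernel_integrable[OF \<mu>'] gb])
        show "norm (map_prod J J (transform \<mu> (\<lambda>s. \<phi> (s + \<sigma> + \<tau>)))) \<le> S" if "0 \<le> \<sigma>" for \<sigma>
          using jS[of "\<sigma> + \<tau>"] that \<tau> by (simp add: j_def add_ac)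
      qed
      also have "\<dots> \<le> 1/2 * S" using small S0 by (intro mult_right_mono) auto
      finally show ?thesis by simp
    qed
    moreover have "j \<tau> \<le> norm (map_prod J J (Tt + Q)) + norm (map_prod J J Q)"
      using norm_triangle_ineq4[of "map_prod J J (Tt + Q)" "map_prod J J Q"] by (simp add: j_def Tt_def PJ.add)
    ultimately show ?thesis by linarith
  qed
  have "S \<le> X + S / 2" unfolding S_def by (rule cSUP_least) (use step in \<open>auto simp: S_def\<close>)
  then have "j 0 \<le> 2 * X" using jS[of 0] by simp
  then show ?thesis by (simp add: j_def X_def algebra_simps)
qed

end

section \<open>A modulus of continuity from the decay of the transform\<close>

text \<open>The real part of the characteristic function of the standard normal law; it exhibits the
  Gaussian as its own cosine transform up to normalization.\<close>

lemma integral_std_normal_cos: "(\<integral>x. std_normal_density x * cos (t * x) \<partial>lborel) = exp (- t\<^sup>2 / 2)"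
proof -
  have "integrable std_normal_distribution (\<lambda>x. iexp (t * x))"
  proof -
    interpret prob_space std_normal_distribution by (rule prob_space_normal_density) simp
    show ?thesis by (intro integrable_const_bound[of _ 1]) (auto intro!: borel_measurable_continuous_onI continuous_intros)
  qed
  from integral_bounded_linear[OF bounded_linear_Re this]
  have "(\<integral>x. Re (iexp (t * x)) \<partial>std_normal_distribution) = Re (char std_normal_distribution t)"
    by (simp add: char_def)
  also have "\<dots> = exp (- t\<^sup>2 / 2)" by (simp add: char_std_normal_distribution)
  finally have "(\<integral>x. cos (t * x) \<partial>std_normal_distribution) = exp (- t\<^sup>2 / 2)" by (simp add: Re_exp)
  then show ?thesis by (subst (asm) integral_density) auto
qed

text \<open>The minimum bounds the change of the sine or cosine of \<xi> t when t moves by \<eta>;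
  the weight is the decay of the transform. Its square order makes the integral finite and lets it
  tend to 0 with \<eta>.\<close>

definition oscillation_modulus :: "real \<Rightarrow> real" where
  "oscillation_modulus \<eta> = (\<integral>\<xi>. min 2 (\<bar>\<xi>\<bar> * \<bar>\<eta>\<bar>) * inverse (1 + \<xi>\<^sup>2) \<partial>lborel)"

lemma integrable_inverse_1_plus_square': "integrable lborel (\<lambda>x::real. inverse (1 + x\<^sup>2))"
proof -
  have "einterval (-\<infinity>) \<infinity> = UNIV" by (auto simp: einterval_def)
  then show ?thesis using integrable_inverse_1_plus_square by (simp add: set_integrable_def)
qed

lemma oscillation_modulus_integrable:
  fixes \<eta> :: real
  shows "integrable lborel (\<lambda>\<xi>. min 2 (\<bar>\<xi>\<bar> * \<bar>\<eta>\<bar>) * inverse (1 + \<xi>\<^sup>2))"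
  by (rule Bochner_Integration.integrable_bound[of _ "\<lambda>x. 2 * inverse (1 + x\<^sup>2)"])
     (auto intro!: integrable_inverse_1_plus_square' mult_right_mono simp: abs_mult simp del: inverse_eq_divide)

lemma oscillation_modulus_tendsto_0: "(oscillation_modulus \<longlongrightarrow> 0) (at 0)"
proof (rule tendsto_at_iff_sequentially[THEN iffD2], intro allI impI)
  fix X :: "nat \<Rightarrow> real" assume X: "X \<longlonglongrightarrow> 0"
  have "(\<lambda>n. \<integral>\<xi>. min 2 (\<bar>\<xi>\<bar> * \<bar>X n\<bar>) * inverse (1 + \<xi>\<^sup>2) \<partial>lborel) \<longlonglongrightarrow> integral\<^sup>L lborel (\<lambda>\<xi>::real. 0)"
  proof (rule integral_dominated_convergence[where w = "\<lambda>x. 2 * inverse (1 + x\<^sup>2)"])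
    show "integrable lborel (\<lambda>x::real. 2 * inverse (1 + x\<^sup>2))" by (intro integrable_mult_right integrable_inverse_1_plus_square')
    show "AE \<xi> in lborel. (\<lambda>n. min 2 (\<bar>\<xi>\<bar> * \<bar>X n\<bar>) * inverse (1 + \<xi>\<^sup>2)) \<longlonglongrightarrow> 0"
    proof (rule AE_I2)
      fix \<xi> :: real
      have "(\<lambda>n. min 2 (\<bar>\<xi>\<bar> * \<bar>X n\<bar>) * inverse (1 + \<xi>\<^sup>2)) \<longlonglongrightarrow> min 2 (\<bar>\<xi>\<bar> * \<bar>0\<bar>) * inverse (1 + \<xi>\<^sup>2)"
        by (intro tendsto_intros X)
      then show "(\<lambda>n. min 2 (\<bar>\<xi>\<bar> * \<bar>X n\<bar>) * inverse (1 + \<xi>\<^sup>2)) \<longlonglongrightarrow> 0" by simp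
    qed
    show "AE \<xi> in lborel. norm (min 2 (\<bar>\<xi>\<bar> * \<bar>X n\<bar>) * inverse (1 + \<xi>\<^sup>2)) \<le> 2 * inverse (1 + \<xi>\<^sup>2)" for n
      by (auto intro!: AE_I2 mult_right_mono simp: abs_mult simp del: inverse_eq_divide)
  qed auto
  then show "(oscillation_modulus \<circ> X) \<longlonglongrightarrow> 0" by (simp add: o_def oscillation_modulus_def)
qed

text \<open>
  Gaussian regularization: the mollified function is the integral of its cosine and sine transforms
  against a Gaussian of height at most one, hence it inherits a modulus of continuity from the decay
  of the transforms which does not depend on the regularization.
\<close>

lemma modulus_of_transform_decay:
  fixes v :: "real \<Rightarrow> 'w::{banach, second_countable_topology}"
  assumes vc: "continuous_on UNIV v" and v0: "\<And>t. t \<notin> {0..L} \<Longrightarrow> v t = 0"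
    and K: "\<And>\<xi>. norm (\<integral>r. cos (\<xi> * r) *\<^sub>R v r \<partial>\<I> L) + norm (\<integral>r. sin (\<xi> * r) *\<^sub>R v r \<partial>\<I> L) \<le> K * inverse (1 + \<xi>\<^sup>2)"
  shows "norm (v t - v t') \<le> K * oscillation_modulus (t - t')"
proof -
  interpret P: pair_sigma_finite "\<I> L" lborel by standard
  have [measurable]: "v \<in> borel_measurable borel" using vc by (rule borel_measurable_continuous_onI)
  have [measurable]: "v \<in> borel_measurable (\<I> L)" by (rule borel_measurable_I) measurable
  obtain V0 where V0: "\<And>t. t \<in> {0..L} \<Longrightarrow> norm (v t) \<le> V0"
    using continuous_on_Icc_bounded[OF vc, of 0 L] by blast
  define V where "V = max 0 V0"
  have V: "norm (v t) \<le> V" for t using V0[of t] v0[of t] by (cases "t \<in> {0..L}") (auto simp: V_def le_max_iff_disj)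
  have V_nonneg: "0 \<le> V" by (simp add: V_def)
  have K0: "0 \<le> K" using order_trans[OF add_nonneg_nonneg[OF norm_ge_zero norm_ge_zero] K[of 0]] by simp
  define N where "N = std_normal_density"
  have Nm[measurable]: "N \<in> borel_measurable borel" by (simp add: N_def)
  have Nint: "integrable lborel N" by (simp add: N_def)
  have N0: "0 \<le> N x" for x by (simp add: N_def)
  have pi1: "1 \<le> sqrt (2 * pi)" using pi_gt3 by simp
  have N1: "N x \<le> 1" for x
  proof -
    have "N x \<le> (1 / sqrt (2 * pi)) * 1"
      unfolding N_def std_normal_density_def by (intro mult_left_mono) auto
    also have "\<dots> \<le> 1" using pi1 by simp
    finally show ?thesis .
  qed
  have Neq: "N y = (1 / sqrt (2 * pi)) * (\<integral>x. N x * cos (y * x) \<partial>lborel)" for y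
    unfolding N_def by (subst integral_std_normal_cos) (simp add: std_normal_density_def)
  \<comment> \<open>The addition theorem confines the dependence on \<open>t\<close> to two scalar
    coefficients of modulus at most 1, so differences in \<open>t\<close> reduce to differences of
    sines and cosines.\<close>
  define W where "W \<xi> t = (\<integral>r. cos (\<xi> * (r - t)) *\<^sub>R v r \<partial>\<I> L)" for \<xi> t
  have Wm[measurable]: "(\<lambda>\<xi>. W \<xi> t) \<in> borel_measurable borel" for t unfolding W_def by measurable
  define VC VS where "VC \<xi> = (\<integral>r. cos (\<xi> * r) *\<^sub>R v r \<partial>\<I> L)" and "VS \<xi> = (\<integral>r. sin (\<xi> * r) *\<^sub>R v r \<partial>\<I> L)" for \<xi>
  have W: "W \<xi> t = cos (\<xi> * t) *\<^sub>R VC \<xi> + sin (\<xi> * t) *\<^sub>R VS \<xi>" for \<xi> t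
  proof -
    have ic: "integrable (\<I> L) (\<lambda>r. cos (\<xi> * r) *\<^sub>R v r)"
      by (rule integrable_bounded_I[of _ _ V]) (auto intro: order_trans[OF mult_left_le_one_le V] simp: abs_cos_le_one)
    have si: "integrable (\<I> L) (\<lambda>r. sin (\<xi> * r) *\<^sub>R v r)"
      by (rule integrable_bounded_I[of _ _ V]) (auto intro: order_trans[OF mult_left_le_one_le V] simp: abs_sin_le_one)
    have "W \<xi> t = (\<integral>r. cos (\<xi> * t) *\<^sub>R (cos (\<xi> * r) *\<^sub>R v r) + sin (\<xi> * t) *\<^sub>R (sin (\<xi> * r) *\<^sub>R v r) \<partial>\<I> L)"
      unfolding W_def by (intro Bochner_Integration.integral_cong refl)
        (simp add: right_diff_distrib cos_diff scaleR_add_left mult.commute)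
    also have "\<dots> = cos (\<xi> * t) *\<^sub>R VC \<xi> + sin (\<xi> * t) *\<^sub>R VS \<xi>"
      unfolding VC_def VS_def
      by (subst Bochner_Integration.integral_add[OF integrable_scaleR_right[OF ic] integrable_scaleR_right[OF si]])
         (simp add: ic si del: scaleR_scaleR)
    finally show ?thesis .
  qed
  have VCS: "norm (VC \<xi>) + norm (VS \<xi>) \<le> K * inverse (1 + \<xi>\<^sup>2)" for \<xi>
    unfolding VC_def VS_def by (rule K)
  have Wb: "norm (W \<xi> t) \<le> K * inverse (1 + \<xi>\<^sup>2)" for \<xi> t
  proof -
    have "norm (W \<xi> t) \<le> norm (VC \<xi>) + norm (VS \<xi>)"
      unfolding W by (intro order_trans[OF norm_triangle_ineq] add_mono)
        (auto intro!: mult_left_le_one_le simp: abs_cos_le_one abs_sin_le_one)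
    then show ?thesis using VCS[of \<xi>] by linarith
  qed
  have Wd: "norm (W \<xi> t - W \<xi> t') \<le> K * (min 2 (\<bar>\<xi>\<bar> * \<bar>t - t'\<bar>) * inverse (1 + \<xi>\<^sup>2))" for \<xi>
  proof -
    define m where "m = min 2 (\<bar>\<xi>\<bar> * \<bar>t - t'\<bar>)"
    have "\<bar>cos x - cos y\<bar> \<le> min 2 \<bar>x - y\<bar>" "\<bar>sin x - sin y\<bar> \<le> min 2 \<bar>x - y\<bar>" for x y :: real
    proof -
      have "\<bar>cos x - cos y\<bar> = 2 * \<bar>sin ((x + y) / 2)\<bar> * \<bar>sin ((y - x) / 2)\<bar>" by (simp add: cos_diff_cos abs_mult)
      also have "\<dots> \<le> 2 * 1 * \<bar>(y - x) / 2\<bar>"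
        by (intro mult_mono abs_sin_x_le_abs_x abs_sin_le_one) auto
      finally have c: "\<bar>cos x - cos y\<bar> \<le> \<bar>x - y\<bar>" by (simp add: abs_minus_commute)
      have "\<bar>sin x - sin y\<bar> = 2 * \<bar>sin ((x - y) / 2)\<bar> * \<bar>cos ((x + y) / 2)\<bar>" by (simp add: sin_diff_sin abs_mult)
      also have "\<dots> \<le> 2 * \<bar>(x - y) / 2\<bar> * 1"
        by (intro mult_mono abs_sin_x_le_abs_x abs_cos_le_one) auto
      finally have s: "\<bar>sin x - sin y\<bar> \<le> \<bar>x - y\<bar>" by simp
      show "\<bar>cos x - cos y\<bar> \<le> min 2 \<bar>x - y\<bar>" using c abs_cos_le_one[of x] abs_cos_le_one[of y] by linarith
      show "\<bar>sin x - sin y\<bar> \<le> min 2 \<bar>x - y\<bar>" using s abs_sin_le_one[of x] abs_sin_le_one[of y] by linarith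
    qed
    from this[of "\<xi> * t" "\<xi> * t'"] have cs: "\<bar>cos (\<xi> * t) - cos (\<xi> * t')\<bar> \<le> m" "\<bar>sin (\<xi> * t) - sin (\<xi> * t')\<bar> \<le> m"
      by (simp_all add: m_def abs_mult flip: right_diff_distrib)
    have "W \<xi> t - W \<xi> t' = (cos (\<xi> * t) - cos (\<xi> * t')) *\<^sub>R VC \<xi> + (sin (\<xi> * t) - sin (\<xi> * t')) *\<^sub>R VS \<xi>"
      by (simp add: W scaleR_diff_left)
    also have "norm \<dots> \<le> m * norm (VC \<xi>) + m * norm (VS \<xi>)"
      using cs by (intro order_trans[OF norm_triangle_ineq] add_mono) (auto intro!: mult_right_mono)
    also have "\<dots> = m * (norm (VC \<xi>) + norm (VS \<xi>))" by (simp add: distrib_left)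
    also have "\<dots> \<le> m * (K * inverse (1 + \<xi>\<^sup>2))" by (intro mult_left_mono VCS) (simp add: m_def)
    finally show ?thesis by (simp add: m_def mult_ac)
  qed
  \<comment> \<open>The Gaussian mean of \<open>v\<close> at scale \<epsilon>, which tends to
    \<open>v t\<close> as \<epsilon> tends to 0.\<close>
  define G where "G \<epsilon> t = (\<integral>x. N x *\<^sub>R v (t + \<epsilon> * x) \<partial>lborel)" for \<epsilon> t
  have G: "G \<epsilon> t = (1 / sqrt (2 * pi)) *\<^sub>R (\<integral>\<xi>. N (\<epsilon> * \<xi>) *\<^sub>R W \<xi> t \<partial>lborel)" if \<epsilon>: "\<epsilon> > 0" for \<epsilon> t
  proof -
    define f where "f r x = (N x * cos ((r - t) / \<epsilon> * x)) *\<^sub>R v r" for r x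
    have fm: "(\<lambda>(r, x). f r x) \<in> borel_measurable (\<I> L \<Otimes>\<^sub>M lborel)" unfolding f_def by measurable
    have fb: "norm (f r x) \<le> V * N x" for r x
    proof -
      have "norm (f r x) = \<bar>cos ((r - t) / \<epsilon> * x)\<bar> * (N x * norm (v r))" using N0 by (simp add: f_def abs_mult)
      also have "\<dots> \<le> 1 * (N x * V)" using N0 V V_nonneg by (intro mult_mono) auto
      finally show ?thesis by (simp add: mult.commute)
    qed
    have fint: "integrable (\<I> L \<Otimes>\<^sub>M lborel) (\<lambda>(r, x). f r x)"
    proof (rule Bochner_Integration.integrable_bound[OF _ fm])
      show "integrable (\<I> L \<Otimes>\<^sub>M lborel) (\<lambda>(r, x). V * N x)"
      proof (rule P.Fubini_integrable)
        show "integrable (\<I> L) (\<lambda>r. \<integral>x. norm (case (r, x) of (r, x) \<Rightarrow> V * N x) \<partial>lborel)" by simp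
        show "AE r in \<I> L. integrable lborel (\<lambda>x. case (r, x) of (r, x) \<Rightarrow> V * N x)" using Nint by simp
      qed measurable
      show "AE p in \<I> L \<Otimes>\<^sub>M lborel. norm (case p of (r, x) \<Rightarrow> f r x) \<le> norm (case p of (r, x) \<Rightarrow> V * N x)"
        by (auto intro!: AE_I2 order_trans[OF fb])
    qed
    \<comment> \<open>Rescaling by \<epsilon> turns the mean into an integral over \<open>r\<close>,
      where the cosine representation of \<open>N\<close> applies. A second rescaling after Fubini
      leaves \<epsilon> only in the factor N (\<epsilon> \<xi>), which is at most 1.\<close>
    have "(\<integral>r. N ((r - t) / \<epsilon>) *\<^sub>R v r \<partial>lborel) = \<epsilon> *\<^sub>R G \<epsilon> t"
      using \<epsilon> by (subst lborel_integral_real_affine[of \<epsilon> _ t]) (simp_all add: G_def)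
    then have "G \<epsilon> t = (1 / \<epsilon>) *\<^sub>R (\<integral>r. N ((r - t) / \<epsilon>) *\<^sub>R v r \<partial>lborel)" using \<epsilon> by simp
    also have "(\<integral>r. N ((r - t) / \<epsilon>) *\<^sub>R v r \<partial>lborel) = (\<integral>r. N ((r - t) / \<epsilon>) *\<^sub>R v r \<partial>\<I> L)"
      unfolding integral_I by (intro Bochner_Integration.integral_cong refl) (use v0 in \<open>auto simp: indicator_def\<close>)
    also have "\<dots> = (\<integral>r. (1 / sqrt (2 * pi)) *\<^sub>R (\<integral>x. f r x \<partial>lborel) \<partial>\<I> L)"
    proof (intro Bochner_Integration.integral_cong refl)
      fix r
      have "integrable lborel (\<lambda>x. N x * cos ((r - t) / \<epsilon> * x))"
        by (rule Bochner_Integration.integrable_bound[OF Nint])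
           (auto simp: abs_mult intro!: AE_I2 mult_left_le abs_cos_le_one)
      then have "(\<integral>x. f r x \<partial>lborel) = (\<integral>x. N x * cos ((r - t) / \<epsilon> * x) \<partial>lborel) *\<^sub>R v r"
        by (simp add: f_def)
      then show "N ((r - t) / \<epsilon>) *\<^sub>R v r = (1 / sqrt (2 * pi)) *\<^sub>R (\<integral>x. f r x \<partial>lborel)"
        by (subst Neq) simp
    qed
    also have "\<dots> = (1 / sqrt (2 * pi)) *\<^sub>R (\<integral>r. (\<integral>x. f r x \<partial>lborel) \<partial>\<I> L)"
      by (rule integral_scaleR_right)
    also have "(\<integral>r. (\<integral>x. f r x \<partial>lborel) \<partial>\<I> L) = (\<integral>x. (\<integral>r. f r x \<partial>\<I> L) \<partial>lborel)"
      using P.Fubini_integral[OF fint] by simp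
    also have "\<dots> = (\<integral>x. N x *\<^sub>R W (x / \<epsilon>) t \<partial>lborel)"
    proof (intro Bochner_Integration.integral_cong refl)
      fix x
      have "(\<integral>r. f r x \<partial>\<I> L) = (\<integral>r. N x *\<^sub>R (cos (x / \<epsilon> * (r - t)) *\<^sub>R v r) \<partial>\<I> L)"
        by (intro Bochner_Integration.integral_cong refl) (simp add: f_def mult.commute)
      also have "\<dots> = N x *\<^sub>R (\<integral>r. cos (x / \<epsilon> * (r - t)) *\<^sub>R v r \<partial>\<I> L)" by (rule integral_scaleR_right)
      finally show "(\<integral>r. f r x \<partial>\<I> L) = N x *\<^sub>R W (x / \<epsilon>) t" by (simp only: W_def)
    qed
    also have "\<dots> = \<epsilon> *\<^sub>R (\<integral>\<xi>. N (\<epsilon> * \<xi>) *\<^sub>R W \<xi> t \<partial>lborel)"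
      using \<epsilon> by (subst lborel_integral_real_affine[of \<epsilon> _ 0]) simp_all
    finally show ?thesis using \<epsilon> by simp
  qed
  have Gd: "norm (G \<epsilon> t - G \<epsilon> t') \<le> K * oscillation_modulus (t - t')" if \<epsilon>: "\<epsilon> > 0" for \<epsilon>
  proof -
    have int: "integrable lborel (\<lambda>\<xi>. N (\<epsilon> * \<xi>) *\<^sub>R W \<xi> t)" for t
    proof (rule Bochner_Integration.integrable_bound)
      show "integrable lborel (\<lambda>\<xi>. K * inverse (1 + \<xi>\<^sup>2))" by (intro integrable_mult_right integrable_inverse_1_plus_square')
      show "AE \<xi> in lborel. norm (N (\<epsilon> * \<xi>) *\<^sub>R W \<xi> t) \<le> norm (K * inverse (1 + \<xi>\<^sup>2))"
      proof (rule AE_I2)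
        fix \<xi>
        have "norm (N (\<epsilon> * \<xi>) *\<^sub>R W \<xi> t) \<le> 1 * (K * inverse (1 + \<xi>\<^sup>2))"
          unfolding norm_scaleR using N0 N1 Wb by (intro mult_mono) auto
        then show "norm (N (\<epsilon> * \<xi>) *\<^sub>R W \<xi> t) \<le> norm (K * inverse (1 + \<xi>\<^sup>2))" by simp
      qed
      have "(\<lambda>\<xi>. N (\<epsilon> * \<xi>) *\<^sub>R W \<xi> t) \<in> borel_measurable borel"
        by (intro borel_measurable_scaleR Wm measurable_compose[OF _ Nm]) simp
      then show "(\<lambda>\<xi>. N (\<epsilon> * \<xi>) *\<^sub>R W \<xi> t) \<in> borel_measurable lborel" by simp
    qed
    have "G \<epsilon> t - G \<epsilon> t' = (1 / sqrt (2 * pi)) *\<^sub>R (\<integral>\<xi>. N (\<epsilon> * \<xi>) *\<^sub>R (W \<xi> t - W \<xi> t') \<partial>lborel)"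
      unfolding G[OF \<epsilon>] using int by (simp add: scaleR_diff_right)
    also have "norm \<dots> \<le> 1 * norm (\<integral>\<xi>. N (\<epsilon> * \<xi>) *\<^sub>R (W \<xi> t - W \<xi> t') \<partial>lborel)"
      unfolding norm_scaleR using pi1 by (intro mult_right_mono) auto
    also have "\<dots> \<le> 1 * (\<integral>\<xi>. K * (min 2 (\<bar>\<xi>\<bar> * \<bar>t - t'\<bar>) * inverse (1 + \<xi>\<^sup>2)) \<partial>lborel)"
    proof (intro mult_left_mono norm_integral_le)
      show "integrable lborel (\<lambda>\<xi>. K * (min 2 (\<bar>\<xi>\<bar> * \<bar>t - t'\<bar>) * inverse (1 + \<xi>\<^sup>2)))"
        by (intro integrable_mult_right oscillation_modulus_integrable)
      show "norm (N (\<epsilon> * \<xi>) *\<^sub>R (W \<xi> t - W \<xi> t')) \<le> K * (min 2 (\<bar>\<xi>\<bar> * \<bar>t - t'\<bar>) * inverse (1 + \<xi>\<^sup>2))" for \<xi>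
      proof -
        have "norm (N (\<epsilon> * \<xi>) *\<^sub>R (W \<xi> t - W \<xi> t')) \<le> 1 * (K * (min 2 (\<bar>\<xi>\<bar> * \<bar>t - t'\<bar>) * inverse (1 + \<xi>\<^sup>2)))"
          unfolding norm_scaleR using N0 N1 Wd by (intro mult_mono) auto
        then show ?thesis by simp
      qed
    qed simp
    finally show ?thesis by (simp add: oscillation_modulus_def)
  qed
  have lim: "(\<lambda>n. G (1 / Suc n) t) \<longlonglongrightarrow> v t" for t
  proof -
    have "(\<lambda>n. G (1 / Suc n) t) \<longlonglongrightarrow> (\<integral>x. N x *\<^sub>R v t \<partial>lborel)"
      unfolding G_def
    proof (rule integral_dominated_convergence[where w = "\<lambda>x. N x * V"])
      show "integrable lborel (\<lambda>x. N x * V)" using Nint by simp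
      show "AE x in lborel. (\<lambda>n. N x *\<^sub>R v (t + 1 / Suc n * x)) \<longlonglongrightarrow> N x *\<^sub>R v t"
      proof (rule AE_I2)
        fix x
        have "(\<lambda>n. t + 1 / Suc n * x) \<longlonglongrightarrow> t + 0 * x" by (intro tendsto_intros LIMSEQ_Suc[OF lim_inverse_n'])
        then have "(\<lambda>n. v (t + 1 / Suc n * x)) \<longlonglongrightarrow> v t"
          by (intro continuous_on_tendsto_compose[OF vc]) auto
        then show "(\<lambda>n. N x *\<^sub>R v (t + 1 / Suc n * x)) \<longlonglongrightarrow> N x *\<^sub>R v t" by (intro tendsto_intros)
      qed
      show "AE x in lborel. norm (N x *\<^sub>R v (t + 1 / Suc n * x)) \<le> N x * V" for n
        using N0 V by (auto intro!: AE_I2 mult_left_mono)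
      have "(\<lambda>x. N x *\<^sub>R v t) \<in> borel_measurable borel" "(\<lambda>x. N x *\<^sub>R v (t + 1 / Suc n * x)) \<in> borel_measurable borel" for n
        by measurable
      then show "(\<lambda>x. N x *\<^sub>R v t) \<in> borel_measurable lborel" "(\<lambda>x. N x *\<^sub>R v (t + 1 / Suc n * x)) \<in> borel_measurable lborel" for n
        by simp_all
    qed
    also have "(\<integral>x. N x *\<^sub>R v t \<partial>lborel) = v t" using Nint by (simp add: N_def)
    finally show ?thesis .
  qed
  show ?thesis
    by (rule LIMSEQ_le_const2[OF tendsto_norm[OF tendsto_diff[OF lim lim]]]) (use Gd in auto)
qed

section \<open>Smoothing of the resolvent family\<close>

text \<open>An exponent of at least 2 flattens the corner at 0: the difference quotient there is at
  most |h| ^ (n + 1).\<close>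

lemma DERIV_max_0_power:
  "((\<lambda>x::real. (max 0 x) ^ (n + 2)) has_real_derivative real (n + 2) * (max 0 x) ^ (n + 1)) (at x)"
proof -
  consider "x < 0" | "x = 0" | "x > 0" by linarith
  then show ?thesis
  proof cases
    case 1
    have "((\<lambda>x. 0) has_real_derivative 0) (at x)" by simp
    then have "((\<lambda>x::real. (max 0 x) ^ (n + 2)) has_real_derivative 0) (at x)"
      by (rule has_field_derivative_transform_within_open[of _ _ _ "{..<0}"]) (use 1 in auto)
    then show ?thesis using 1 by simp
  next
    case 2
    have "(\<lambda>h. ((max 0 (0 + h)) ^ (n + 2) - (max 0 0) ^ (n + 2)) / h) \<midarrow>0\<rightarrow> (0::real)"
    proof (rule Lim_null_comparison)
      show "\<forall>\<^sub>F h in at (0::real). norm (((max 0 (0 + h)) ^ (n + 2) - (max 0 0) ^ (n + 2)) / h) \<le> \<bar>h\<bar> ^ (n + 1)"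
      proof (rule always_eventually, intro allI)
        show "norm (((max 0 (0 + h)) ^ (n + 2) - (max 0 0) ^ (n + 2)) / h) \<le> \<bar>h\<bar> ^ (n + 1)" for h :: real
        proof (cases "h > 0")
          case False
          then have "norm (((max 0 (0 + h)) ^ (n + 2) - (max 0 0) ^ (n + 2)) / h) = 0" by simp
          also have "0 \<le> \<bar>h\<bar> ^ (n + 1)" by (rule zero_le_power) simp
          finally show ?thesis .
        qed simp
      qed
      have "(\<lambda>h::real. \<bar>h\<bar> ^ (n + 1)) \<midarrow>0\<rightarrow> \<bar>0\<bar> ^ (n + 1)" by (intro tendsto_intros)
      then show "(\<lambda>h::real. \<bar>h\<bar> ^ (n + 1)) \<midarrow>0\<rightarrow> 0" by simp
    qed
    then show ?thesis using 2 by (simp add: DERIV_def)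
  next
    case 3
    have "((\<lambda>x. x ^ (n + 2)) has_real_derivative real (n + 2) * x ^ (n + 1)) (at x)"
      using DERIV_pow[of "n + 2" x] by simp
    then have "((\<lambda>x::real. (max 0 x) ^ (n + 2)) has_real_derivative real (n + 2) * x ^ (n + 1)) (at x)"
      by (rule has_field_derivative_transform_within_open[of _ _ _ "{0<..}"]) (use 3 in auto)
    then show ?thesis using 3 by simp
  qed
qed

lemma DERIV_max_0_square [derivative_intros]:
  assumes "(f has_real_derivative d) (at x)"
  shows "((\<lambda>x::real. (max 0 (f x))\<^sup>2) has_real_derivative 2 * max 0 (f x) * d) (at x)"
  using DERIV_chain2[OF DERIV_max_0_power[of 0] assms] by (simp add: numeral_2_eq_2)

lemma DERIV_max_0_cube [derivative_intros]:
  assumes "(f has_real_derivative d) (at x)"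
  shows "((\<lambda>x::real. (max 0 (f x)) ^ 3) has_real_derivative 3 * (max 0 (f x))\<^sup>2 * d) (at x)"
  using DERIV_chain2[OF DERIV_max_0_power[of 1] assms] by (simp add: numeral_2_eq_2 numeral_3_eq_3)

text \<open>The factor \<open>t\<close> provides the value 0 at 0, the cube provides two continuous
  derivatives at \<open>L\<close>, and positivity on (0, L) allows division by the cutoff.\<close>

definition cutoff :: "real \<Rightarrow> real \<Rightarrow> real" where
  "cutoff L t = t * (max 0 (L - t)) ^ 3"
definition cutoff' :: "real \<Rightarrow> real \<Rightarrow> real" where
  "cutoff' L t = (max 0 (L - t)) ^ 3 - 3 * t * (max 0 (L - t))\<^sup>2"
definition cutoff'' :: "real \<Rightarrow> real \<Rightarrow> real" where
  "cutoff'' L t = - 6 * (max 0 (L - t))\<^sup>2 + 6 * t * max 0 (L - t)"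

lemma test_function_cutoff: "test_function L (cutoff L) (cutoff' L)" "test_function L (cutoff' L) (cutoff'' L)"
  unfolding test_function_def cutoff_def[abs_def] cutoff'_def[abs_def] cutoff''_def[abs_def]
  by (auto simp flip: has_real_derivative_iff_has_vector_derivative
      intro!: derivative_eq_intros continuous_intros simp: algebra_simps max_absorb1)

text \<open>Concentrated just to the right of \<open>a\<close>, to read off \<open>G\<close> near
  \<open>a\<close>. Squares suffice, as the estimate of the resolvent defect asks for one continuous
  derivative.\<close>

definition bump :: "real \<Rightarrow> real \<Rightarrow> real \<Rightarrow> real" where
  "bump a h t = (max 0 (t - a))\<^sup>2 * (max 0 (a + h - t))\<^sup>2"
definition bump' :: "real \<Rightarrow> real \<Rightarrow> real \<Rightarrow> real" where
  "bump' a h t = 2 * max 0 (t - a) * (max 0 (a + h - t))\<^sup>2 - (max 0 (t - a))\<^sup>2 * (2 * max 0 (a + h - t))"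

lemma test_function_bump: "test_function (a + h) (bump a h) (bump' a h)"
  unfolding test_function_def bump_def[abs_def] bump'_def[abs_def]
  by (auto simp flip: has_real_derivative_iff_has_vector_derivative
      intro!: derivative_eq_intros continuous_intros simp: algebra_simps max_absorb1)

text \<open>The derivative is the kernel times its logarithmic derivative - \<beta> + (\<nu> - 1) /
  t, which is negative by \<beta> \<ge> 0 and \<nu> < 1. Integrability at 0 rests on \<nu> >
  0.\<close>

lemma kernel_volterra:
  assumes \<alpha>: "\<alpha> > 0" and \<beta>: "\<beta> \<ge> 0" and \<nu>: "0 < \<nu>" "\<nu> < 1" and L: "0 < L"
  shows "volterra_kernel (kernel \<alpha> \<beta> \<nu>) (\<lambda>t. kernel \<alpha> \<beta> \<nu> t * (- \<beta> + (\<nu> - 1) / t)) L"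
proof
  have Gam: "Gamma \<nu> > 0" using \<nu> by (simp add: Gamma_real_pos)
  show nn: "0 \<le> kernel \<alpha> \<beta> \<nu> t" for t
    using \<alpha> Gam by (auto simp: kernel_def intro!: mult_nonneg_nonneg divide_nonneg_pos)
  show m[measurable]: "kernel \<alpha> \<beta> \<nu> \<in> borel_measurable borel" unfolding kernel_def by measurable
  show "integrable (\<I> L) (kernel \<alpha> \<beta> \<nu>)"
  proof -
    have "(\<lambda>x. x powr (\<nu> - 1)) integrable_on {0..L}"
      using \<nu> L by (intro integrable_on_powr_from_0) auto
    then have "set_integrable lebesgue {0..L} (\<lambda>x. x powr (\<nu> - 1))"
      by (rule nonnegative_absolutely_integrable_1) auto
    then have "integrable lborel (\<lambda>x. indicator {0..L} x *\<^sub>R x powr (\<nu> - 1))"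
      unfolding set_integrable_def by (subst (asm) integrable_completion) auto
    then have "integrable (\<I> L) (\<lambda>x. x powr (\<nu> - 1))" by (simp add: integrable_I)
    then have "integrable (\<I> L) (\<lambda>x. \<alpha> / Gamma \<nu> * x powr (\<nu> - 1))" by simp
    then show ?thesis
    proof (rule Bochner_Integration.integrable_bound)
      show "AE x in \<I> L. norm (kernel \<alpha> \<beta> \<nu> x) \<le> norm (\<alpha> / Gamma \<nu> * x powr (\<nu> - 1))"
        using \<alpha> \<beta> Gam by (auto simp: kernel_def abs_mult mult_left_le_one_le divide_right_mono intro!: AE_I2)
    qed (rule borel_measurable_I[OF m])
  qed
  show "(kernel \<alpha> \<beta> \<nu> has_real_derivative kernel \<alpha> \<beta> \<nu> t * (- \<beta> + (\<nu> - 1) / t)) (at t)" if "0 < t" for t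
  proof -
    have "((\<lambda>t. t powr (\<nu> - 1)) has_real_derivative (\<nu> - 1) * t powr (\<nu> - 1 - 1)) (at t)"
      using that by (rule has_real_derivative_powr)
    then have p: "((\<lambda>t. t powr (\<nu> - 1) / Gamma \<nu>) has_real_derivative (\<nu> - 1) * t powr (\<nu> - 1 - 1) / Gamma \<nu>) (at t)"
      by (rule DERIV_cdivide)
    have e: "((\<lambda>t. \<alpha> * exp (- \<beta> * t)) has_real_derivative \<alpha> * (exp (- \<beta> * t) * - \<beta>)) (at t)"
      by (auto intro!: derivative_eq_intros)
    have eq: "\<alpha> * (exp (- \<beta> * t) * - \<beta>) * (t powr (\<nu> - 1) / Gamma \<nu>) + (\<nu> - 1) * t powr (\<nu> - 1 - 1) / Gamma \<nu> * (\<alpha> * exp (- \<beta> * t))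
        = kernel \<alpha> \<beta> \<nu> t * (- \<beta> + (\<nu> - 1) / t)"
      using that Gam by (simp add: kernel_def powr_diff field_simps power2_eq_square)
    show ?thesis using DERIV_mult[OF e p] unfolding eq unfolding kernel_def[abs_def] .
  qed
  show "continuous_on {0<..} (\<lambda>t. kernel \<alpha> \<beta> \<nu> t * (- \<beta> + (\<nu> - 1) / t))"
    unfolding kernel_def using Gam by (intro continuous_intros) auto
  show "kernel \<alpha> \<beta> \<nu> t * (- \<beta> + (\<nu> - 1) / t) \<le> 0" if "0 < t" for t
  proof (rule mult_nonneg_nonpos[OF nn])
    have "(\<nu> - 1) / t \<le> 0" using that \<nu> by (intro divide_nonpos_pos) auto
    with \<beta> show "- \<beta> + (\<nu> - 1) / t \<le> 0" by linarith
  qed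
qed (rule L)

lemma lebesgue_on_eq_I:
  fixes f :: "real \<Rightarrow> 'b::{banach, second_countable_topology}"
  assumes [measurable]: "f \<in> borel_measurable borel" and "t \<le> L"
  shows "(LINT s|lebesgue_on {0..t}. f s) = (\<integral>s. (if s \<le> t then f s else 0) \<partial>\<I> L)"
proof -
  have "(LINT s|lebesgue_on {0..t}. f s) = (LINT s|lebesgue. indicator {0..t} s *\<^sub>R f s)"
    by (simp add: integral_restrict_space)
  also have "\<dots> = (LINT s|lborel. indicator {0..t} s *\<^sub>R f s)"
    using assms(1) by (intro integral_completion) simp
  also have "\<dots> = (\<integral>s. (if s \<le> t then f s else 0) \<partial>\<I> L)"
    unfolding integral_I using assms(2) by (intro Bochner_Integration.integral_cong refl) (auto simp: indicator_def)
  finally show ?thesis .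
qed

section \<open>Norm continuity and compactness of the resolvent family\<close>

locale resolvent_operators =
  fixes D :: "('w::{banach, second_countable_topology}) set" and A :: "'w \<Rightarrow> 'w"
    and \<kappa> \<kappa>' :: "real \<Rightarrow> real" and M :: real and G :: "real \<Rightarrow> 'w \<Rightarrow>\<^sub>L 'w" and R :: "real \<Rightarrow> 'w \<Rightarrow>\<^sub>L 'w"
  assumes volterra: "\<And>L. 0 < L \<Longrightarrow> volterra_kernel \<kappa> \<kappa>' L"
    and est: "vertical_estimate D A M TYPE('w)" and M1: "1 \<le> M"
    and res: "\<And>n. 0 < n \<Longrightarrow> real_resolvent D A n (R n)" and res_norm: "\<And>n. 0 < n \<Longrightarrow> norm (R n) \<le> M / n"
    and res_compact: "\<And>n. 0 < n \<Longrightarrow> compact_operator (R n)"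
    and dense: "closure D = UNIV"
    and G_continuous: "\<And>z. continuous_on {0..} (\<lambda>t. blinfun_apply (G t) z)"
    and G_0: "G 0 = id_blinfun"
    and G_domain: "\<And>z t. z \<in> D \<Longrightarrow> 0 \<le> t \<Longrightarrow> G t z \<in> D" and G_commute: "\<And>z t. z \<in> D \<Longrightarrow> 0 \<le> t \<Longrightarrow> G t (A z) = A (G t z)"
    and G_eq: "\<And>z t. z \<in> D \<Longrightarrow> 0 \<le> t \<Longrightarrow> G t z = z + (LINT s|lebesgue_on {0..t}.
           (1 + (LINT r|lebesgue_on {0..t - s}. \<kappa> r)) *\<^sub>R A (blinfun_apply (G s) z))"
begin

text \<open>\<open>max 0 t\<close> extends the orbit by a constant to negative times, for continuity
  on the whole line. The bound \<open>C * norm z\<close> contains no \<open>A z\<close>, which is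
  what makes density arguments possible.\<close>

lemma orbit:
  assumes z: "z \<in> D" and L: "0 < L" and bnd: "\<And>t. 0 \<le> t \<Longrightarrow> t \<le> L \<Longrightarrow> norm (G t) \<le> C"
  shows "volterra_orbit \<kappa> \<kappa>' L D A (R 1) (\<lambda>t. G (max 0 t) z) (\<lambda>t. G (max 0 t) (A z)) (C * norm z)"
proof -
  interpret volterra_kernel \<kappa> \<kappa>' L by (rule volterra[OF L])
  have cont: "continuous_on UNIV (\<lambda>t. G (max 0 t) x)" for x
    by (rule continuous_on_compose2[OF G_continuous]) (auto intro!: continuous_intros)
  have meas[measurable]: "(\<lambda>t. G (max 0 t) x) \<in> borel_measurable borel" for x
    using cont by (rule borel_measurable_continuous_onI)
  show ?thesis
  proof unfold_locales
    show "real_resolvent D A 1 (R 1)" by (rule res) simp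
    show "G (max 0 t) z = G (max 0 0) z + (\<integral>s. (if s \<le> t then (1 + (\<integral>r. (if r \<le> t - s then \<kappa> r else 0) \<partial>\<I> L)) *\<^sub>R G (max 0 s) (A z) else 0) \<partial>\<I> L)"
      if t: "0 \<le> t" "t \<le> L" for t
    proof -
      define a where "a u = 1 + (\<integral>r. (if r \<le> u then \<kappa> r else 0) \<partial>\<I> L)" for u
      have [measurable]: "a \<in> borel_measurable borel" unfolding a_def by measurable
      have "(LINT s|lebesgue_on {0..t}. (1 + (LINT r|lebesgue_on {0..t - s}. \<kappa> r)) *\<^sub>R A (blinfun_apply (G s) z))
          = (LINT s|lebesgue_on {0..t}. a (t - s) *\<^sub>R G (max 0 s) (A z))"
      proof (intro Bochner_Integration.integral_cong refl)
        fix s assume "s \<in> space (lebesgue_on {0..t})"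
        then have s: "0 \<le> s" "s \<le> t" by auto
        then have "(LINT r|lebesgue_on {0..t - s}. \<kappa> r) = (\<integral>r. (if r \<le> t - s then \<kappa> r else 0) \<partial>\<I> L)"
          using t by (intro lebesgue_on_eq_I) auto
        then show "(1 + (LINT r|lebesgue_on {0..t - s}. \<kappa> r)) *\<^sub>R A (blinfun_apply (G s) z) = a (t - s) *\<^sub>R G (max 0 s) (A z)"
          using s G_commute[OF z s(1)] by (simp add: a_def max_absorb2)
      qed
      also have "\<dots> = (\<integral>s. (if s \<le> t then a (t - s) *\<^sub>R G (max 0 s) (A z) else 0) \<partial>\<I> L)"
        using t by (intro lebesgue_on_eq_I) auto
      finally show ?thesis using G_eq[OF z t(1)] t unfolding a_def[symmetric] by (simp add: G_0 max_absorb2)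
    qed
    show "continuous_on UNIV (\<lambda>t. G (max 0 t) z)" "continuous_on UNIV (\<lambda>t. G (max 0 t) (A z))"
      by (rule cont)+
    show "norm (G (max 0 t) z) \<le> C * norm z" if "0 \<le> t" "t \<le> L" for t
      using bnd[OF that] that by (simp add: max_absorb2 order_trans[OF norm_blinfun mult_right_mono])
  qed (use G_domain[OF z] G_commute[OF z] in \<open>auto simp: max_absorb2\<close>)
qed

text \<open>Transfers to the operator norm the estimates that are linear in \<open>norm z\<close>
  and were obtained for orbits starting in \<open>D\<close>.\<close>

lemma dense_bound:
  assumes "\<And>z. z \<in> D \<Longrightarrow> norm (blinfun_apply X z) \<le> C * norm z" "0 \<le> C"
  shows "norm X \<le> C"
proof (rule norm_blinfun_bound[OF assms(2)])
  fix x
  have "x \<in> closure D" using dense by simp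
  then obtain z where z: "\<And>n. z n \<in> D" "z \<longlonglongrightarrow> x" by (auto simp: closure_sequential)
  have "(\<lambda>n. norm (X (z n))) \<longlonglongrightarrow> norm (X x)" "(\<lambda>n. C * norm (z n)) \<longlonglongrightarrow> C * norm x"
    by (intro tendsto_intros z(2))+
  then show "norm (X x) \<le> C * norm x" by (rule LIMSEQ_le) (use assms(1) z(1) in auto)
qed

lemma G_locally_bounded: obtains C where "C \<ge> 0" "\<And>t. 0 \<le> t \<Longrightarrow> t \<le> L \<Longrightarrow> norm (G t) \<le> C"
  using strongly_continuous_locally_bounded[OF G_continuous, of L] by auto

text \<open>
  On a vertical line the Laplace transform of \<open>t \<mapsto> cutoff L t *\<^sub>R G t z\<close> is quadratically small, uniformly
  for \<open>z\<close> in bounded sets, so \<open>G\<close> is continuous for the operator norm wherever the cutoff is positive.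
\<close>

lemma G_norm_isCont:
  assumes t0: "0 < t0"
  shows "isCont G t0"
proof -
  define L where "L = t0 + 1"
  have L: "0 < L" using t0 by (simp add: L_def)
  interpret V: volterra_kernel \<kappa> \<kappa>' L by (rule volterra[OF L])
  obtain C where C: "C \<ge> 0" "\<And>t. 0 \<le> t \<Longrightarrow> t \<le> L \<Longrightarrow> norm (G t) \<le> C" using G_locally_bounded by blast
  \<comment> \<open>The line Re \<mu> = b is fixed once for all \<open>z\<close>: a large
    \<open>b\<close> makes the memory term absorbable, and b \<ge> 1 gives 1 + \<xi>^2 \<le>
    |\<mu>|^2.\<close>
  have "\<forall>\<^sub>F b in at_top. V.damped_mass b < 1 / (8 * (4 * M + 1))"
    using M1 by (intro order_tendstoD(2)[OF V.damped_mass_tendsto_0]) auto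
  then have "\<forall>\<^sub>F b in at_top. V.damped_mass b < 1 / (8 * (4 * M + 1)) \<and> b \<ge> 1"
    using eventually_ge_at_top by (rule eventually_conj)
  then obtain b where b: "V.damped_mass b < 1 / (8 * (4 * M + 1))" "b \<ge> 1"
    using eventually_happens'[OF trivial_limit_at_top_linorder] by blast
  have small: "(4 * M + 1) * (4 * V.damped_mass b) \<le> 1/2"
    using b(1) M1 by (simp add: field_simps)
  obtain C1 where C1: "\<And>t. 0 \<le> t \<Longrightarrow> norm (cutoff' L t) \<le> C1"
    using test_function_bounded[OF test_function_cutoff(2)] by blast
  have cc: "continuous_on UNIV (cutoff'' L)" using test_function_cutoff(2) by (simp add: test_function_def)
  obtain C2' where C2': "\<And>t. t \<in> {0..L} \<Longrightarrow> norm (cutoff'' L t) \<le> C2'"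
    using continuous_on_Icc_bounded[OF cc, of 0 L] by blast
  define C2 where "C2 = max 0 C2'"
  have C2: "\<bar>cutoff'' L t\<bar> \<le> C2" if "0 \<le> t" for t
    using C2'[of t] that by (cases "t \<le> L") (auto simp: C2_def cutoff''_def)
  define K0 where "K0 = 8 * M * (M + 8 * (4 * M + 1) * (\<integral>\<sigma>. \<kappa> \<sigma> \<partial>\<I> L)) * (L * C2 + C1) * C"
  have "0 \<le> (\<integral>\<sigma>. \<kappa> \<sigma> \<partial>\<I> L)" using V.kernel_nonneg by (intro integral_nonneg_AE) auto
  then have K0: "0 \<le> K0"
    unfolding K0_def using M1 C(1) L C1[of 0] C2[of 0] order_trans[OF norm_ge_zero C1[of 0]]
    by (intro mult_nonneg_nonneg add_nonneg_nonneg) auto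
  \<comment> \<open>The exponential is the damping by Re \<mu> = b moved into the function, so that
    pure sine and cosine transforms remain.\<close>
  define p where "p t = exp (- (b * t)) * cutoff L (max 0 t)" for t
  have pc: "continuous_on UNIV p" unfolding p_def cutoff_def by (intro continuous_intros)
  have key: "norm (p t *\<^sub>R G (max 0 t) z - p t' *\<^sub>R G (max 0 t') z) \<le> 2 * K0 * norm z * oscillation_modulus (t - t')"
    if z: "z \<in> D" for z t t'
  proof -
    interpret O: volterra_orbit \<kappa> \<kappa>' L D A "R 1" "\<lambda>t. G (max 0 t) z" "\<lambda>t. G (max 0 t) (A z)" "C * norm z"
      by (rule orbit[OF z L C(2)])
    define v where "v t = p t *\<^sub>R G (max 0 t) z" for t
    have vc: "continuous_on UNIV v" unfolding v_def by (intro continuous_intros pc O.orbit_continuous)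
    have [measurable]: "v \<in> borel_measurable borel" using vc by (rule borel_measurable_continuous_onI)
    have v0: "v t = 0" if "t \<notin> {0..L}" for t using that by (auto simp: v_def p_def cutoff_def max_def)
    have "norm (v t - v t') \<le> (2 * K0 * norm z) * oscillation_modulus (t - t')"
    proof (rule modulus_of_transform_decay[OF vc v0])
      fix \<xi>
      define \<mu> where "\<mu> = Complex b \<xi>"
      have \<mu>: "0 < Re \<mu>" "Re \<mu> = b" using b(2) by (auto simp: \<mu>_def)
      have cm: "(cmod \<mu>)\<^sup>2 \<ge> 1 + \<xi>\<^sup>2" using b(2) by (simp add: \<mu>_def cmod_power2)
      have dec: "(cmod \<mu>)\<^sup>2 * norm (O.transform \<mu> (cutoff L)) \<le> K0 * norm z"
        using O.transform_decay_square[OF test_function_cutoff _ \<mu>(1) est M1 _ _ C2, of C1] small C1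
        by (simp add: \<mu>(2) cutoff_def K0_def mult_ac)
      have "(1 + \<xi>\<^sup>2) * norm (O.transform \<mu> (cutoff L)) \<le> K0 * norm z"
        using order_trans[OF mult_right_mono[OF cm norm_ge_zero] dec] .
      then have T: "norm (O.transform \<mu> (cutoff L)) \<le> K0 * norm z * inverse (1 + \<xi>\<^sup>2)"
        using sum_power2_gt_zero_iff[of 1 \<xi>] by (simp add: field_simps)
      have int: "integrable (\<I> L) (\<lambda>s. complexify (exp (- (\<mu> * of_real s)) * of_real (cutoff L s)) (G (max 0 s) z))"
      proof -
        have "continuous_on UNIV (\<lambda>s. complexify (exp (- (\<mu> * of_real s)) * of_real (cutoff L s)) (G (max 0 s) z))"
          unfolding cutoff_def by (intro cpx.continuous_on continuous_intros O.orbit_continuous)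
        then show ?thesis by (rule integrable_continuous_I)
      qed
      \<comment> \<open>On the line, the components of the transform are the cosine transform and
        minus the sine transform of \<open>v\<close>; estimating both costs the factor 2 in front of
        \<open>K0\<close>.\<close>
      have c: "fst (O.transform \<mu> (cutoff L)) = (\<integral>r. cos (\<xi> * r) *\<^sub>R v r \<partial>\<I> L)"
        unfolding O.transform_def integral_bounded_linear[OF bounded_linear_fst int, symmetric]
        by (intro Bochner_Integration.integral_cong refl)
           (simp add: complexify_def v_def p_def \<mu>_def Re_exp mult_ac max_absorb2)
      have s: "snd (O.transform \<mu> (cutoff L)) = - (\<integral>r. sin (\<xi> * r) *\<^sub>R v r \<partial>\<I> L)"
        unfolding O.transform_def integral_bounded_linear[OF bounded_linear_snd int, symmetric] integral_minus[symmetric]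
        by (intro Bochner_Integration.integral_cong refl)
           (simp add: complexify_def v_def p_def \<mu>_def Im_exp mult_ac max_absorb2)
      have "norm (fst (O.transform \<mu> (cutoff L))) \<le> norm (O.transform \<mu> (cutoff L))"
        "norm (snd (O.transform \<mu> (cutoff L))) \<le> norm (O.transform \<mu> (cutoff L))"
        by (metis norm_fst_le norm_snd_le prod.collapse)+
      then show "norm (\<integral>r. cos (\<xi> * r) *\<^sub>R v r \<partial>\<I> L) + norm (\<integral>r. sin (\<xi> * r) *\<^sub>R v r \<partial>\<I> L) \<le> 2 * K0 * norm z * inverse (1 + \<xi>\<^sup>2)"
        using T unfolding c s by simp
    qed
    then show ?thesis by (simp add: v_def)
  qed
  have H: "norm (p t *\<^sub>R G t - p t0 *\<^sub>R G t0) \<le> 2 * K0 * oscillation_modulus (t - t0)" if "0 < t" for t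
  proof (rule dense_bound)
    show "norm (blinfun_apply (p t *\<^sub>R G t - p t0 *\<^sub>R G t0) z) \<le> 2 * K0 * oscillation_modulus (t - t0) * norm z" if "z \<in> D" for z
      using key[OF that, of t t0] \<open>0 < t\<close> t0 by (simp add: blinfun.diff_left blinfun.scaleR_left max_absorb2 mult_ac)
    show "0 \<le> 2 * K0 * oscillation_modulus (t - t0)"
      unfolding oscillation_modulus_def using K0 by (intro mult_nonneg_nonneg integral_nonneg_AE) auto
  qed
  have "((\<lambda>t. p t *\<^sub>R G t - p t0 *\<^sub>R G t0) \<longlongrightarrow> 0) (at t0)"
  proof (rule Lim_null_comparison)
    show "\<forall>\<^sub>F t in at t0. norm (p t *\<^sub>R G t - p t0 *\<^sub>R G t0) \<le> 2 * K0 * oscillation_modulus (t - t0)"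
      using eventually_at_in_open'[of "{0<..}" t0] t0 by (auto elim!: eventually_mono intro: H)
    have "((\<lambda>t. oscillation_modulus (t - t0)) \<longlongrightarrow> 0) (at t0)"
      using oscillation_modulus_tendsto_0 LIM_offset_zero_iff[of t0 "\<lambda>t. oscillation_modulus (t - t0)" 0] by simp
    then show "((\<lambda>t. 2 * K0 * oscillation_modulus (t - t0)) \<longlongrightarrow> 0) (at t0)"
      using tendsto_mult_right_zero by blast
  qed
  then have pG: "((\<lambda>t. p t *\<^sub>R G t) \<longlongrightarrow> p t0 *\<^sub>R G t0) (at t0)" by (simp add: LIM_zero_iff)
  have pt: "(p \<longlongrightarrow> p t0) (at t0)" using pc by (simp add: continuous_on_eq_continuous_at isCont_def)
  have p0: "p t > 0" if "0 < t" "t < L" for t using that by (simp add: p_def cutoff_def)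
  have p00: "p t0 > 0" using t0 by (intro p0) (auto simp: L_def)
  have "((\<lambda>t. inverse (p t) *\<^sub>R (p t *\<^sub>R G t)) \<longlongrightarrow> inverse (p t0) *\<^sub>R (p t0 *\<^sub>R G t0)) (at t0)"
    using p00 by (intro tendsto_intros pt pG) auto
  then have "((\<lambda>t. inverse (p t) *\<^sub>R (p t *\<^sub>R G t)) \<longlongrightarrow> G t0) (at t0)" using p00 by simp
  moreover have "\<forall>\<^sub>F t in at t0. inverse (p t) *\<^sub>R (p t *\<^sub>R G t) = G t"
  proof -
    have "\<forall>\<^sub>F t in at t0. t \<in> {0<..<L}" using t0 by (intro eventually_at_in_open') (auto simp: L_def)
    then show ?thesis
    proof eventually_elim
      case (elim t)
      then have "p t > 0" by (intro p0) auto
      then show ?case by simp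
    qed
  qed
  ultimately show ?thesis unfolding isCont_def by (rule Lim_transform_eventually)
qed

text \<open>The error of the Yosida-type approximation n R(n) of the identity. Since n R(n) G t is
  compact, compactness of G t follows once \<open>defect n o\<^sub>L G t\<close> tends to 0 in
  norm.\<close>

definition defect :: "real \<Rightarrow> 'w \<Rightarrow>\<^sub>L 'w" where
  "defect n = n *\<^sub>R R n - id_blinfun"

lemma defect_apply: "defect n x = n *\<^sub>R R n x - x"
  by (simp add: defect_def blinfun.diff_left blinfun.scaleR_left)

lemma norm_defect: "0 < n \<Longrightarrow> norm (defect n) \<le> M + 1"
proof -
  assume n: "0 < n"
  have "norm (defect n) \<le> n * norm (R n) + norm (id_blinfun :: 'w \<Rightarrow>\<^sub>L 'w)"
    unfolding defect_def using n by (intro order_trans[OF norm_triangle_ineq4]) simp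
  also have "\<dots> \<le> n * (M / n) + 1"
    using n res_norm[OF n] by (intro add_mono mult_left_mono norm_blinfun_id_le) auto
  finally show ?thesis using n by simp
qed

lemma bump_mass_pos:
  assumes "0 \<le> a" "0 < h"
  shows "0 < (\<integral>s. exp (- (b * s)) * bump a h s \<partial>\<I> (a + h))"
proof -
  have c: "continuous_on UNIV (\<lambda>s. exp (- (b * s)) * bump a h s)" unfolding bump_def by (intro continuous_intros)
  have nn: "0 \<le> exp (- (b * s)) * bump a h s" for s by (simp add: bump_def)
  define q where "q = Inf ((\<lambda>s. exp (- (b * s)) * bump a h s) ` {a + h/4..a + 3*h/4})"
  have "compact {a + h/4..a + 3*h/4}" "{a + h/4..a + 3*h/4} \<noteq> {}" using assms by auto
  then obtain x where x: "x \<in> {a + h/4..a + 3*h/4}" "\<And>s. s \<in> {a + h/4..a + 3*h/4} \<Longrightarrow> exp (- (b * x)) * bump a h x \<le> exp (- (b * s)) * bump a h s"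
    using continuous_attains_inf[of "{a + h/4..a + 3*h/4}" "\<lambda>s. exp (- (b * s)) * bump a h s"] continuous_on_subset[OF c] by blast
  define c0 where "c0 = exp (- (b * x)) * bump a h x"
  have c0: "c0 > 0" using x(1) assms by (auto simp: c0_def bump_def)
  have "c0 * (h / 2) = (\<integral>s. c0 * indicator {a + h/4..a + 3*h/4} s \<partial>lborel)" using assms by simp
  also have "\<dots> \<le> (\<integral>s. indicator {0..a + h} s *\<^sub>R (exp (- (b * s)) * bump a h s) \<partial>lborel)"
  proof (rule integral_mono)
    show "integrable lborel (\<lambda>s. indicator {0..a + h} s *\<^sub>R (exp (- (b * s)) * bump a h s))"
      by (rule borel_integrable_compact) (auto intro: continuous_on_subset[OF c])
    show "c0 * indicator {a + h/4..a + 3*h/4} s \<le> indicator {0..a + h} s *\<^sub>R (exp (- (b * s)) * bump a h s)" for s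
      using x(2)[of s] nn[of s] assms by (auto simp: indicator_def c0_def)
  qed (simp add: integrable_indicator_iff emeasure_lborel_Icc_eq)
  finally have "c0 * (h / 2) \<le> (\<integral>s. exp (- (b * s)) * bump a h s \<partial>\<I> (a + h))" by (simp add: integral_I)
  moreover have "0 < c0 * (h / 2)" using c0 assms by simp
  ultimately show ?thesis by linarith
qed

text \<open>Average the orbit over [t0, t0 + h] with the weight exp (- (b s)) times the bump. This
  average is a transform at the real point \<open>b\<close>, so its defect is of order 1 / n; by
  norm continuity it differs from \<open>m\<close> times G t0 z by at most m e norm z.\<close>

lemma defect_tendsto_0:
  assumes t0: "0 < t0"
  shows "(\<lambda>n. norm (defect (Suc n) o\<^sub>L G t0)) \<longlonglongrightarrow> 0"
proof (rule LIMSEQ_I)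
  fix r :: real assume r: "0 < r"
  \<comment> \<open>As the defect has norm at most M + 1, replacing \<open>G t0\<close> by its
    average costs r / 2, which leaves r / 2 for the term of order 1 / n.\<close>
  define e where "e = r / (2 * (M + 1))"
  have "M + 1 > 0" using M1 by simp
  then have e: "e > 0" "(M + 1) * e = r / 2" using r by (auto simp: e_def field_simps)
  from G_norm_isCont[OF t0] e(1) obtain d where d: "d > 0" "\<And>s. dist s t0 < d \<Longrightarrow> dist (G s) (G t0) < e"
    unfolding continuous_at_eps_delta by blast
  define h where "h = d / 2"
  have h: "h > 0" "\<And>s. t0 \<le> s \<Longrightarrow> s \<le> t0 + h \<Longrightarrow> norm (G s - G t0) \<le> e"
    using d by (auto simp: h_def dist_norm intro: less_imp_le)
  define L where "L = t0 + h"
  have L: "0 < L" using t0 h by (simp add: L_def)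
  interpret V: volterra_kernel \<kappa> \<kappa>' L by (rule volterra[OF L])
  obtain C where C: "C \<ge> 0" "\<And>t. 0 \<le> t \<Longrightarrow> t \<le> L \<Longrightarrow> norm (G t) \<le> C" using G_locally_bounded by blast
  have "\<forall>\<^sub>F b in at_top. V.damped_mass b < 1 / 8"
    by (intro order_tendstoD(2)[OF V.damped_mass_tendsto_0]) auto
  then have "\<forall>\<^sub>F b in at_top. V.damped_mass b < 1 / 8 \<and> b \<ge> 1"
    using eventually_ge_at_top by (rule eventually_conj)
  then obtain b where b: "V.damped_mass b < 1 / 8" "b \<ge> 1"
    using eventually_happens'[OF trivial_limit_at_top_linorder] by blast
  have test: "test_function L (bump t0 h) (bump' t0 h)" unfolding L_def by (rule test_function_bump)
  obtain C0 where C0: "\<And>t. 0 \<le> t \<Longrightarrow> norm (bump t0 h t) \<le> C0" using test_function_bounded[OF test] by blast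
  have bc: "continuous_on UNIV (bump t0 h)" using test by (rule test_function_continuous)
  have bc': "continuous_on UNIV (bump' t0 h)" using test by (simp add: test_function_def)
  obtain C1' where C1': "\<And>t. t \<in> {0..L} \<Longrightarrow> norm (bump' t0 h t) \<le> C1'"
    using continuous_on_Icc_bounded[OF bc', of 0 L] by blast
  define C1 where "C1 = max 0 C1'"
  have C1: "\<bar>bump' t0 h t\<bar> \<le> C1" if "0 \<le> t" for t
    using C1'[of t] that by (cases "t \<le> L") (auto simp: C1_def bump'_def L_def)
  define m where "m = (\<integral>s. exp (- (b * s)) * bump t0 h s \<partial>\<I> L)"
  have m: "m > 0" unfolding m_def L_def using t0 h(1) by (intro bump_mass_pos) auto
  define X where "X = 4 * M * (8 * b * L * C0 + 2 * L * C1 + 2 * C0) * C"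
  have C0': "C0 \<ge> 0" using C0[of 0] norm_ge_zero order_trans by blast
  have X0: "X \<ge> 0" using M1 b(2) L C0' C1[of 0] C(1) unfolding X_def by (intro mult_nonneg_nonneg add_nonneg_nonneg) auto
  have main: "norm (defect n o\<^sub>L G t0) \<le> X / (n * m) + (M + 1) * e" if n: "0 < n" for n
  proof (rule dense_bound)
    show "0 \<le> X / (n * m) + (M + 1) * e" using X0 n m e M1 by (intro add_nonneg_nonneg divide_nonneg_pos) auto
    fix z assume z: "z \<in> D"
    interpret O: volterra_orbit \<kappa> \<kappa>' L D A "R 1" "\<lambda>t. G (max 0 t) z" "\<lambda>t. G (max 0 t) (A z)" "C * norm z"
      by (rule orbit[OF z L C(2)])
    define q where "q s = exp (- (b * s)) * bump t0 h s" for s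
    have qc: "continuous_on UNIV q" unfolding q_def by (intro continuous_intros bc)
    have q0: "0 \<le> q s" for s by (simp add: q_def bump_def)
    note int = integrable_continuous_I[of _ L]
    define T where "T = O.transform (of_real b) (bump t0 h)"
    define w where "w s = G (max 0 s) z" for s
    have wc: "continuous_on UNIV w" unfolding w_def by (rule O.orbit_continuous)
    have "norm (map_prod (\<lambda>x. n *\<^sub>R R n x - x) (\<lambda>x. n *\<^sub>R R n x - x) T) \<le> 4 * M / n * (8 * cmod (of_real b) * L * C0 + 2 * L * C1 + 2 * C0) * (C * norm z)"
      unfolding T_def using b C0 C1 by (intro O.transform_resolvent_defect[OF test _ _ res[OF n] res_norm[OF n] n]) auto
    also have "\<dots> = X * norm z / n" using b(2) by (simp add: X_def)
    finally have dT: "norm (defect n (fst T)) \<le> X * norm z / n"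
      using norm_fst_le[of "defect n (fst T)" "defect n (snd T)"] by (cases T) (simp add: defect_apply)
    have "integrable (\<I> L) (\<lambda>s. complexify (exp (- (of_real b * of_real s)) * of_real (bump t0 h s)) (w s))"
      by (intro int cpx.continuous_on continuous_intros bc wc)
    from integral_bounded_linear[OF bounded_linear_fst this]
    have fT: "fst T = (\<integral>s. q s *\<^sub>R w s \<partial>\<I> L)"
      by (simp add: T_def O.transform_def w_def complexify_def q_def Re_exp)
    have mq: "m = (\<integral>s. q s \<partial>\<I> L)" by (simp add: m_def q_def)
    have "fst T - m *\<^sub>R G t0 z = (\<integral>s. q s *\<^sub>R w s - q s *\<^sub>R G t0 z \<partial>\<I> L)"
      unfolding fT mq using int[OF qc] by (subst Bochner_Integration.integral_diff) (auto intro!: int continuous_intros qc wc)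
    also have "norm \<dots> \<le> (\<integral>s. q s * (e * norm z) \<partial>\<I> L)"
    proof (rule norm_integral_le)
      show "integrable (\<I> L) (\<lambda>s. q s * (e * norm z))" using int[OF qc] by simp
      show "norm (q s *\<^sub>R w s - q s *\<^sub>R G t0 z) \<le> q s * (e * norm z)" if "s \<in> space (\<I> L)" for s
      proof (cases "t0 \<le> s")
        case True
        have "norm (w s - G t0 z) = norm ((G s - G t0) z)" using that by (simp add: w_def blinfun.diff_left max_absorb2)
        also have "\<dots> \<le> e * norm z"
          using True that by (intro order_trans[OF norm_blinfun] mult_right_mono h(2)) (auto simp: L_def)
        finally show ?thesis using q0[of s] by (simp flip: scaleR_diff_right add: mult_left_mono)
      next
        case False
        then show ?thesis by (simp add: q_def bump_def)
      qed
    qed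
    also have "\<dots> = m * (e * norm z)" using int[OF qc] by (simp add: mq)
    finally have dif: "norm (fst T - m *\<^sub>R G t0 z) \<le> m * (e * norm z)" .
    have "m * norm (defect n (G t0 z)) = norm (defect n (fst T) - defect n (fst T - m *\<^sub>R G t0 z))"
      using m by (simp add: blinfun.diff_right blinfun.scaleR_right)
    also have "\<dots> \<le> X * norm z / n + (M + 1) * (m * (e * norm z))"
    proof (intro order_trans[OF norm_triangle_ineq4] add_mono dT)
      show "norm (defect n (fst T - m *\<^sub>R G t0 z)) \<le> (M + 1) * (m * (e * norm z))"
        using dif norm_defect[OF n] M1 by (intro order_trans[OF norm_blinfun] mult_mono) auto
    qed
    finally have "norm (defect n (G t0 z)) \<le> (X * norm z / n + (M + 1) * (m * (e * norm z))) / m"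
      using m by (simp add: field_simps)
    also have "\<dots> = (X / (n * m) + (M + 1) * e) * norm z" using m n by (simp add: field_simps)
    finally show "norm (blinfun_apply (defect n o\<^sub>L G t0) z) \<le> (X / (n * m) + (M + 1) * e) * norm z" by simp
  qed
  obtain N :: nat where N: "2 * X / (m * r) < N" using reals_Archimedean2 by blast
  show "\<exists>no. \<forall>n\<ge>no. norm (norm (defect (Suc n) o\<^sub>L G t0) - 0) < r"
  proof (intro exI allI impI)
    fix n assume "N \<le> n"
    then have "2 * X / (m * r) < Suc n" using N by simp
    then have "2 * X < Suc n * (m * r)" using m r by (subst (asm) pos_divide_less_eq) auto
    then have "X < r / 2 * (Suc n * m)" by (simp add: algebra_simps)
    then have "X / (Suc n * m) < r / 2" using m by (subst pos_divide_less_eq) auto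
    moreover have "norm (defect (Suc n) o\<^sub>L G t0) \<le> X / (Suc n * m) + (M + 1) * e" by (rule main) simp
    ultimately have "norm (defect (Suc n) o\<^sub>L G t0) < r" using e(2) by linarith
    then show "norm (norm (defect (Suc n) o\<^sub>L G t0) - 0) < r" by simp
  qed
qed

end

section \<open>Compactness of the convolution and steering\<close>

lemma complete_measure_lebesgue_on:
  assumes "S \<in> sets lebesgue"
  shows "complete_measure (lebesgue_on S)"
proof
  fix A B assume AB: "B \<subseteq> A" "A \<in> null_sets (lebesgue_on S)"
  then have A: "A \<in> null_sets lebesgue" "A \<subseteq> S" using assms by (auto simp: null_sets_restrict_space)
  then have "B \<in> null_sets lebesgue" using AB(1) completion.complete2 by blast
  then show "B \<in> sets (lebesgue_on S)" using A(2) AB(1) assms by (auto simp: sets_restrict_space_iff null_sets_def)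
qed

lemma (in complete_measure) measurable_AE_eq:
  assumes f: "f \<in> M \<rightarrow>\<^sub>M N" and eq: "AE x in M. f x = g x" and g: "g \<in> space M \<rightarrow> space N"
  shows "g \<in> M \<rightarrow>\<^sub>M N"
proof (rule measurableI)
  show "x \<in> space M \<Longrightarrow> g x \<in> space N" for x using g by auto
  fix A assume A: "A \<in> sets N"
  show "g -` A \<inter> space M \<in> sets M"
  proof (rule in_sets_AE[of "f -` A \<inter> space M"])
    show "AE x in M. (x \<in> f -` A \<inter> space M) = (x \<in> g -` A \<inter> space M)" using eq by eventually_elim auto
  qed (use f A in auto)
qed

text \<open>Approximate \<open>g\<close> by simple functions and pass to the limit in the continuous
  argument. On the exceptional null set \<open>h'\<close> freezes that argument at
  \<open>x0\<close>; completeness then allows changing back there.\<close>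

lemma (in complete_measure) measurable_Caratheodory:
  fixes h :: "'a \<Rightarrow> 'b::{second_countable_topology, metric_space} \<Rightarrow> 'c::metric_space"
  assumes cont: "AE s in M. continuous_on UNIV (h s)" and meas: "\<And>x. (\<lambda>s. h s x) \<in> borel_measurable M"
    and g: "g \<in> borel_measurable M"
  shows "(\<lambda>s. h s (g s)) \<in> borel_measurable M"
proof -
  obtain N where N: "N \<in> null_sets M" "{s \<in> space M. \<not> continuous_on UNIV (h s)} \<subseteq> N"
    using cont by (auto elim!: AE_E simp: null_sets_def)
  obtain x0 :: 'b where True by blast
  obtain F where F: "\<And>i. simple_function M (F i)" "\<And>s. s \<in> space M \<Longrightarrow> (\<lambda>i. F i s) \<longlonglongrightarrow> g s"
    using borel_measurable_implies_sequence_metric[OF g, of x0] by blast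
  define h' where "h' s x = (if s \<in> N then h s x0 else h s x)" for s x
  have [measurable]: "N \<in> sets M" using N(1) by auto
  note meas[measurable]
  have h'm: "(\<lambda>s. h' s x) \<in> borel_measurable M" for x unfolding h'_def by measurable
  have Fm: "(\<lambda>s. h' s (F i s)) \<in> borel_measurable M" for i
  proof (rule measurable_compose_countable'[of "F i ` space M" "\<lambda>x s. h' s x"])
    show "F i \<in> M \<rightarrow>\<^sub>M count_space (F i ` space M)"
      using F(1)[of i] by (subst measurable_count_space_eq2) (auto simp: simple_function_def)
    show "countable (F i ` space M)" using F(1)[of i] by (auto simp: simple_function_def countable_finite)
  qed (rule h'm)
  have "(\<lambda>s. h' s (g s)) \<in> borel_measurable M"
  proof (rule borel_measurable_LIMSEQ_metric[OF Fm])
    fix s assume s: "s \<in> space M"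
    show "(\<lambda>i. h' s (F i s)) \<longlonglongrightarrow> h' s (g s)"
    proof (cases "s \<in> N")
      case False
      then have "continuous_on UNIV (h s)" using N(2) s by auto
      then have "(\<lambda>i. h s (F i s)) \<longlonglongrightarrow> h s (g s)"
        by (rule continuous_on_tendsto_compose[OF _ F(2)[OF s]]) auto
      then show ?thesis using False by (simp add: h'_def)
    qed (simp add: h'_def)
  qed
  then show ?thesis
  proof (rule measurable_AE_eq)
    show "AE s in M. h' s (g s) = h s (g s)"
      using AE_not_in[OF N(1)] by eventually_elim (simp add: h'_def)
  qed simp
qed

lemma lebesgue_on_Icc_restrict:
  fixes f :: "real \<Rightarrow> 'b::{banach, second_countable_topology}"
  assumes "t \<le> T"
  shows "integrable (lebesgue_on {0..t}) f \<longleftrightarrow> integrable (lebesgue_on {0..T}) (\<lambda>s. if s \<le> t then f s else 0)"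
    and "(LINT s|lebesgue_on {0..t}. f s) = (LINT s|lebesgue_on {0..T}. (if s \<le> t then f s else 0))"
proof -
  have eq: "indicator {0..t} s *\<^sub>R f s = indicator {0..T} s *\<^sub>R (if s \<le> t then f s else 0)" for s
    using assms by (auto simp: indicator_def)
  show "integrable (lebesgue_on {0..t}) f \<longleftrightarrow> integrable (lebesgue_on {0..T}) (\<lambda>s. if s \<le> t then f s else 0)"
    by (simp add: integrable_restrict_space eq)
  show "(LINT s|lebesgue_on {0..t}. f s) = (LINT s|lebesgue_on {0..T}. (if s \<le> t then f s else 0))"
    by (simp add: integral_restrict_space eq)
qed

lemma AE_lebesgue_on_neq: "AE s in lebesgue_on {0..T}. s \<noteq> (t::real)"
proof (rule AE_I[of _ _ "{t} \<inter> {0..T}"])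
  show "emeasure (lebesgue_on {0..T}) ({t} \<inter> {0..T}) = 0" by (subst emeasure_restrict_space) (auto simp: Int_insert_left)
  show "{t} \<inter> {0..T} \<in> sets (lebesgue_on {0..T})" by (auto simp: sets_restrict_space_iff Int_insert_left)
qed auto

text \<open>The truncation jumps, as a function of its end point t, only where s = t, a null set;
  dominated convergence gives continuity and compactness of the interval the rest.\<close>

lemma indefinite_integral_uniformly_continuous:
  fixes \<gamma> :: "real \<Rightarrow> real"
  assumes \<gamma>: "integrable (lebesgue_on {0..T}) \<gamma>"
  shows "uniformly_continuous_on {a..b} (\<lambda>t. LINT s|lebesgue_on {0..T}. (if s \<le> t then \<gamma> s else 0))"
proof (rule compact_uniformly_continuous)
  show "continuous_on {a..b} (\<lambda>t. LINT s|lebesgue_on {0..T}. (if s \<le> t then \<gamma> s else 0))"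
  proof (rule continuous_at_imp_continuous_on, rule ballI, rule continuous_within_sequentiallyI)
    fix t and u :: "nat \<Rightarrow> real" assume u: "u \<longlonglongrightarrow> t"
    have [measurable]: "\<gamma> \<in> borel_measurable (lebesgue_on {0..T})" using \<gamma> by auto
    have le[measurable]: "Measurable.pred (lebesgue_on {0..T}) (\<lambda>s. s \<le> c)" for c :: real
    proof -
      have "{s \<in> space (lebesgue_on {0..T}). s \<le> c} = {..c} \<inter> {0..T}" by auto
      then show ?thesis unfolding pred_def by (auto simp: sets_restrict_space_iff)
    qed
    show "(\<lambda>n. LINT s|lebesgue_on {0..T}. (if s \<le> u n then \<gamma> s else 0)) \<longlonglongrightarrow> (LINT s|lebesgue_on {0..T}. (if s \<le> t then \<gamma> s else 0))"
    proof (rule integral_dominated_convergence[where w = "\<lambda>s. norm (\<gamma> s)"])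
      show "AE s in lebesgue_on {0..T}. (\<lambda>n. if s \<le> u n then \<gamma> s else 0) \<longlonglongrightarrow> (if s \<le> t then \<gamma> s else 0)"
        using AE_lebesgue_on_neq[where t = t and T = T]
      proof eventually_elim
        case (elim s)
        consider "s < t" | "s > t" using elim by linarith
        then show ?case
        proof cases
          case 1
          have "\<forall>\<^sub>F n in sequentially. (if s \<le> u n then \<gamma> s else 0) = (if s \<le> t then \<gamma> s else 0)"
            using order_tendstoD(1)[OF u 1] by eventually_elim (use 1 in auto)
          then show ?thesis by (rule tendsto_eventually)
        next
          case 2
          have "\<forall>\<^sub>F n in sequentially. (if s \<le> u n then \<gamma> s else 0) = (if s \<le> t then \<gamma> s else 0)"
            using order_tendstoD(2)[OF u 2] by eventually_elim (use 2 in auto)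
          then show ?thesis by (rule tendsto_eventually)
        qed
      qed
    qed (use \<gamma> in auto)
  qed
qed simp

section \<open>Convolution with the resolvent family\<close>

locale convolution_class = resolvent_operators +
  fixes T :: real and \<gamma> :: "real \<Rightarrow> real"
  assumes T: "0 < T" and \<gamma>_int: "integrable (lebesgue_on {0..T}) \<gamma>" and \<gamma>_nonneg: "\<And>t. t \<in> {0..T} \<Longrightarrow> 0 \<le> \<gamma> t"
begin

text \<open>The forcing terms f s (w s) are enlarged to everything dominated by \<gamma>, a class
  that does not depend on the state, so one compact set serves all states.\<close>

definition admissible :: "(real \<Rightarrow> 'a) \<Rightarrow> bool" where
  "admissible g \<longleftrightarrow> g \<in> borel_measurable (lebesgue_on {0..T}) \<and> (AE s in lebesgue_on {0..T}. norm (g s) \<le> \<gamma> s)"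

definition conv :: "(real \<Rightarrow> 'a) \<Rightarrow> real \<Rightarrow> 'a" where
  "conv g t = (LINT s|lebesgue_on {0..T}. (if s \<le> t then G (t - s) (g s) else 0))"

lemma le_measurable: "Measurable.pred (lebesgue_on {0..T}) (\<lambda>s. s \<le> c)" for c :: real
proof -
  have "{s \<in> space (lebesgue_on {0..T}). s \<le> c} = {..c} \<inter> {0..T}" by auto
  then show ?thesis unfolding pred_def by (auto simp: sets_restrict_space_iff)
qed

text \<open>Strong continuity of \<open>G\<close> makes G (t - s) x a Caratheodory function of s and
  x; \<open>max 0 (t - s)\<close> keeps the time argument in the range where continuity is
  known.\<close>

lemma conv_measurable:
  assumes "g \<in> borel_measurable (lebesgue_on {0..T})"
  shows "(\<lambda>s. if s \<le> t then G (t - s) (g s) else 0) \<in> borel_measurable (lebesgue_on {0..T})"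
proof -
  interpret complete_measure "lebesgue_on {0..T}" by (rule complete_measure_lebesgue_on) simp
  define h where "h s x = (if s \<le> t then G (t - s) x else 0)" for s x
  have hc: "continuous_on UNIV (h s)" for s
    unfolding h_def by (cases "s \<le> t") (auto intro!: continuous_intros)
  have "(\<lambda>s. h s (g s)) \<in> borel_measurable (lebesgue_on {0..T})"
  proof (rule measurable_Caratheodory[where h = h and g = g])
    show "AE s in lebesgue_on {0..T}. continuous_on UNIV (h s)"
      by (intro AE_I2 hc)
    show "(\<lambda>s. h s x) \<in> borel_measurable (lebesgue_on {0..T})" for x
    proof -
      have "continuous_on UNIV (\<lambda>s. G (max 0 (t - s)) x)"
        by (rule continuous_on_compose2[OF G_continuous]) (auto intro!: continuous_intros)
      then have "(\<lambda>s. G (max 0 (t - s)) x) \<in> borel_measurable borel" by (rule borel_measurable_continuous_onI)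
      then have [measurable]: "(\<lambda>s. G (max 0 (t - s)) x) \<in> borel_measurable (lebesgue_on {0..T})"
        by (intro measurable_restrict_space1 measurable_completion) simp
      note le_measurable[measurable]
      have "h s x = (if s \<le> t then G (max 0 (t - s)) x else 0)" for s by (simp add: h_def)
      then show ?thesis by simp
    qed
  qed (rule assms)
  then show ?thesis by (simp add: h_def)
qed

lemma G_bound_T: obtains C where "C \<ge> 0" "\<And>t. 0 \<le> t \<Longrightarrow> t \<le> T \<Longrightarrow> norm (G t) \<le> C"
  using G_locally_bounded by blast

lemma conv_integrable:
  assumes g: "integrable (lebesgue_on {0..T}) g" and t: "t \<le> T"
  shows "integrable (lebesgue_on {0..T}) (\<lambda>s. if s \<le> t then G (t - s) (g s) else 0)"
proof -
  obtain C where C: "C \<ge> 0" "\<And>t. 0 \<le> t \<Longrightarrow> t \<le> T \<Longrightarrow> norm (G t) \<le> C" using G_bound_T by blast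
  show ?thesis
  proof (rule Bochner_Integration.integrable_bound)
    show "integrable (lebesgue_on {0..T}) (\<lambda>s. C * norm (g s))" using g by simp
    show "AE s in lebesgue_on {0..T}. norm (if s \<le> t then G (t - s) (g s) else 0) \<le> norm (C * norm (g s))"
    proof (rule AE_I2)
      fix s assume "s \<in> space (lebesgue_on {0..T})"
      then show "norm (if s \<le> t then G (t - s) (g s) else 0) \<le> norm (C * norm (g s))"
        using C t by (auto intro!: order_trans[OF norm_blinfun] mult_right_mono)
    qed
  qed (use g in \<open>intro conv_measurable\<close>, auto)
qed

lemma admissible_integrable: "admissible g \<Longrightarrow> integrable (lebesgue_on {0..T}) g"
  unfolding admissible_def by (intro Bochner_Integration.integrable_bound[OF \<gamma>_int]) (auto elim!: eventually_mono)

lemma conv_diff_bound: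
  assumes C: "C \<ge> 0" "\<And>t. 0 \<le> t \<Longrightarrow> t \<le> T \<Longrightarrow> norm (G t) \<le> C"
    and g: "integrable (lebesgue_on {0..T}) g" "integrable (lebesgue_on {0..T}) g'" and t: "t \<le> T"
  shows "norm (conv g t - conv g' t) \<le> C * (LINT s|lebesgue_on {0..T}. norm (g s - g' s))"
proof -
  have "conv g t - conv g' t = (LINT s|lebesgue_on {0..T}. (if s \<le> t then G (t - s) (g s) else 0) - (if s \<le> t then G (t - s) (g' s) else 0))"
    unfolding conv_def by (rule Bochner_Integration.integral_diff[symmetric]) (intro conv_integrable g t)+
  also have "norm \<dots> \<le> (LINT s|lebesgue_on {0..T}. C * norm (g s - g' s))"
  proof (rule norm_integral_le)
    show "norm ((if s \<le> t then G (t - s) (g s) else 0) - (if s \<le> t then G (t - s) (g' s) else 0)) \<le> C * norm (g s - g' s)"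
      if "s \<in> space (lebesgue_on {0..T})" for s
    proof (cases "s \<le> t")
      case True
      have "norm (G (t - s) (g s - g' s)) \<le> C * norm (g s - g' s)"
        using C that True t by (intro order_trans[OF norm_blinfun] mult_right_mono) auto
      then show ?thesis using True by (simp add: blinfun.diff_right)
    qed (use C in simp)
  qed (use g in simp)
  finally show ?thesis by simp
qed

text \<open>Norm continuity of \<open>G\<close> is uniform only away from 0. Up to t - \<delta> it
  controls the difference; on the remaining stretch up to t' the values of \<open>G\<close> are
  merely bounded, but \<gamma> has little mass there. Both bounds see \<open>g\<close> only through
  \<gamma>.\<close>

lemma conv_equicontinuous:
  assumes e: "e > 0"
  shows "\<exists>d>0. \<forall>g t t'. admissible g \<longrightarrow> t \<in> {0..T} \<longrightarrow> t' \<in> {0..T} \<longrightarrow> \<bar>t - t'\<bar> < d \<longrightarrow> dist (conv g t) (conv g t') < e"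
proof -
  obtain C where C: "C \<ge> 0" "\<And>t. 0 \<le> t \<Longrightarrow> t \<le> T \<Longrightarrow> norm (G t) \<le> C" using G_bound_T by blast
  define \<Gamma> where "\<Gamma> t = (LINT s|lebesgue_on {0..T}. (if s \<le> t then \<gamma> s else 0))" for t
  define I where "I = (LINT s|lebesgue_on {0..T}. \<gamma> s)"
  have I: "I \<ge> 0" unfolding I_def using \<gamma>_nonneg by (intro integral_nonneg_AE) auto
  have \<Gamma>int: "integrable (lebesgue_on {0..T}) (\<lambda>s. if s \<le> t then \<gamma> s else 0)" for t
  proof (rule Bochner_Integration.integrable_bound[OF \<gamma>_int])
    note le_measurable[measurable]
    have [measurable]: "\<gamma> \<in> borel_measurable (lebesgue_on {0..T})" using \<gamma>_int by auto
    show "(\<lambda>s. if s \<le> t then \<gamma> s else 0) \<in> borel_measurable (lebesgue_on {0..T})" by measurable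
  qed auto
  define e1 where "e1 = e / (4 * (C + 1))"
  have e1: "e1 > 0" "2 * C * e1 < e / 2"
    using e C(1) by (auto simp: e1_def field_simps)
  \<comment> \<open>The interval starts at -1 because t - \<delta> may be negative; \<delta> \<le> 1
    keeps it inside.\<close>
  have "uniformly_continuous_on {-1..T} \<Gamma>"
    unfolding \<Gamma>_def[abs_def] by (rule indefinite_integral_uniformly_continuous[OF \<gamma>_int])
  from this[unfolded uniformly_continuous_on_def, rule_format, OF e1(1)]
  obtain d0 where d0: "d0 > 0" "\<And>x y. x \<in> {-1..T} \<Longrightarrow> y \<in> {-1..T} \<Longrightarrow> dist y x < d0 \<Longrightarrow> dist (\<Gamma> y) (\<Gamma> x) < e1"
    by blast
  \<comment> \<open>The stretch from t - \<delta> to t' has length below 2 \<delta>, hence the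
    demand 2 \<delta> < d0.\<close>
  define \<delta> where "\<delta> = min 1 (d0 / 4)"
  have \<delta>: "0 < \<delta>" "\<delta> \<le> 1" "2 * \<delta> < d0" using d0(1) by (auto simp: \<delta>_def)
  define e2 where "e2 = e / (4 * (I + 1))"
  have e2: "e2 > 0" "e2 * I < e / 2" using e I by (auto simp: e2_def field_simps intro!: add_pos_nonneg)
  have "uniformly_continuous_on {\<delta>..T} G"
    using \<delta>(1) by (intro compact_uniformly_continuous continuous_at_imp_continuous_on ballI G_norm_isCont) auto
  from this[unfolded uniformly_continuous_on_def, rule_format, OF e2(1)]
  obtain d1 where d1: "d1 > 0" "\<And>x y. x \<in> {\<delta>..T} \<Longrightarrow> y \<in> {\<delta>..T} \<Longrightarrow> dist y x < d1 \<Longrightarrow> dist (G y) (G x) < e2"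
    by blast
  define d where "d = min \<delta> d1"
  have d: "d > 0" "d \<le> \<delta>" "d \<le> d1" using \<delta> d1 by (auto simp: d_def)
  have key: "dist (conv g t) (conv g t') < e" if g: "admissible g" and t: "0 \<le> t" "t \<le> t'" "t' \<le> T" "t' - t < d" for g t t'
  proof -
    define N where "N s = (if s \<le> t - \<delta> then e2 * \<gamma> s else if s \<le> t' then 2 * C * \<gamma> s else 0)" for s
    have Neq: "N s = e2 * (if s \<le> t - \<delta> then \<gamma> s else 0) + 2 * C * ((if s \<le> t' then \<gamma> s else 0) - (if s \<le> t - \<delta> then \<gamma> s else 0))" for s
      using t \<delta> by (auto simp: N_def algebra_simps)
    have Nint: "integrable (lebesgue_on {0..T}) N" unfolding Neq[abs_def] using \<Gamma>int by (intro Bochner_Integration.integrable_add integrable_mult_right Bochner_Integration.integrable_diff)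
    have "(LINT s|lebesgue_on {0..T}. N s) = e2 * \<Gamma> (t - \<delta>) + 2 * C * (\<Gamma> t' - \<Gamma> (t - \<delta>))"
      unfolding Neq \<Gamma>_def using \<Gamma>int by simp
    also have "\<dots> < e / 2 + e / 2"
    proof (rule add_le_less_mono)
      have "\<Gamma> (t - \<delta>) \<le> I" unfolding \<Gamma>_def I_def by (rule integral_mono[OF \<Gamma>int \<gamma>_int]) (use \<gamma>_nonneg in auto)
      then have "e2 * \<Gamma> (t - \<delta>) \<le> e2 * I" using e2(1) by (intro mult_left_mono) auto
      then show "e2 * \<Gamma> (t - \<delta>) \<le> e / 2" using e2(2) by linarith
      have "dist (\<Gamma> t') (\<Gamma> (t - \<delta>)) < e1" using t \<delta> d by (intro d0(2)) (auto simp: dist_real_def)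
      then have "\<Gamma> t' - \<Gamma> (t - \<delta>) \<le> e1" by (simp add: dist_real_def)
      then have "2 * C * (\<Gamma> t' - \<Gamma> (t - \<delta>)) \<le> 2 * C * e1" using C(1) by (intro mult_left_mono) auto
      then show "2 * C * (\<Gamma> t' - \<Gamma> (t - \<delta>)) < e / 2" using e1(2) by linarith
    qed
    finally have NI: "(LINT s|lebesgue_on {0..T}. N s) < e" by simp
    note gi = admissible_integrable[OF g]
    have t0: "t \<le> T" using t by simp
    have "conv g t - conv g t' = (LINT s|lebesgue_on {0..T}. (if s \<le> t then G (t - s) (g s) else 0) - (if s \<le> t' then G (t' - s) (g s) else 0))"
      unfolding conv_def by (rule Bochner_Integration.integral_diff[symmetric]) (intro conv_integrable gi t t0)+
    also have "norm \<dots> \<le> (LINT s|lebesgue_on {0..T}. N s)"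
    proof (rule norm_integral_le_AE[OF Nint])
      show "AE s in lebesgue_on {0..T}. norm ((if s \<le> t then G (t - s) (g s) else 0) - (if s \<le> t' then G (t' - s) (g s) else 0)) \<le> N s"
        using conjunct2[OF g[unfolded admissible_def]] AE_space
      proof eventually_elim
        case (elim s)
        then have s: "0 \<le> s" "s \<le> T" "norm (g s) \<le> \<gamma> s" by auto
        consider "s \<le> t - \<delta>" | "t - \<delta> < s" "s \<le> t" | "t < s" "s \<le> t'" | "t' < s" by linarith
        then show ?case
        proof cases
          case 1
          have "dist (G (t - s)) (G (t' - s)) < e2"
            using 1 t s d by (intro d1(2)) (auto simp: dist_real_def)
          then have "norm ((G (t - s) - G (t' - s)) (g s)) \<le> e2 * \<gamma> s"
            using s e2(1) by (intro order_trans[OF norm_blinfun] mult_mono) (auto simp: dist_norm)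
          then show ?thesis using 1 t \<delta> by (simp add: N_def blinfun.diff_left)
        next
          case 2
          have "norm (G (t - s) (g s)) \<le> C * \<gamma> s" "norm (G (t' - s) (g s)) \<le> C * \<gamma> s"
            using 2 s t C by (auto intro!: order_trans[OF norm_blinfun] mult_mono)
          then show ?thesis using 2 t \<delta> norm_triangle_ineq4[of "G (t - s) (g s)" "G (t' - s) (g s)"] by (simp add: N_def)
        next
          case 3
          have "norm (G (t' - s) (g s)) \<le> C * \<gamma> s" "0 \<le> C * \<gamma> s"
            using 3 s t C \<gamma>_nonneg[of s] by (auto intro!: order_trans[OF norm_blinfun] mult_mono)
          then show ?thesis using 3 t \<delta> by (simp add: N_def)
        next
          case 4
          then show ?thesis using t \<delta> by (simp add: N_def)
        qed
      qed
    qed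
    finally show ?thesis using NI by (simp add: dist_norm)
  qed
  have "dist (conv g t) (conv g t') < e" if "admissible g" "t \<in> {0..T}" "t' \<in> {0..T}" "\<bar>t - t'\<bar> < d" for g t t'
    using key[of g t t'] key[of g t' t] that by (cases "t \<le> t'") (auto simp: dist_commute)
  then show ?thesis using d(1) by blast
qed

text \<open>n R(n) maps the bounded set of values into a compact set. The error is at most the
  integral of \<open>dn n\<close> against \<gamma>, which tends to 0 by dominated convergence and
  does not depend on \<open>g\<close>.\<close>

lemma conv_totally_bounded:
  assumes t: "t \<in> {0..T}" and e: "e > 0"
  shows "\<exists>k. finite k \<and> (\<forall>g. admissible g \<longrightarrow> (\<exists>x\<in>k. dist x (conv g t) < e))"
proof -
  obtain C where C: "C \<ge> 0" "\<And>t. 0 \<le> t \<Longrightarrow> t \<le> T \<Longrightarrow> norm (G t) \<le> C" using G_bound_T by blast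
  define I where "I = (LINT s|lebesgue_on {0..T}. \<gamma> s)"
  have I: "I \<ge> 0" unfolding I_def using \<gamma>_nonneg by (intro integral_nonneg_AE) auto
  have gm[measurable]: "\<gamma> \<in> borel_measurable (lebesgue_on {0..T})" using \<gamma>_int by auto
  \<comment> \<open>Zero at s = t, where \<open>G\<close> is the identity and the defect need not
    tend to 0 in norm; a single point does not affect the integral.\<close>
  define dn where "dn n s = indicator {..<t} s *\<^sub>R norm (defect (Suc n) o\<^sub>L G (t - s))" for n s
  have dnb: "norm (dn n s) \<le> (M + 1) * C" if "0 \<le> s" for n s
  proof (cases "s < t")
    case True
    have "norm (defect (Suc n) o\<^sub>L G (t - s)) \<le> (M + 1) * C"
      using True that t C norm_defect[of "Suc n"] M1 by (intro order_trans[OF norm_blinfun_compose] mult_mono) auto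
    then show ?thesis using True by (simp add: dn_def)
  qed (use M1 C in \<open>simp add: dn_def\<close>)
  have dnm: "dn n \<in> borel_measurable (lebesgue_on {0..T})" for n
  proof -
    have "isCont (\<lambda>s. norm (defect (Suc n) o\<^sub>L G (t - s))) s" if "s < t" for s
    proof -
      have "isCont (\<lambda>s. t - s) s" by (intro continuous_intros)
      then have "isCont (\<lambda>s. G (t - s)) s" by (rule isCont_o2) (use that in \<open>auto intro: G_norm_isCont\<close>)
      then show ?thesis by (intro continuous_intros bounded_bilinear.continuous[OF bounded_bilinear_blinfun_compose])
    qed
    then have "continuous_on {..<t} (\<lambda>s. norm (defect (Suc n) o\<^sub>L G (t - s)))"
      by (intro continuous_at_imp_continuous_on) auto
    then have "dn n \<in> borel_measurable borel"
      unfolding dn_def by (intro borel_measurable_continuous_on_indicator) auto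
    then show ?thesis by (intro measurable_restrict_space1 measurable_completion) simp
  qed
  have "(\<lambda>n. LINT s|lebesgue_on {0..T}. dn n s * \<gamma> s) \<longlonglongrightarrow> (LINT s|lebesgue_on {0..T}. 0)"
  proof (rule integral_dominated_convergence[where w = "\<lambda>s. (M + 1) * C * \<gamma> s"])
    show "AE s in lebesgue_on {0..T}. (\<lambda>n. dn n s * \<gamma> s) \<longlonglongrightarrow> 0"
    proof (rule AE_I2)
      fix s
      have "(\<lambda>n. dn n s) \<longlonglongrightarrow> 0"
      proof (cases "s < t")
        case True
        then show ?thesis using defect_tendsto_0[of "t - s"] by (simp add: dn_def)
      qed (simp add: dn_def)
      then show "(\<lambda>n. dn n s * \<gamma> s) \<longlonglongrightarrow> 0" by (rule tendsto_mult_left_zero)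
    qed
    show "AE s in lebesgue_on {0..T}. norm (dn n s * \<gamma> s) \<le> (M + 1) * C * \<gamma> s" for n
      using dnb \<gamma>_nonneg by (intro AE_I2) (auto simp: abs_mult intro!: mult_right_mono)
  qed (use dnm \<gamma>_int in auto)
  then have "(\<lambda>n. LINT s|lebesgue_on {0..T}. dn n s * \<gamma> s) \<longlonglongrightarrow> 0" by simp
  from LIMSEQ_D[OF this, of "e / 2"] e obtain n where n: "norm ((LINT s|lebesgue_on {0..T}. dn n s * \<gamma> s) - 0) < e / 2"
    by auto
  have dint: "integrable (lebesgue_on {0..T}) (\<lambda>s. dn n s * \<gamma> s)"
  proof (rule Bochner_Integration.integrable_bound)
    show "integrable (lebesgue_on {0..T}) (\<lambda>s. (M + 1) * C * \<gamma> s)" using \<gamma>_int by simp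
    show "AE s in lebesgue_on {0..T}. norm (dn n s * \<gamma> s) \<le> norm ((M + 1) * C * \<gamma> s)"
    proof (rule AE_I2)
      fix s assume "s \<in> space (lebesgue_on {0..T})"
      then have "norm (dn n s * \<gamma> s) \<le> (M + 1) * C * \<gamma> s"
        using dnb[of s n] \<gamma>_nonneg[of s] by (auto simp: abs_mult intro!: mult_right_mono)
      then show "norm (dn n s * \<gamma> s) \<le> norm ((M + 1) * C * \<gamma> s)"
        unfolding real_norm_def by (rule order_trans[OF _ abs_ge_self])
    qed
  qed (use dnm in measurable)
  \<comment> \<open>C I bounds the norm of the convolution; the added 1 keeps the factor positive,
    so that \<open>y\<close> can be scaled into the unit ball.\<close>
  define q where "q = (\<lambda>x. (real (Suc n) * (C * I + 1)) *\<^sub>R x) ` closure (blinfun_apply (R (Suc n)) ` cball 0 1)"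
  have "compact q" unfolding q_def
    using res_compact[of "Suc n"] by (intro compact_scaling) (simp add: compact_operator_def)
  moreover have "e / 2 > 0" using e by simp
  ultimately obtain k where k: "finite k" "q \<subseteq> (\<Union>x\<in>k. ball x (e / 2))"
    unfolding compact_eq_totally_bounded by blast
  have "\<exists>x\<in>k. dist x (conv g t) < e" if g: "admissible g" for g
  proof -
    note gi = admissible_integrable[OF g]
    have ci: "integrable (lebesgue_on {0..T}) (\<lambda>s. if s \<le> t then G (t - s) (g s) else 0)"
      using t by (intro conv_integrable gi) auto
    define y where "y = conv g t"
    have gae: "AE s in lebesgue_on {0..T}. norm (g s) \<le> \<gamma> s" using g by (simp add: admissible_def)
    have "norm y \<le> (LINT s|lebesgue_on {0..T}. C * \<gamma> s)"
      unfolding y_def conv_def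
    proof (rule norm_integral_le_AE)
      show "AE s in lebesgue_on {0..T}. norm (if s \<le> t then G (t - s) (g s) else 0) \<le> C * \<gamma> s"
        using gae AE_space
      proof eventually_elim
        case (elim s)
        then have "norm (g s) \<le> \<gamma> s" "0 \<le> s" "0 \<le> \<gamma> s" using \<gamma>_nonneg[of s] by auto
        then show ?case using C t by (auto intro!: order_trans[OF norm_blinfun] mult_mono)
      qed
    qed (use \<gamma>_int in simp)
    then have ny: "norm y \<le> C * I" by (simp add: I_def)
    have "defect (Suc n) y = (LINT s|lebesgue_on {0..T}. defect (Suc n) (if s \<le> t then G (t - s) (g s) else 0))"
      unfolding y_def conv_def by (rule integral_bounded_linear[OF blinfun.bounded_linear_right ci, symmetric])
    also have "norm \<dots> \<le> (LINT s|lebesgue_on {0..T}. dn n s * \<gamma> s)"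
    proof (rule norm_integral_le_AE[OF dint])
      show "AE s in lebesgue_on {0..T}. norm (defect (Suc n) (if s \<le> t then G (t - s) (g s) else 0)) \<le> dn n s * \<gamma> s"
        using gae AE_lebesgue_on_neq[where t = t and T = T]
      proof eventually_elim
        case (elim s)
        show ?case
        proof (cases "s < t")
          case True
          have "norm ((defect (Suc n) o\<^sub>L G (t - s)) (g s)) \<le> norm (defect (Suc n) o\<^sub>L G (t - s)) * \<gamma> s"
            using elim(1) by (intro order_trans[OF norm_blinfun] mult_left_mono) auto
          then show ?thesis using True by (simp add: dn_def)
        next
          case False
          then show ?thesis using elim(2) by (simp add: dn_def)
        qed
      qed
    qed
    finally have dy: "norm (defect (Suc n) y) < e / 2" using n by simp
    define \<rho> where "\<rho> = C * I + 1"
    have \<rho>: "\<rho> > 0" using C(1) I by (simp add: \<rho>_def add_nonneg_pos)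
    have "norm (y /\<^sub>R \<rho>) \<le> 1" using ny \<rho> by (simp add: \<rho>_def field_simps)
    then have "R (Suc n) (y /\<^sub>R \<rho>) \<in> closure (blinfun_apply (R (Suc n)) ` cball 0 1)"
      by (intro subsetD[OF closure_subset] imageI) simp
    then have "(real (Suc n) * \<rho>) *\<^sub>R R (Suc n) (y /\<^sub>R \<rho>) \<in> q" unfolding q_def \<rho>_def by (rule imageI)
    moreover have "real (Suc n) * \<rho> * inverse \<rho> = real (Suc n)" using \<rho> by simp
    ultimately have "real (Suc n) *\<^sub>R R (Suc n) y \<in> q" by (simp only: blinfun.scaleR_right scaleR_scaleR)
    then have "real (Suc n) *\<^sub>R R (Suc n) y \<in> (\<Union>x\<in>k. ball x (e / 2))" by (rule subsetD[OF k(2)])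
    then obtain x where x: "x \<in> k" "dist x (real (Suc n) *\<^sub>R R (Suc n) y) < e / 2" by (elim UN_E) (simp only: mem_ball)
    have "dist (real (Suc n) *\<^sub>R R (Suc n) y) y < e / 2" using dy by (simp add: dist_norm defect_apply)
    with x(2) have "dist x y < e" using dist_triangle[of x y "real (Suc n) *\<^sub>R R (Suc n) y"] by linarith
    with x(1) show ?thesis unfolding y_def by (rule bexI[rotated])
  qed
  with k(1) show ?thesis by blast
qed

lemma conv_continuous_on:
  assumes "admissible g"
  shows "continuous_on {0..T} (conv g)"
  unfolding continuous_on_iff
proof (intro ballI allI impI)
  fix t and e :: real assume t: "t \<in> {0..T}" and e: "0 < e"
  from conv_equicontinuous[OF e] obtain d where d: "d > 0"
    "\<And>t t'. t \<in> {0..T} \<Longrightarrow> t' \<in> {0..T} \<Longrightarrow> \<bar>t - t'\<bar> < d \<Longrightarrow> dist (conv g t) (conv g t') < e"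
    using assms by blast
  then show "\<exists>d>0. \<forall>t'\<in>{0..T}. dist t' t < d \<longrightarrow> dist (conv g t') (conv g t) < e"
    using t by (intro exI[of _ d]) (auto simp: dist_real_def)
qed

theorem conv_compact: "compact (closure ((\<lambda>g. clamp_bcontfun T (conv g)) ` {g. admissible g}))"
proof -
  have "compact (closure (clamp_bcontfun T ` (conv ` {g. admissible g})))"
  proof (rule compact_closure_clamp_bcontfun)
    show "continuous_on {0..T} w" if "w \<in> conv ` {g. admissible g}" for w
      using that conv_continuous_on by auto
    show "\<exists>d>0. \<forall>w\<in>conv ` {g. admissible g}. \<forall>s\<in>{0..T}. \<forall>t\<in>{0..T}. \<bar>s - t\<bar> < d \<longrightarrow> dist (w s) (w t) < e" if "e > 0" for e
      using conv_equicontinuous[OF that] by (elim exE conjE) (intro exI conjI ballI, assumption, auto)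
    show "\<exists>k. finite k \<and> (\<forall>w\<in>conv ` {g. admissible g}. \<exists>x\<in>k. dist x (w t) < e)" if "t \<in> {0..T}" "e > 0" for t e
      using conv_totally_bounded[OF that] by (elim exE conjE) (intro exI conjI ballI, assumption, auto)
  qed (use T in simp)
  then show ?thesis by (simp add: image_image)
qed

end

section \<open>Controls and steering of the semilinear system\<close>

lemma L2_control_scaleR: "L2_control T u \<Longrightarrow> L2_control T (\<lambda>s. c *\<^sub>R u s)"
  unfolding L2_control_def by (auto simp: power_mult_distrib)

lemma L2_control_add:
  assumes "L2_control T u" "L2_control T v"
  shows "L2_control T (\<lambda>s. u s + v s)"
  unfolding L2_control_def
proof
  have m[measurable]: "u \<in> borel_measurable (lebesgue_on {0..T})" "v \<in> borel_measurable (lebesgue_on {0..T})"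
    using assms by (auto simp: L2_control_def)
  show "(\<lambda>s. u s + v s) \<in> borel_measurable (lebesgue_on {0..T})" by measurable
  show "integrable (lebesgue_on {0..T}) (\<lambda>s. (norm (u s + v s))\<^sup>2)"
  proof (rule Bochner_Integration.integrable_bound)
    show "integrable (lebesgue_on {0..T}) (\<lambda>s. 2 * (norm (u s))\<^sup>2 + 2 * (norm (v s))\<^sup>2)"
      using assms by (intro Bochner_Integration.integrable_add integrable_mult_right) (auto simp: L2_control_def)
    show "AE s in lebesgue_on {0..T}. norm ((norm (u s + v s))\<^sup>2) \<le> norm (2 * (norm (u s))\<^sup>2 + 2 * (norm (v s))\<^sup>2)"
    proof (rule AE_I2)
      fix s
      have "(norm (u s + v s))\<^sup>2 \<le> (norm (u s) + norm (v s))\<^sup>2" by (intro power_mono norm_triangle_ineq) auto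
      also have "\<dots> \<le> 2 * (norm (u s))\<^sup>2 + 2 * (norm (v s))\<^sup>2"
        using sum_squares_bound[of "norm (u s)" "norm (v s)"] by (simp add: power2_sum)
      finally show "norm ((norm (u s + v s))\<^sup>2) \<le> norm (2 * (norm (u s))\<^sup>2 + 2 * (norm (v s))\<^sup>2)" by simp
    qed
  qed measurable
qed

lemma L2_control_sum:
  fixes u :: "nat \<Rightarrow> real \<Rightarrow> 'u::{real_inner, banach, second_countable_topology}"
  assumes "\<And>i. i < m \<Longrightarrow> L2_control T (u i)"
  shows "L2_control T (\<lambda>s. \<Sum>i<m. c i *\<^sub>R u i s)"
  using assms
proof (induction m)
  case 0
  show ?case by (simp add: L2_control_def)
next
  case (Suc m)
  then show ?case using L2_control_add[OF Suc.IH L2_control_scaleR[of T "u m" "c m"]] by simp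
qed

context convolution_class
begin

text \<open>Convergence in the supremum norm gives convergence of the forcing terms at almost every
  time, with 2 \<gamma> as majorant of the differences. The bound on \<open>G\<close> over [0, T]
  makes the convergence of the convolutions uniform in time.\<close>

lemma clamp_conv_continuous:
  fixes f :: "real \<Rightarrow> 'a \<Rightarrow> 'a"
  assumes f: "AE t in lebesgue_on {0..T}. continuous_on UNIV (f t)"
    "\<And>w. (\<lambda>t. f t w) \<in> borel_measurable (lebesgue_on {0..T})"
    "AE t in lebesgue_on {0..T}. \<forall>w. norm (f t w) \<le> \<gamma> t"
  shows "admissible (\<lambda>s. f s (apply_bcontfun w s))"
    and "continuous_on UNIV (\<lambda>w. clamp_bcontfun T (conv (\<lambda>s. f s (apply_bcontfun w s))))"
proof -
  interpret complete_measure "lebesgue_on {0..T}" by (rule complete_measure_lebesgue_on) simp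
  show adm: "admissible (\<lambda>s. f s (apply_bcontfun w s))" for w
    unfolding admissible_def
  proof
    have "apply_bcontfun w \<in> borel_measurable borel" by (rule borel_measurable_continuous_onI) simp
    then have "apply_bcontfun w \<in> borel_measurable (lebesgue_on {0..T})"
      by (intro measurable_restrict_space1 measurable_completion) simp
    with f(1,2) show "(\<lambda>s. f s (apply_bcontfun w s)) \<in> borel_measurable (lebesgue_on {0..T})"
      by (rule measurable_Caratheodory[where h = f])
    show "AE s in lebesgue_on {0..T}. norm (f s (apply_bcontfun w s)) \<le> \<gamma> s"
      using f(3) by eventually_elim auto
  qed
  obtain C where C: "C \<ge> 0" "\<And>t. 0 \<le> t \<Longrightarrow> t \<le> T \<Longrightarrow> norm (G t) \<le> C" using G_bound_T by blast
  show "continuous_on UNIV (\<lambda>w. clamp_bcontfun T (conv (\<lambda>s. f s (apply_bcontfun w s))))"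
  proof (rule continuous_on_sequentiallyI)
    fix u :: "nat \<Rightarrow> real \<Rightarrow>\<^sub>C 'a" and a assume u: "u \<longlonglongrightarrow> a"
    let ?N = "\<lambda>w s. f s (apply_bcontfun w s)"
    have "(\<lambda>n. LINT s|lebesgue_on {0..T}. norm (?N (u n) s - ?N a s)) \<longlonglongrightarrow> (LINT s|lebesgue_on {0..T}. 0)"
    proof (rule integral_dominated_convergence[where w = "\<lambda>s. 2 * \<gamma> s"])
      show "AE s in lebesgue_on {0..T}. (\<lambda>n. norm (?N (u n) s - ?N a s)) \<longlonglongrightarrow> 0"
        using f(1)
      proof eventually_elim
        case (elim s)
        have "(\<lambda>n. apply_bcontfun (u n) s) \<longlonglongrightarrow> apply_bcontfun a s"
          by (rule tendsto_uniform_limitI[OF tendsto_bcontfun_uniform_limit[OF u]]) simp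
        then have "(\<lambda>n. ?N (u n) s) \<longlonglongrightarrow> ?N a s" by (rule continuous_on_tendsto_compose[OF elim]) auto
        then show ?case by (simp add: LIM_zero tendsto_norm_zero)
      qed
      show "AE s in lebesgue_on {0..T}. norm (norm (?N (u n) s - ?N a s)) \<le> 2 * \<gamma> s" for n
        using f(3)
      proof eventually_elim
        case (elim s)
        have "norm (?N (u n) s) \<le> \<gamma> s" "norm (?N a s) \<le> \<gamma> s" using elim by auto
        then show ?case using norm_triangle_ineq4[of "?N (u n) s" "?N a s"] by simp
      qed
      show "(\<lambda>s. norm (?N (u n) s - ?N a s)) \<in> borel_measurable (lebesgue_on {0..T})" for n
        using adm[of "u n"] adm[of a] by (auto simp: admissible_def)
    qed (use \<gamma>_int in auto)
    then have "(\<lambda>n. C * (LINT s|lebesgue_on {0..T}. norm (?N (u n) s - ?N a s))) \<longlonglongrightarrow> 0"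
      by (intro tendsto_mult_right_zero) simp
    then have "(\<lambda>n. dist (clamp_bcontfun T (conv (?N (u n)))) (clamp_bcontfun T (conv (?N a)))) \<longlonglongrightarrow> 0"
    proof (rule Lim_null_comparison[rotated])
      have "dist (clamp_bcontfun T (conv (?N (u n)))) (clamp_bcontfun T (conv (?N a)))
          \<le> C * (LINT s|lebesgue_on {0..T}. norm (?N (u n) s - ?N a s))" for n
        using T C conv_diff_bound[OF C admissible_integrable[OF adm] admissible_integrable[OF adm]]
        by (intro dist_clamp_bcontfun conv_continuous_on adm) (auto simp: dist_norm)
      then show "\<forall>\<^sub>F n in sequentially. norm (dist (clamp_bcontfun T (conv (?N (u n)))) (clamp_bcontfun T (conv (?N a))))
          \<le> C * (LINT s|lebesgue_on {0..T}. norm (?N (u n) s - ?N a s))" by simp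
    qed
    then show "(\<lambda>n. clamp_bcontfun T (conv (?N (u n)))) \<longlonglongrightarrow> clamp_bcontfun T (conv (?N a))"
      by (simp add: tendsto_dist_iff[of _ "clamp_bcontfun T (conv (?N a))"])
  qed
qed

lemma conv_eq_lebesgue_on:
  assumes g: "admissible g" and t: "t \<in> {0..T}"
  shows "integrable (lebesgue_on {0..t}) (\<lambda>s. G (t - s) (g s))"
    and "(LINT s|lebesgue_on {0..t}. G (t - s) (g s)) = conv g t"
  using t conv_integrable[OF admissible_integrable[OF g], of t]
  by (simp_all add: lebesgue_on_Icc_restrict[of t T] conv_def)

text \<open>
  The control is a combination \<open>\<Sum>i. c i *\<^sub>R u i\<close> of controls \<open>u i\<close> steering the linear system from 0
  almost to \<open>\<zeta>\<^sub>1 - G T \<zeta> - y i\<close>, where the \<open>y i\<close> form a finite net of the possible final values of the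
  nonlinear part and the weights \<open>c i\<close> depend continuously on the state.
\<close>

theorem semilinear_steering:
  fixes f :: "real \<Rightarrow> 'a \<Rightarrow> 'a" and B :: "'u::{real_inner, banach, second_countable_topology} \<Rightarrow>\<^sub>L 'a"
  assumes f: "AE t in lebesgue_on {0..T}. continuous_on UNIV (f t)"
    "\<And>w. (\<lambda>t. f t w) \<in> borel_measurable (lebesgue_on {0..T})"
    "AE t in lebesgue_on {0..T}. \<forall>w. norm (f t w) \<le> \<gamma> t"
    and lin: "\<And>\<zeta>\<^sub>1 \<epsilon>. \<epsilon> > 0 \<Longrightarrow> \<exists>u w. L2_control T u \<and> mild_solution G B (\<lambda>t w. 0) T 0 u w \<and> norm (w T - \<zeta>\<^sub>1) < \<epsilon>"
    and \<epsilon>: "\<epsilon> > 0"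
  shows "\<exists>u w. L2_control T u \<and> mild_solution G B f T \<zeta> u w \<and> norm (w T - \<zeta>\<^sub>1) < \<epsilon>"
proof -
  define N where "N w s = f s (apply_bcontfun w s)" for w s
  define S where "S w = clamp_bcontfun T (conv (N w))" for w
  have adm: "admissible (N w)" for w unfolding N_def by (rule clamp_conv_continuous(1)[OF f])
  have S_cont: "continuous_on UNIV S" unfolding S_def[abs_def] N_def[abs_def] by (rule clamp_conv_continuous(2)[OF f])
  define C1 where "C1 = closure ((\<lambda>g. clamp_bcontfun T (conv g)) ` {g. admissible g})"
  have C1: "compact C1" unfolding C1_def by (rule conv_compact)
  have SC1: "S w \<in> C1" for w unfolding C1_def S_def using adm by (intro subsetD[OF closure_subset] imageI) simp
  have Sapp: "apply_bcontfun (S w) t = conv (N w) t" if "t \<in> {0..T}" for w t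
    unfolding S_def by (rule clamp_bcontfun_apply_mem[OF conv_continuous_on[OF adm] that])
  have TT: "T \<in> {0..T}" using T by simp
  have ev: "continuous_on X (\<lambda>w. apply_bcontfun w T)" for X :: "(real \<Rightarrow>\<^sub>C 'a) set"
  proof (rule continuous_on_subset[of UNIV], rule continuous_on_sequentiallyI)
    fix u :: "nat \<Rightarrow> real \<Rightarrow>\<^sub>C 'a" and a assume "u \<longlonglongrightarrow> a"
    then show "(\<lambda>n. apply_bcontfun (u n) T) \<longlonglongrightarrow> apply_bcontfun a T"
      by (intro tendsto_uniform_limitI[OF tendsto_bcontfun_uniform_limit]) auto
  qed simp
  \<comment> \<open>The final value of the nonlinear part, which the control has to
    compensate.\<close>
  define k where "k w = apply_bcontfun (S w) T" for w
  have k_cont: "continuous_on UNIV k"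
    unfolding k_def[abs_def] by (rule continuous_on_compose2[OF ev S_cont]) auto
  \<comment> \<open>One \<eta> for the net and one for the linear steering, and 2 \<eta> <
    \<epsilon>.\<close>
  define \<eta> where "\<eta> = \<epsilon> / 3"
  have \<eta>: "\<eta> > 0" using \<epsilon> by (simp add: \<eta>_def)
  have "compact ((\<lambda>w. apply_bcontfun w T) ` C1)" by (rule compact_continuous_image[OF ev C1])
  then obtain m and y :: "nat \<Rightarrow> 'a" where y: "\<And>x. x \<in> (\<lambda>w. apply_bcontfun w T) ` C1 \<Longrightarrow> \<exists>i<m. dist x (y i) < \<eta>"
    using totally_bounded_nat_net \<eta> by blast
  have ky: "\<exists>i<m. dist (k w) (y i) < \<eta>" for w unfolding k_def by (intro y imageI SC1)
  \<comment> \<open>The free evolution G T \<zeta> is put into the target, so that all linear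
    trajectories start at 0 and may be superposed.\<close>
  have "\<forall>i. \<exists>u v. L2_control T u \<and> mild_solution G B (\<lambda>t w. 0) T 0 u v \<and> norm (v T - (\<zeta>\<^sub>1 - G T \<zeta> - y i)) < \<eta>"
    using lin[OF \<eta>] by blast
  then obtain u v where uv: "\<And>i. L2_control T (u i)" "\<And>i. mild_solution G B (\<lambda>t w. 0) T 0 (u i) (v i)"
    "\<And>i. norm (v i T - (\<zeta>\<^sub>1 - G T \<zeta> - y i)) < \<eta>"
    by metis
  have v_cont: "continuous_on {0..T} (v i)" for i using uv(2)[of i] by (simp add: mild_solution_def)
  have v_int: "integrable (lebesgue_on {0..t}) (\<lambda>s. G (t - s) (B (u i s)))" if "t \<in> {0..T}" for i t
    using uv(2)[of i] that by (simp add: mild_solution_def)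
  have v_eq: "v i t = (LINT s|lebesgue_on {0..t}. G (t - s) (B (u i s)))" if "t \<in> {0..T}" for i t
    using uv(2)[of i] that by (simp add: mild_solution_def blinfun.zero_right)
  have z_cont: "continuous_on {0..T} (\<lambda>t. G t \<zeta>)" by (rule continuous_on_subset[OF G_continuous]) auto
  define V where "V i = clamp_bcontfun T (v i)" for i
  define Z where "Z = clamp_bcontfun T (\<lambda>t. G t \<zeta>)"
  have Vapp: "apply_bcontfun (V i) t = v i t" if "t \<in> {0..T}" for i t
    unfolding V_def by (rule clamp_bcontfun_apply_mem[OF v_cont that])
  have Zapp: "apply_bcontfun Z t = G t \<zeta>" if "t \<in> {0..T}" for t
    unfolding Z_def by (rule clamp_bcontfun_apply_mem[OF z_cont that])
  define c where "c w i = net_weight \<eta> m y i (k w)" for w i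
  \<comment> \<open>A fixed point is at once the state, the argument of the nonlinearity and the
    selector of the control weights.\<close>
  define F where "F w = Z + ((\<Sum>i<m. c w i *\<^sub>R V i) + S w)" for w
  have F_cont: "continuous_on UNIV F"
    unfolding F_def c_def by (intro continuous_intros continuous_on_net_weight k_cont ky S_cont)
  define H where "H = {\<Sum>j<m. c j *\<^sub>R V j |c. \<forall>j<m. 0 \<le> c j \<and> c j \<le> (1::real)}"
  have "compact {a + b |a b. a \<in> H \<and> b \<in> C1}"
    unfolding H_def by (intro compact_sums compact_unit_combinations C1)
  then have "compact ((+) Z ` {a + b |a b. a \<in> H \<and> b \<in> C1})" by (rule compact_translation)
  moreover have "F w \<in> (+) Z ` {a + b |a b. a \<in> H \<and> b \<in> C1}" for w
  proof -
    have "(\<Sum>i<m. c w i *\<^sub>R V i) \<in> H"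
      unfolding H_def
      by (rule CollectI, rule exI[of _ "c w"]) (auto simp: c_def net_weight_nonneg net_weight_le_1[OF ky])
    then show ?thesis unfolding F_def using SC1 by blast
  qed
  ultimately obtain w where w: "F w = w"
    using Schauder_fixed_point[OF F_cont] by blast
  define uu where "uu s = (\<Sum>i<m. c w i *\<^sub>R u i s)" for s
  have wt: "apply_bcontfun w t = G t \<zeta> + ((\<Sum>i<m. c w i *\<^sub>R v i t) + conv (N w) t)" if t: "t \<in> {0..T}" for t
  proof -
    have "apply_bcontfun (\<Sum>i<n. c w i *\<^sub>R V i) t = (\<Sum>i<n. c w i *\<^sub>R apply_bcontfun (V i) t)" for n
      by (induction n) auto
    then have "apply_bcontfun (F w) t = G t \<zeta> + ((\<Sum>i<m. c w i *\<^sub>R v i t) + conv (N w) t)"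
      by (simp add: F_def Zapp[OF t] Vapp[OF t] Sapp[OF t])
    then show ?thesis by (simp add: w)
  qed
  have mild: "mild_solution G B f T \<zeta> uu (apply_bcontfun w)"
    unfolding mild_solution_def
  proof (intro conjI ballI)
    fix t assume t: "t \<in> {0..T}"
    note ci = conv_eq_lebesgue_on[OF adm t, of w]
    have eq: "G (t - s) (B (uu s) + f s (apply_bcontfun w s)) = (\<Sum>i<m. c w i *\<^sub>R G (t - s) (B (u i s))) + G (t - s) (N w s)" for s
      by (simp add: uu_def N_def blinfun.add_right blinfun.sum_right blinfun.scaleR_right)
    have si: "integrable (lebesgue_on {0..t}) (\<lambda>s. \<Sum>i<m. c w i *\<^sub>R G (t - s) (B (u i s)))"
      by (intro Bochner_Integration.integrable_sum integrable_scaleR_right v_int t)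
    show "integrable (lebesgue_on {0..t}) (\<lambda>s. G (t - s) (B (uu s) + f s (apply_bcontfun w s)))"
      unfolding eq by (intro Bochner_Integration.integrable_add si ci(1))
    have "(LINT s|lebesgue_on {0..t}. G (t - s) (B (uu s) + f s (apply_bcontfun w s)))
        = (LINT s|lebesgue_on {0..t}. (\<Sum>i<m. c w i *\<^sub>R G (t - s) (B (u i s)))) + conv (N w) t"
      unfolding eq by (subst Bochner_Integration.integral_add[OF si ci(1)]) (simp add: ci(2))
    also have "(LINT s|lebesgue_on {0..t}. (\<Sum>i<m. c w i *\<^sub>R G (t - s) (B (u i s)))) = (\<Sum>i<m. c w i *\<^sub>R v i t)"
      using v_int[OF t] by (subst Bochner_Integration.integral_sum) (auto simp: v_eq[OF t])
    finally show "apply_bcontfun w t = G t \<zeta> + (LINT s|lebesgue_on {0..t}. G (t - s) (B (uu s) + f s (apply_bcontfun w s)))"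
      using wt[OF t] by simp
  qed simp
  have "norm (apply_bcontfun w T - \<zeta>\<^sub>1) \<le> \<eta> + \<eta>"
  proof -
    \<comment> \<open>\<open>z i\<close> is the nonlinear final value which the control
      \<open>u i\<close> compensates exactly; it lies within \<eta> of \<open>y i\<close>. The
      weighted average of the \<open>z i\<close> minus \<open>k w\<close> is precisely
      \<open>\<zeta>\<^sub>1\<close> minus the final state.\<close>
    define z where "z i = \<zeta>\<^sub>1 - G T \<zeta> - v i T" for i
    have "norm ((\<Sum>j<m. net_weight \<eta> m y j (k w) *\<^sub>R z j) - k w) \<le> \<eta> + \<eta>"
    proof (rule net_weight_average[OF ky])
      show "dist (y i) (z i) \<le> \<eta>" for i
        using uv(3)[of i] by (simp add: dist_norm z_def algebra_simps)
    qed
    moreover have E: "(\<Sum>j<m. net_weight \<eta> m y j (k w) *\<^sub>R z j) = \<zeta>\<^sub>1 - G T \<zeta> - (\<Sum>j<m. c w j *\<^sub>R v j T)"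
      using net_weight_sum[OF ky, of w] by (simp add: z_def c_def scaleR_diff_right sum_subtractf flip: scaleR_sum_left)
    have kw: "k w = conv (N w) T" by (simp add: k_def Sapp[OF TT])
    have "\<zeta>\<^sub>1 - apply_bcontfun w T = (\<zeta>\<^sub>1 - G T \<zeta> - (\<Sum>j<m. c w j *\<^sub>R v j T)) - k w"
      unfolding wt[OF TT] kw by (simp add: algebra_simps)
    then have "\<zeta>\<^sub>1 - apply_bcontfun w T = (\<Sum>j<m. net_weight \<eta> m y j (k w) *\<^sub>R z j) - k w"
      by (simp only: E)
    ultimately have "norm (\<zeta>\<^sub>1 - apply_bcontfun w T) \<le> \<eta> + \<eta>" by (simp only:)
    then show ?thesis by (simp add: norm_minus_commute)
  qed
  also have "\<eta> + \<eta> < \<epsilon>" using \<epsilon> by (simp add: \<eta>_def)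
  finally have "norm (apply_bcontfun w T - \<zeta>\<^sub>1) < \<epsilon>" .
  moreover have "L2_control T uu" unfolding uu_def[abs_def] by (rule L2_control_sum) (rule uv(1))
  ultimately show ?thesis using mild by blast
qed

end

theorem theorem3p11:
  fixes K :: "complex set"
    and cW :: "complex \<Rightarrow> 'w \<Rightarrow> 'w::{banach, second_countable_topology}"
    and cU :: "complex \<Rightarrow> 'u \<Rightarrow> 'u::{real_inner, banach, second_countable_topology}"
    and T \<alpha> \<beta> \<nu> :: real
    and D :: "'w set" and A :: "'w \<Rightarrow> 'w"
    and B :: "'u \<Rightarrow>\<^sub>L 'w"
    and f :: "real \<Rightarrow> 'w \<Rightarrow> 'w" and \<gamma> :: "real \<Rightarrow> real"
  assumes "scalar_field K"
    and "scalar_action K cW TYPE('w)" and "scalar_action K cU TYPE('u)"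
    and "super_reflexive K cW TYPE('w)"
    and "T > 0" and "\<alpha> > 0" and "\<beta> \<ge> 0" and "0 < \<nu>" and "\<nu> < 1"
    and "subspace_over K cW D" and "linear_over K cW cW D A"
    and "closed_operator D A" and "closure D = UNIV"
    and "sectorial K cW D A (\<nu> * pi / 2)"
    and "compact_resolvent K cW D A"
    and "linear_over K cU cW UNIV (blinfun_apply B)"
    and "AE t in lebesgue_on {0..T}. continuous_on UNIV (f t)"
    and "\<And>w. (\<lambda>t. f t w) \<in> borel_measurable (lebesgue_on {0..T})"
    and "\<And>t. t \<in> {0..T} \<Longrightarrow> 0 \<le> \<gamma> t" and "integrable (lebesgue_on {0..T}) \<gamma>"
    and "AE t in lebesgue_on {0..T}. \<forall>w. norm (f t w) \<le> \<gamma> t"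
    and "approximately_controllable K cW D A (kernel \<alpha> \<beta> \<nu>) B (\<lambda>t w. 0) T"
  shows "approximately_controllable K cW D A (kernel \<alpha> \<beta> \<nu>) B f T"
proof -
  obtain M where M: "M \<ge> 1" "vertical_estimate D A M TYPE('w)"
    "\<And>n. n > 0 \<Longrightarrow> \<exists>R. real_resolvent D A n R \<and> norm R \<le> M / n \<and> compact_operator R"
    using sectorial_compact_resolvent_real[OF assms(1,2,10,11,14,15)] by blast
  define R where "R n = (SOME R. real_resolvent D A n R \<and> norm R \<le> M / n \<and> compact_operator R)" for n
  have R: "real_resolvent D A n (R n) \<and> norm (R n) \<le> M / n \<and> compact_operator (R n)" if "n > 0" for n
    unfolding R_def using M(3)[OF that] by (rule someI_ex)
  \<comment> \<open>The family provided by the hypothesis on the linear system is also the witness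
    in the conclusion.\<close>
  obtain G where G: "resolvent_family K cW D A (kernel \<alpha> \<beta> \<nu>) G"
    and lin: "\<And>\<zeta> \<zeta>\<^sub>1 \<epsilon>. \<epsilon> > 0 \<Longrightarrow> \<exists>u w. L2_control T u \<and> mild_solution G B (\<lambda>t w. 0) T \<zeta> u w \<and> norm (w T - \<zeta>\<^sub>1) < \<epsilon>"
    using assms(22) unfolding approximately_controllable_def by blast
  interpret convolution_class D A "kernel \<alpha> \<beta> \<nu>" "\<lambda>t. kernel \<alpha> \<beta> \<nu> t * (- \<beta> + (\<nu> - 1) / t)" M G R T \<gamma>
  proof (intro convolution_class.intro resolvent_operators.intro convolution_class_axioms.intro)
    show "volterra_kernel (kernel \<alpha> \<beta> \<nu>) (\<lambda>t. kernel \<alpha> \<beta> \<nu> t * (- \<beta> + (\<nu> - 1) / t)) L" if "0 < L" for L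
      using assms(6-9) that by (intro kernel_volterra)
  qed (use M R G assms(5,13,19,20) in \<open>auto simp: resolvent_family_def\<close>)
  show ?thesis
    unfolding approximately_controllable_def
    using G semilinear_steering[OF assms(17,18,21) lin] by blast
qed

end
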